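(* For every $\theta<1/2$ and every $t\in\mathbb{R}$, $$\|(e^{-itH}u)^2\|_{\mathcal{H}^\theta(\mathbb{R})}<+\infty\quad\text{for }\mu\text{-almost every }u.$$
   Context: $H=-\partial_x^2+x^2$ on $L^2(\mathbb{R})$, with orthonormal basis of eigenfunctions the Hermite functions $h_n(x)=(-1)^nc_ne^{x^2/2}\frac{d^n}{dx^n}(e^{-x^2})$, $1/c_n=(n!)^{1/2}2^{n/2}\pi^{1/4}$, $Hh_n=\lambda_n^2h_n$, $\lambda_n=\sqrt{2n+1}$. $\mathcal{H}^\theta(\mathbb{R})$ has norm $\|u\|_{\mathcal{H}^\theta}=\|H^{\theta/2}u\|_{L^2}$. The measure $\mu$ is the law, on $\mathcal{H}^{-\sigma}(\mathbb{R})$ for any $\sigma>0$, of $\sum_{n\ge0}\frac{\sqrt2}{\lambda_n}g_n(\omega)h_n$, where $(g_n)$ are independent standard complex Gaussians (law $\frac1\pi e^{-|z|^2}dL(z)$ on $\mathbb C$). *)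

theory Defs
  imports "HOL-Probability.Probability"
begin

section \<open>Hermite functions and the harmonic oscillator\<close>

definition harmonic_oscillator :: "(real \<Rightarrow> real) \<Rightarrow> real \<Rightarrow> real" where
  "harmonic_oscillator f x = - deriv (deriv f) x + x\<^sup>2 * f x"

definition hermite_const :: "nat \<Rightarrow> real" where
  "hermite_const n = 1 / (sqrt (fact n) * 2 powr (real n / 2) * pi powr (1 / 4))"

definition hermite_fun :: "nat \<Rightarrow> real \<Rightarrow> real" where
  "hermite_fun n x =
     (-1) ^ n * hermite_const n * exp (x\<^sup>2 / 2) * (deriv ^^ n) (\<lambda>y. exp (- (y\<^sup>2))) x"

definition hermite_freq :: "nat \<Rightarrow> real" where
  "hermite_freq n = sqrt (2 * real n + 1)"

fun gauss_deriv :: "nat \<Rightarrow> real \<Rightarrow> real" where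
  "gauss_deriv 0 x = exp (- (x\<^sup>2))"
| "gauss_deriv (Suc 0) x = - 2 * x * exp (- (x\<^sup>2))"
| "gauss_deriv (Suc (Suc n)) x =
     - 2 * x * gauss_deriv (Suc n) x - 2 * (real n + 1) * gauss_deriv n x"

lemma gauss_deriv_has_derivative:
  "(gauss_deriv n has_field_derivative gauss_deriv (Suc n) x) (at x)"
proof (induction n arbitrary: x rule: induct_nat_012)
  case 0
  have "gauss_deriv 0 = (\<lambda>x. exp (- (x\<^sup>2)))" by auto
  then show ?case by (auto intro!: derivative_eq_intros)
next
  case 1
  have "gauss_deriv (Suc 0) = (\<lambda>x. - 2 * x * exp (- (x\<^sup>2)))" by auto
  then show ?case
    by (auto intro!: derivative_eq_intros simp: algebra_simps)
next
  case (ge2 n)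
  have eq: "gauss_deriv (Suc (Suc n)) =
      (\<lambda>x. - 2 * x * gauss_deriv (Suc n) x - 2 * (real n + 1) * gauss_deriv n x)" by auto
  have "((\<lambda>x. - 2 * x * gauss_deriv (Suc n) x - 2 * (real n + 1) * gauss_deriv n x)
      has_field_derivative
        (- 2 * gauss_deriv (Suc n) x - 2 * x * gauss_deriv (Suc (Suc n)) x)
        - 2 * (real n + 1) * gauss_deriv (Suc n) x) (at x)"
    using ge2 by (auto intro!: derivative_eq_intros simp del: gauss_deriv.simps)
  moreover have "(- 2 * gauss_deriv (Suc n) x - 2 * x * gauss_deriv (Suc (Suc n)) x)
        - 2 * (real n + 1) * gauss_deriv (Suc n) x = gauss_deriv (Suc (Suc (Suc n))) x"
    by (simp only: gauss_deriv.simps(3)[of "Suc n"]) (simp add: algebra_simps)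
  ultimately show ?case by (simp only: eq)
qed

lemma gauss_deriv_eq: "(deriv ^^ n) (\<lambda>y. exp (- (y\<^sup>2))) = gauss_deriv n"
proof (induction n)
  case (Suc n)
  then show ?case
    by (auto simp del: gauss_deriv.simps intro!: DERIV_imp_deriv gauss_deriv_has_derivative)
qed auto

lemma hermite_eigenfunction:
  "harmonic_oscillator (hermite_fun n) x = (hermite_freq n)\<^sup>2 * hermite_fun n x"
proof -
  define a where "a = (-1) ^ n * hermite_const n"
  have h: "hermite_fun n = (\<lambda>x. a * exp (x\<^sup>2 / 2) * gauss_deriv n x)"
    by (auto simp: hermite_fun_def gauss_deriv_eq a_def)
  have "(hermite_fun n has_field_derivative
      a * exp (x\<^sup>2 / 2) * (x * gauss_deriv n x + gauss_deriv (Suc n) x)) (at x)" for x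
    unfolding h using gauss_deriv_has_derivative
    by (auto intro!: derivative_eq_intros simp: algebra_simps simp del: gauss_deriv.simps)
  then have d1: "deriv (hermite_fun n) =
      (\<lambda>x. a * exp (x\<^sup>2 / 2) * (x * gauss_deriv n x + gauss_deriv (Suc n) x))"
    by (auto intro!: DERIV_imp_deriv)
  have "(deriv (hermite_fun n) has_field_derivative
      a * exp (x\<^sup>2 / 2) * (x * (x * gauss_deriv n x + gauss_deriv (Suc n) x) + gauss_deriv n x
        + x * gauss_deriv (Suc n) x + gauss_deriv (Suc (Suc n)) x)) (at x)"
    unfolding d1 using gauss_deriv_has_derivative
    by (auto intro!: derivative_eq_intros simp: algebra_simps simp del: gauss_deriv.simps)
  then have d2: "deriv (deriv (hermite_fun n)) x =
      a * exp (x\<^sup>2 / 2) * (x * (x * gauss_deriv n x + gauss_deriv (Suc n) x) + gauss_deriv n x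
        + x * gauss_deriv (Suc n) x + gauss_deriv (Suc (Suc n)) x)"
    by (rule DERIV_imp_deriv)
  show ?thesis
    unfolding harmonic_oscillator_def d2
    by (simp add: h hermite_freq_def algebra_simps power2_eq_square)
qed


section \<open>Schwartz functions and tempered distributions\<close>

definition vderiv :: "(real \<Rightarrow> complex) \<Rightarrow> real \<Rightarrow> complex" where
  "vderiv \<phi> x = vector_derivative \<phi> (at x)"

definition schwartz :: "(real \<Rightarrow> complex) \<Rightarrow> bool" where
  "schwartz \<phi> \<longleftrightarrow>
     (\<forall>k x. (vderiv ^^ k) \<phi> differentiable (at x)) \<and>
     (\<forall>j k. bounded (range (\<lambda>x. x ^ j *\<^sub>R (vderiv ^^ k) \<phi> x)))"

definition schwartz_seminorm :: "nat \<Rightarrow> nat \<Rightarrow> (real \<Rightarrow> complex) \<Rightarrow> real" where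
  "schwartz_seminorm j k \<phi> = (SUP x. norm (x ^ j *\<^sub>R (vderiv ^^ k) \<phi> x))"

text \<open>Distributions are functionals on all functions \<^typ>\<open>real \<Rightarrow> complex\<close> that vanish, by
  convention, off the Schwartz space. The pairing is bilinear (no conjugation); as the Hermite
  functions are real-valued, \<open>T h\<^sub>n\<close> is the Hermite coefficient of \<open>T\<close>.\<close>

type_synonym distribution = "(real \<Rightarrow> complex) \<Rightarrow> complex"

definition tempered :: "distribution \<Rightarrow> bool" where
  "tempered T \<longleftrightarrow>
     (\<forall>\<phi>. \<not> schwartz \<phi> \<longrightarrow> T \<phi> = 0) \<and>
     (\<forall>\<phi> \<psi> a b. schwartz \<phi> \<longrightarrow> schwartz \<psi> \<longrightarrow>
        T (\<lambda>x. a * \<phi> x + b * \<psi> x) = a * T \<phi> + b * T \<psi>) \<and>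
     (\<exists>C K. \<forall>\<phi>. schwartz \<phi> \<longrightarrow>
        norm (T \<phi>) \<le> C * (\<Sum>j\<le>K. \<Sum>k\<le>K. schwartz_seminorm j k \<phi>))"

definition regular :: "(real \<Rightarrow> complex) \<Rightarrow> distribution" where
  "regular f \<phi> = (if schwartz \<phi> then (\<integral>x. f x * \<phi> x \<partial>lborel) else 0)"

definition represents :: "(real \<Rightarrow> complex) \<Rightarrow> distribution \<Rightarrow> bool" where
  "represents f T \<longleftrightarrow>
     f \<in> borel_measurable lborel \<and>
     (\<forall>\<phi>. schwartz \<phi> \<longrightarrow> integrable lborel (\<lambda>x. f x * \<phi> x)) \<and>
     tempered T \<and> T = regular f"

text \<open>A distribution has a square only if it is (given by) a function; the square is then the
  distribution given by the pointwise square.\<close>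

definition has_square :: "distribution \<Rightarrow> distribution \<Rightarrow> bool" where
  "has_square T S \<longleftrightarrow> (\<exists>f. represents f T \<and> represents (\<lambda>x. (f x)\<^sup>2) S)"

text \<open>The representing function is unique up to null sets, so the infimum ranges over at most one
  value; it is \<open>\<infinity>\<close> if \<open>T\<close> is not in \<open>L\<^sup>2\<close>.\<close>

definition L2_norm :: "distribution \<Rightarrow> ennreal" where
  "L2_norm T = Inf {ennreal (sqrt (\<integral>x. (norm (f x))\<^sup>2 \<partial>lborel)) | f.
     represents f T \<and> integrable lborel (\<lambda>x. (norm (f x))\<^sup>2)}"


section \<open>Functional calculus of the harmonic oscillator and Sobolev spaces\<close>

abbreviation hermite_cfun :: "nat \<Rightarrow> real \<Rightarrow> complex" where
  "hermite_cfun n \<equiv> (\<lambda>x. complex_of_real (hermite_fun n x))"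

text \<open>\<open>F(H) T = \<Sum>\<^sub>n F(\<lambda>\<^sub>n\<^sup>2) \<langle>T, h\<^sub>n\<rangle> h\<^sub>n\<close>, tested against \<open>\<phi>\<close>.\<close>

definition H_calculus :: "(real \<Rightarrow> complex) \<Rightarrow> distribution \<Rightarrow> distribution" where
  "H_calculus F T \<phi> =
     (\<Sum>n. F ((hermite_freq n)\<^sup>2) * T (hermite_cfun n) * regular (hermite_cfun n) \<phi>)"

definition H_power :: "real \<Rightarrow> distribution \<Rightarrow> distribution" where
  "H_power s = H_calculus (\<lambda>e. complex_of_real (e powr s))"

definition schroedinger_flow :: "real \<Rightarrow> distribution \<Rightarrow> distribution" where
  "schroedinger_flow t = H_calculus (\<lambda>e. exp (- (\<i> * complex_of_real (t * e))))"

definition sobolev_norm :: "real \<Rightarrow> distribution \<Rightarrow> ennreal" where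
  "sobolev_norm s T = L2_norm (H_power (s / 2) T)"

definition sobolev_space :: "real \<Rightarrow> distribution set" where
  "sobolev_space s = {T. tempered T \<and> sobolev_norm s T < \<infinity>}"

definition sobolev_dist :: "real \<Rightarrow> distribution \<Rightarrow> distribution \<Rightarrow> ennreal" where
  "sobolev_dist s T S = sobolev_norm s (\<lambda>\<phi>. T \<phi> - S \<phi>)"

definition sobolev_open :: "real \<Rightarrow> distribution set \<Rightarrow> bool" where
  "sobolev_open s U \<longleftrightarrow> U \<subseteq> sobolev_space s \<and>
     (\<forall>T\<in>U. \<exists>r>0. {S \<in> sobolev_space s. sobolev_dist s T S < r} \<subseteq> U)"

definition sobolev_borel :: "real \<Rightarrow> distribution measure" where
  "sobolev_borel s = sigma (sobolev_space s) {U. sobolev_open s U}"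


section \<open>The Gaussian measure\<close>

definition hermite_sums :: "real \<Rightarrow> (nat \<Rightarrow> complex) \<Rightarrow> distribution \<Rightarrow> bool" where
  "hermite_sums s c T \<longleftrightarrow> T \<in> sobolev_space s \<and>
     (\<lambda>N. sobolev_dist s (regular (\<lambda>x. \<Sum>n<N. c n * hermite_cfun n x)) T) \<longlonglongrightarrow> 0"

text \<open>The sum of \<open>\<Sum>\<^sub>n c\<^sub>n h\<^sub>n\<close> in the Sobolev space, with the junk value \<open>0\<close> if the series diverges.\<close>

definition hermite_suminf :: "real \<Rightarrow> (nat \<Rightarrow> complex) \<Rightarrow> distribution" where
  "hermite_suminf s c =
     (if \<exists>T. hermite_sums s c T then (SOME T. hermite_sums s c T) else (\<lambda>\<phi>. 0))"

definition standard_complex_gaussian :: "'w measure \<Rightarrow> ('w \<Rightarrow> complex) \<Rightarrow> bool" where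
  "standard_complex_gaussian M X \<longleftrightarrow>
     distributed M lborel X (\<lambda>z. ennreal (exp (- (norm z)\<^sup>2) / pi))"

definition gaussian_law ::
    "'w measure \<Rightarrow> (nat \<Rightarrow> 'w \<Rightarrow> complex) \<Rightarrow> real \<Rightarrow> distribution measure" where
  "gaussian_law M g \<sigma> = distr M (sobolev_borel (- \<sigma>))
     (\<lambda>\<omega>. hermite_suminf (- \<sigma>) (\<lambda>n. complex_of_real (sqrt 2 / hermite_freq n) * g n \<omega>))"

end

theory Submission
  imports Defs
begin

text \<open>
  The argument controls a random series by its second moments, and reduces the second moment of the
  square to a deterministic double series of Hermite functions.

  Write \<open>d\<^sub>n\<close> for the Hermite coefficients of \<open>e\<^bsup>-itH\<^esup> u\<close>. Almost surely they are \<open>c\<^sub>n g\<^sub>n\<close> with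
  \<open>|c\<^sub>n|\<^sup>2 = 2/(2n+1)\<close>, since the flow only changes the phases. As \<open>\<Sum> h\<^sub>n(x)\<^sup>2/(2n+1)\<close> is
  bounded (\<open>hermite_inverse_weighted_bounded\<close>), the partial sums \<open>S\<^sub>N = \<Sum>\<^sub>n\<^sub><\<^sub>N d\<^sub>n h\<^sub>n\<close> converge along a lacunary sequence,
  almost everywhere and in \<open>L\<^sup>2(dx/(1+x\<^sup>2))\<close>, to a function \<open>f\<close> that represents \<open>e\<^bsup>-itH\<^esup> u\<close>; the square of \<open>f\<close>
  is locally integrable and again a tempered distribution (\<open>hermite_series_converges\<close>).

  By lower semicontinuity it remains to bound the expectation of \<open>\<parallel>S\<^sub>N\<^sup>2\<parallel>\<^sup>2\<close> in \<open>\<H>\<^sup>\<theta>\<close> uniformly in \<open>N\<close>. Since the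
  \<open>g\<^sub>n\<close> are rotation invariant and independent, only the pairings \<open>{n, m} = {k, l}\<close> contribute
  (\<open>quadratic_chaos_bound\<close>), and the expectation is at most a constant times
  \<open>\<Sum>\<^sub>n\<^sub>,\<^sub>m \<parallel>h\<^sub>n h\<^sub>m\<parallel>\<^sup>2 / ((2n+1)(2m+1))\<close>.

  Interpolating between \<open>L\<^sup>2\<close> and \<open>\<H>\<^sup>1\<close> with the ladder operators, the squared \<open>\<H>\<^sup>\<theta>\<close> norm of \<open>h\<^sub>n h\<^sub>m\<close> is at
  most \<open>max (2n+1) (2m+1)\<^bsup>\<theta>\<^esup>\<close> times neighbouring overlaps \<open>\<integral> h\<^sub>n\<^sup>2 h\<^sub>m\<^sup>2\<close> (\<open>hermite_product_norm\<close>). So the series is dominated by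
  the integral of \<open>(\<Sum> (2n+1)\<^bsup>\<theta>-1\<^esup> h\<^sub>n\<^sup>2) (\<Sum> (2m+1)\<^bsup>-1\<^esup> h\<^sub>m\<^sup>2)\<close>. Mehler's formula on the diagonal bounds both factors by explicit
  sums of Gaussians over dyadic scales; they behave like \<open>|x|\<^bsup>2\<theta>-1\<^esup>\<close> and \<open>|x|\<^bsup>-1\<^esup>\<close> at infinity, and the integral is finite
  precisely when \<open>\<theta> < 1/2\<close> (\<open>hermite_overlap_sum_bounded\<close>).

  The law of \<open>u\<close> lives on a Sobolev space whose coefficient functionals are continuous, so the set of
  good \<open>u\<close>, defined through coefficients alone, is measurable.
\<close>

section \<open>Ladder relations and decay of the Hermite functions\<close>

lemma hermite_const_Suc:
  "hermite_const (Suc n) * sqrt (2 * (real n + 1)) = hermite_const n"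
proof -
  have "2 powr (real (Suc n) / 2) = 2 powr (real n / 2) * sqrt 2"
    by (simp add: add_divide_distrib powr_add powr_half_sqrt)
  moreover have "sqrt (fact (Suc n)) = sqrt (real n + 1) * sqrt (fact n)"
    by (simp add: add.commute flip: real_sqrt_mult)
  ultimately show ?thesis
    unfolding hermite_const_def real_sqrt_mult
    by (simp add: field_simps del: fact_Suc of_nat_Suc)
qed

lemma hermite_fun_eq:
  "hermite_fun n x = (-1) ^ n * hermite_const n * exp (x\<^sup>2 / 2) * gauss_deriv n x"
  by (simp add: hermite_fun_def gauss_deriv_eq)

text \<open>The raising relation \<open>\<surd>(2n+2) h\<^sub>n\<^sub>+\<^sub>1 = (x - d/dx) h\<^sub>n\<close> in terms of the derivatives of the
  Gaussian; the normalising constants are chosen to produce exactly this factor.\<close>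

lemma hermite_raise:
  "sqrt (2 * (real n + 1)) * hermite_fun (Suc n) x
     = - ((-1) ^ n * hermite_const n * exp (x\<^sup>2 / 2) * gauss_deriv (Suc n) x)"
proof -
  have "sqrt (2 * (real n + 1)) * hermite_fun (Suc n) x
     = - ((-1) ^ n * (hermite_const (Suc n) * sqrt (2 * (real n + 1)))
          * exp (x\<^sup>2 / 2) * gauss_deriv (Suc n) x)"
    unfolding hermite_fun_eq by (simp del: gauss_deriv.simps)
  then show ?thesis
    by (simp only: hermite_const_Suc)
qed

lemma hermite_has_derivative:
  "(hermite_fun n has_field_derivative
     x * hermite_fun n x - sqrt (2 * (real n + 1)) * hermite_fun (Suc n) x) (at x)"
proof -
  define a where "a = (-1) ^ n * hermite_const n"
  have h: "hermite_fun n = (\<lambda>x. a * exp (x\<^sup>2 / 2) * gauss_deriv n x)"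
    by (auto simp: hermite_fun_eq a_def)
  have "(hermite_fun n has_field_derivative
      x * (a * exp (x\<^sup>2 / 2) * gauss_deriv n x) + a * exp (x\<^sup>2 / 2) * gauss_deriv (Suc n) x) (at x)"
    unfolding h using gauss_deriv_has_derivative
    by (auto intro!: derivative_eq_intros simp: algebra_simps simp del: gauss_deriv.simps)
  then show ?thesis
    unfolding hermite_raise by (simp add: h a_def del: gauss_deriv.simps)
qed

lemma hermite_recurrence:
  "sqrt (2 * (real n + 2)) * hermite_fun (Suc (Suc n)) x
     = 2 * x * hermite_fun (Suc n) x - sqrt (2 * (real n + 1)) * hermite_fun n x"
proof -
  define s where "s = sqrt (2 * (real n + 1))"
  define e where "e = (-1) ^ n * hermite_const (Suc n) * exp (x\<^sup>2 / 2)"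
  have s: "s * s = 2 * (real n + 1)"
    unfolding s_def by auto
  have "hermite_const n = s * hermite_const (Suc n)"
    using hermite_const_Suc[of n] by (simp add: s_def mult.commute)
  then have h: "hermite_fun n x = s * e * gauss_deriv n x"
    by (simp add: hermite_fun_eq e_def)
  have h1: "hermite_fun (Suc n) x = - (e * gauss_deriv (Suc n) x)"
    by (simp add: hermite_fun_eq e_def del: gauss_deriv.simps)
  have n2: "2 * (real (Suc n) + 1) = 2 * (real n + 2)"
    by simp
  have "sqrt (2 * (real n + 2)) * hermite_fun (Suc (Suc n)) x = e * gauss_deriv (Suc (Suc n)) x"
    using hermite_raise[of "Suc n" x] unfolding n2 by (simp add: e_def del: gauss_deriv.simps)
  also have "\<dots> = e * (- 2 * x * gauss_deriv (Suc n) x - (s * s) * gauss_deriv n x)"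
    unfolding s by simp
  also have "\<dots> = 2 * x * hermite_fun (Suc n) x - s * hermite_fun n x"
    unfolding h h1 by (simp add: algebra_simps del: gauss_deriv.simps)
  finally show ?thesis
    by (simp add: s_def)
qed

lemma hermite_lower:
  "(x * hermite_fun (Suc n) x - sqrt (2 * (real (Suc n) + 1)) * hermite_fun (Suc (Suc n)) x)
     + x * hermite_fun (Suc n) x = sqrt (2 * (real n + 1)) * hermite_fun n x"
  using hermite_recurrence[of n x] by (simp add: algebra_simps)

lemma hermite_0: "hermite_fun 0 x = exp (- (x\<^sup>2) / 2) / pi powr (1 / 4)"
proof -
  have "exp (x\<^sup>2 / 2) * exp (- (x\<^sup>2)) = exp (- (x\<^sup>2) / 2)"
    by (simp flip: exp_add)
  then show ?thesis
    by (simp add: hermite_fun_eq hermite_const_def)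
qed

lemma hermite_1: "sqrt 2 * hermite_fun (Suc 0) x = 2 * x * hermite_fun 0 x"
  using hermite_raise[of 0 x] by (simp add: hermite_fun_eq)

text \<open>Polynomials times a Gaussian are closed under differentiation, so this form makes \<open>h\<^sub>n\<close> and
  \<open>h\<^sub>n h\<^sub>m\<close> Schwartz functions at once.\<close>

lemma hermite_poly: "\<exists>p. \<forall>x. hermite_fun n x = poly p x * exp (- (1/2) * x\<^sup>2)"
proof -
  have "\<exists>p. \<forall>x. gauss_deriv n x = poly p x * exp (- (x\<^sup>2))"
  proof (induction n rule: induct_nat_012)
    case 0
    have "\<forall>x. gauss_deriv 0 x = poly 1 x * exp (- (x\<^sup>2))" by simp
    then show ?case by blast
  next
    case 1
    have "\<forall>x. gauss_deriv (Suc 0) x = poly [:0, -2:] x * exp (- (x\<^sup>2))" by simp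
    then show ?case by blast
  next
    case (ge2 n)
    then obtain p q where pq: "\<And>x. gauss_deriv n x = poly p x * exp (- (x\<^sup>2))"
      "\<And>x. gauss_deriv (Suc n) x = poly q x * exp (- (x\<^sup>2))" by blast
    have "\<forall>x. gauss_deriv (Suc (Suc n)) x
        = poly (smult (-2) (pCons 0 q) - smult (2 * (real n + 1)) p) x * exp (- (x\<^sup>2))"
      by (simp add: pq algebra_simps)
    then show ?case by blast
  qed
  then obtain p where p: "\<And>x. gauss_deriv n x = poly p x * exp (- (x\<^sup>2))" by blast
  have "exp (x\<^sup>2 / 2) * exp (- (x\<^sup>2)) = exp (- (1/2) * x\<^sup>2)" for x :: real
    by (simp flip: exp_add)
  then have "\<forall>x. hermite_fun n x
      = poly (smult ((-1) ^ n * hermite_const n) p) x * exp (- (1/2) * x\<^sup>2)"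
    unfolding hermite_fun_eq p by (simp add: algebra_simps)
  then show ?thesis by blast
qed

lemma power_gaussian_bounded:
  fixes a :: real
  assumes "a > 0"
  shows "\<bar>x ^ j\<bar> * exp (- a * x\<^sup>2) \<le> 1 + fact j / a ^ j"
proof -
  have 1: "(a * x\<^sup>2) ^ j / fact j \<le> exp (a * x\<^sup>2)"
  proof -
    have "(\<lambda>n. inverse (fact n) * (a * x\<^sup>2) ^ n) sums exp (a * x\<^sup>2)"
      using exp_converges[of "a * x\<^sup>2"] by simp
    moreover have "inverse (fact n) * (a * x\<^sup>2) ^ n \<ge> 0" for n
      using assms by simp
    ultimately have "(\<Sum>n\<in>{j}. inverse (fact n) * (a * x\<^sup>2) ^ n) \<le> exp (a * x\<^sup>2)"
      by (intro sum_le_suminf[THEN order_trans]) (auto simp: sums_iff)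
    then show ?thesis by (simp add: field_simps)
  qed
  have 2: "\<bar>x ^ j\<bar> \<le> 1 + (x\<^sup>2) ^ j"
  proof -
    have "0 \<le> (\<bar>x ^ j\<bar> - 1)\<^sup>2" by simp
    then have "2 * \<bar>x ^ j\<bar> \<le> 1 + (x ^ j)\<^sup>2"
      by (simp add: power2_diff)
    moreover have "(x ^ j)\<^sup>2 = (x\<^sup>2) ^ j"
      by (simp add: mult.commute flip: power_mult)
    ultimately show ?thesis
      using abs_ge_zero[of "x ^ j"] by linarith
  qed
  have e: "exp (- a * x\<^sup>2) * exp (a * x\<^sup>2) = 1"
    by (simp flip: exp_add)
  have "\<bar>x ^ j\<bar> * exp (- a * x\<^sup>2) \<le> (1 + (x\<^sup>2) ^ j) * exp (- a * x\<^sup>2)"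
    using 2 by (intro mult_right_mono) auto
  also have "\<dots> = exp (- a * x\<^sup>2) + (x\<^sup>2) ^ j * exp (- a * x\<^sup>2)"
    by (simp add: algebra_simps)
  also have "\<dots> \<le> 1 + (fact j / a ^ j * exp (a * x\<^sup>2)) * exp (- a * x\<^sup>2)"
    using assms 1 by (intro add_mono mult_right_mono) (auto simp: field_simps power_mult_distrib)
  also have "\<dots> = 1 + fact j / a ^ j"
    using e by (simp add: algebra_simps)
  finally show ?thesis .
qed

lemma poly_gaussian_bounded:
  fixes p :: "real poly"
  assumes "a > 0"
  shows "\<exists>C. \<forall>x. \<bar>x ^ j * (poly p x * exp (- a * x\<^sup>2))\<bar> \<le> C"
proof (intro exI allI)
  fix x :: real
  have "\<bar>x ^ j * (poly p x * exp (- a * x\<^sup>2))\<bar>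
      = \<bar>\<Sum>i\<le>degree p. coeff p i * (x ^ (j + i) * exp (- a * x\<^sup>2))\<bar>"
    by (simp add: poly_altdef sum_distrib_left sum_distrib_right power_add algebra_simps)
  also have "\<dots> \<le> (\<Sum>i\<le>degree p. \<bar>coeff p i * (x ^ (j + i) * exp (- a * x\<^sup>2))\<bar>)"
    by (rule sum_abs)
  also have "\<dots> \<le> (\<Sum>i\<le>degree p. \<bar>coeff p i\<bar> * (1 + fact (j + i) / a ^ (j + i)))"
    unfolding abs_mult using power_gaussian_bounded[OF assms]
    by (intro sum_mono mult_left_mono) (auto simp: abs_mult)
  finally show "\<bar>x ^ j * (poly p x * exp (- a * x\<^sup>2))\<bar>
      \<le> (\<Sum>i\<le>degree p. \<bar>coeff p i\<bar> * (1 + fact (j + i) / a ^ (j + i)))" .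
qed

lemma poly_gaussian_derivative:
  fixes p :: "real poly"
  shows "((\<lambda>x. complex_of_real (poly p x * exp (- a * x\<^sup>2))) has_vector_derivative
     complex_of_real (poly (pderiv p - smult (2 * a) (pCons 0 p)) x * exp (- a * x\<^sup>2))) (at x)"
  by (rule has_vector_derivative_of_real)
     (auto intro!: derivative_eq_intros simp: algebra_simps
        simp flip: has_real_derivative_iff_has_vector_derivative)

lemma schwartz_poly_gaussian:
  fixes p :: "real poly"
  assumes "a > 0"
  shows "schwartz (\<lambda>x. complex_of_real (poly p x * exp (- a * x\<^sup>2)))"
proof -
  have k: "\<exists>q. (vderiv ^^ k) (\<lambda>x. complex_of_real (poly p x * exp (- a * x\<^sup>2)))
      = (\<lambda>x. complex_of_real (poly q x * exp (- a * x\<^sup>2)))" for k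
  proof (induction k)
    case 0
    then show ?case by auto
  next
    case (Suc k)
    then obtain q where q: "(vderiv ^^ k) (\<lambda>x. complex_of_real (poly p x * exp (- a * x\<^sup>2)))
      = (\<lambda>x. complex_of_real (poly q x * exp (- a * x\<^sup>2)))" by blast
    show ?case
      unfolding funpow.simps(2) comp_apply q
      by (intro exI[of _ "pderiv q - smult (2 * a) (pCons 0 q)"] ext)
         (simp only: vderiv_def vector_derivative_at[OF poly_gaussian_derivative])
  qed
  show ?thesis
    unfolding schwartz_def
  proof safe
    fix k x
    obtain q where q: "(vderiv ^^ k) (\<lambda>x. complex_of_real (poly p x * exp (- a * x\<^sup>2)))
      = (\<lambda>x. complex_of_real (poly q x * exp (- a * x\<^sup>2)))" using k by blast
    show "(vderiv ^^ k) (\<lambda>x. complex_of_real (poly p x * exp (- a * x\<^sup>2))) differentiable at x"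
      unfolding q using poly_gaussian_derivative by (rule differentiableI_vector)
  next
    fix j k
    obtain q where q: "(vderiv ^^ k) (\<lambda>x. complex_of_real (poly p x * exp (- a * x\<^sup>2)))
      = (\<lambda>x. complex_of_real (poly q x * exp (- a * x\<^sup>2)))" using k by blast
    obtain C where "\<And>x. \<bar>x ^ j * (poly q x * exp (- a * x\<^sup>2))\<bar> \<le> C"
      using poly_gaussian_bounded[OF assms] by blast
    then show "bounded (range (\<lambda>x. x ^ j *\<^sub>R
        (vderiv ^^ k) (\<lambda>x. complex_of_real (poly p x * exp (- a * x\<^sup>2))) x))"
      unfolding q by (intro boundedI[of _ C]) (auto simp: norm_mult abs_mult simp flip: of_real_mult)
  qed
qed

lemma schwartz_hermite: "schwartz (hermite_cfun n)"
proof -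
  obtain p where "\<And>x. hermite_fun n x = poly p x * exp (- (1/2) * x\<^sup>2)"
    using hermite_poly by blast
  then have "hermite_cfun n = (\<lambda>x. complex_of_real (poly p x * exp (- (1/2) * x\<^sup>2)))"
    by auto
  then show ?thesis
    using schwartz_poly_gaussian[of "1/2" p] by simp
qed

lemma schwartz_hermite_mult: "schwartz (\<lambda>x. hermite_cfun n x * hermite_cfun m x)"
proof -
  obtain p q where p: "\<And>x. hermite_fun n x = poly p x * exp (- (1/2) * x\<^sup>2)"
    and q: "\<And>x. hermite_fun m x = poly q x * exp (- (1/2) * x\<^sup>2)"
    using hermite_poly by meson
  have "exp (- (1/2) * x\<^sup>2) * exp (- (1/2) * x\<^sup>2) = exp (- 1 * x\<^sup>2)" for x :: real
    by (simp flip: exp_add)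
  then have "(\<lambda>x. hermite_cfun n x * hermite_cfun m x)
      = (\<lambda>x. complex_of_real (poly (p * q) x * exp (- 1 * x\<^sup>2)))"
    unfolding p q of_real_mult[symmetric] poly_mult
    by (intro ext arg_cong[of _ _ complex_of_real]) (metis (no_types, lifting) mult.assoc mult.left_commute)
  then show ?thesis
    using schwartz_poly_gaussian[of 1 "p * q"] by simp
qed

lemma schwartz_has_derivative:
  assumes "schwartz \<phi>"
  shows "((vderiv ^^ k) \<phi> has_vector_derivative (vderiv ^^ Suc k) \<phi> x) (at x)"
proof -
  have "(vderiv ^^ k) \<phi> differentiable at x"
    using assms by (auto simp: schwartz_def)
  then show ?thesis
    by (simp add: vderiv_def vector_derivative_works[symmetric])
qed

lemma schwartz_continuous:
  assumes "schwartz \<phi>"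
  shows "continuous_on A ((vderiv ^^ k) \<phi>)"
  using has_vector_derivative_continuous[OF schwartz_has_derivative[OF assms, of k]]
  by (meson continuous_at_imp_continuous_on)

lemma schwartz_seminorm_bound:
  assumes "schwartz \<phi>"
  shows "\<bar>x\<bar> ^ j * norm ((vderiv ^^ k) \<phi> x) \<le> schwartz_seminorm j k \<phi>"
proof -
  have "bounded (range (\<lambda>x. x ^ j *\<^sub>R (vderiv ^^ k) \<phi> x))"
    using assms by (simp add: schwartz_def)
  then obtain B where "\<And>x. norm (x ^ j *\<^sub>R (vderiv ^^ k) \<phi> x) \<le> B"
    by (auto simp: bounded_iff)
  then have "bdd_above (range (\<lambda>x. norm (x ^ j *\<^sub>R (vderiv ^^ k) \<phi> x)))"
    by (intro bdd_aboveI[of _ B]) auto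
  then have "norm (x ^ j *\<^sub>R (vderiv ^^ k) \<phi> x) \<le> schwartz_seminorm j k \<phi>"
    unfolding schwartz_seminorm_def by (rule cSUP_upper[rotated]) simp
  then show ?thesis by (simp add: power_abs)
qed

lemma schwartz_seminorm_nonneg: "schwartz \<phi> \<Longrightarrow> schwartz_seminorm j k \<phi> \<ge> 0"
  using schwartz_seminorm_bound[of \<phi> 0 j k] order_trans[of 0 "\<bar>0\<bar> ^ j * norm ((vderiv ^^ k) \<phi> 0)"]
  by simp

text \<open>An integrable weight that decays polynomially, so that it dominates all Schwartz functions; the
  random series converges in the corresponding weighted \<open>L\<^sup>2\<close> space but not in \<open>L\<^sup>2\<close>.\<close>

abbreviation japanese_weight :: "real \<Rightarrow> real" where
  "japanese_weight x \<equiv> inverse (1 + x\<^sup>2)"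

lemma schwartz_decay_bound:
  assumes "schwartz \<phi>"
  shows "\<bar>x\<bar> ^ j * norm ((vderiv ^^ k) \<phi> x)
    \<le> (schwartz_seminorm j k \<phi> + schwartz_seminorm (j + 2) k \<phi>) * japanese_weight x"
proof -
  have "(1 + x\<^sup>2) * (\<bar>x\<bar> ^ j * norm ((vderiv ^^ k) \<phi> x))
      \<le> schwartz_seminorm j k \<phi> + schwartz_seminorm (j + 2) k \<phi>"
    using schwartz_seminorm_bound[OF assms, of x j k] schwartz_seminorm_bound[OF assms, of x "j + 2" k]
    by (simp add: algebra_simps power_add power2_eq_square)
  moreover have "1 + x\<^sup>2 > 0" by (simp add: add_pos_nonneg)
  ultimately show ?thesis by (simp add: field_simps)
qed

lemma integrable_japanese_weight: "integrable lborel japanese_weight"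
  using integrable_inverse_1_plus_square by (simp add: set_integrable_def einterval_def)

lemma japanese_weight_pos: "japanese_weight x > 0"
  by (simp add: add_pos_nonneg)

lemma japanese_weight_le_1: "japanese_weight x \<le> 1"
  by (simp add: inverse_le_1_iff)

lemma japanese_weight_measurable [measurable]: "japanese_weight \<in> borel_measurable borel"
  by measurable

lemma integrable_japanese_weight_bound:
  fixes f :: "real \<Rightarrow> 'b :: {banach, second_countable_topology}"
  assumes "f \<in> borel_measurable lborel" "\<And>x. norm (f x) \<le> C * japanese_weight x"
  shows "integrable lborel f"
  using integrable_mult_right[OF integrable_japanese_weight, of C] assms(1)
proof (rule Bochner_Integration.integrable_bound)
  show "AE x in lborel. norm (f x) \<le> norm (C * japanese_weight x)"
    using assms(2) order_trans[OF _ abs_ge_self] by (intro AE_I2) (force simp del: abs_mult)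
qed

lemma schwartz_measurable [measurable (raw)]:
  assumes "schwartz \<phi>"
  shows "(vderiv ^^ k) \<phi> \<in> borel_measurable borel"
  using schwartz_continuous[OF assms] by (rule borel_measurable_continuous_onI)

lemma schwartz_measurable0:
  "schwartz \<phi> \<Longrightarrow> \<phi> \<in> borel_measurable borel"
  "schwartz \<phi> \<Longrightarrow> vderiv \<phi> \<in> borel_measurable borel"
  using schwartz_measurable[of \<phi> 0] schwartz_measurable[of \<phi> 1] by auto

section \<open>Orthonormality and Bessel inequalities\<close>

lemma integral_derivative_decaying:
  fixes F f :: "real \<Rightarrow> complex"
  assumes der: "\<And>x. (F has_vector_derivative f x) (at x)"
    and cont: "\<And>x. isCont f x"
    and F: "\<And>x. norm (F x) \<le> C * japanese_weight x"
    and f: "\<And>x. norm (f x) \<le> C * japanese_weight x"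
  shows "(\<integral>x. f x \<partial>lborel) = 0"
proof -
  have lim: "((\<lambda>x. C * japanese_weight x) \<longlongrightarrow> 0) at_top"
    "((\<lambda>x. C * japanese_weight x) \<longlongrightarrow> 0) at_bot"
    by (real_asymp; fail)+
  have meas: "f \<in> borel_measurable lborel"
    using cont by (auto intro!: borel_measurable_continuous_onI simp: continuous_on_eq_continuous_at)
  have int: "integrable lborel f"
    using meas f by (rule integrable_japanese_weight_bound)
  have "(LBINT x=-\<infinity>..\<infinity>. f x) = 0 - 0"
  proof (rule interval_integral_FTC_integrable)
    show "set_integrable lborel (einterval (-\<infinity>) \<infinity>) f"
      using int by (simp add: set_integrable_def einterval_def)
    show "((F \<circ> real_of_ereal) \<longlongrightarrow> 0) (at_left \<infinity>)"
      unfolding ereal_tendsto_simps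
      by (rule Lim_null_comparison[OF always_eventually lim(1)]) (use F in auto)
    show "((F \<circ> real_of_ereal) \<longlongrightarrow> 0) (at_right (-\<infinity>))"
      unfolding ereal_tendsto_simps
      by (rule Lim_null_comparison[OF always_eventually lim(2)]) (use F in auto)
  qed (use der cont in auto)
  then show ?thesis
    by (simp add: interval_lebesgue_integral_def set_lebesgue_integral_def einterval_def)
qed

definition hermite_coeff :: "(real \<Rightarrow> complex) \<Rightarrow> nat \<Rightarrow> complex" where
  "hermite_coeff \<phi> k = (\<integral>x. \<phi> x * hermite_cfun k x \<partial>lborel)"

lemma schwartz_bound0:
  assumes "schwartz \<phi>"
  obtains C where "C \<ge> 0" "\<And>x. norm (\<phi> x) \<le> C * japanese_weight x"
    "\<And>x. norm (vderiv \<phi> x) \<le> C * japanese_weight x"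
    "\<And>x. norm (complex_of_real x * \<phi> x) \<le> C * japanese_weight x"
proof -
  define S where "S j k = schwartz_seminorm j k \<phi> + schwartz_seminorm (j + 2) k \<phi>" for j k
  have S: "S j k \<ge> 0" for j k
    using schwartz_seminorm_nonneg[OF assms] by (simp add: S_def)
  define C where "C = S 0 0 + S 0 1 + S 1 0"
  have C: "S 0 0 \<le> C" "S 0 1 \<le> C" "S 1 0 \<le> C" "C \<ge> 0"
    using S[of 0 0] S[of 0 1] S[of 1 0] by (auto simp: C_def)
  have le: "\<bar>x\<bar> ^ j * norm ((vderiv ^^ k) \<phi> x) \<le> C * japanese_weight x" if "S j k \<le> C" for x j k
    using schwartz_decay_bound[OF assms, of x j k] japanese_weight_pos[of x] that
    unfolding S_def by (meson less_imp_le mult_right_mono order_trans)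
  show ?thesis
    using that[of C] le[of 0 0] le[of 0 1] le[of 1 0] C by (auto simp: norm_mult)
qed

lemma hermite_measurable [measurable]: "hermite_fun n \<in> borel_measurable borel"
proof -
  have "continuous_on UNIV (hermite_fun n)"
    using DERIV_isCont[OF hermite_has_derivative] by (auto simp: continuous_on_eq_continuous_at)
  then show ?thesis by (rule borel_measurable_continuous_onI)
qed

lemma hermite_bound:
  obtains C where "C > 0" "\<And>x. \<bar>hermite_fun n x\<bar> \<le> C * japanese_weight x" "\<And>x. \<bar>hermite_fun n x\<bar> \<le> C"
proof -
  obtain C where C: "C \<ge> 0" "\<And>x. norm (hermite_cfun n x) \<le> C * japanese_weight x"
    using schwartz_bound0[OF schwartz_hermite] by metis
  have 1: "\<bar>hermite_fun n x\<bar> \<le> (C + 1) * japanese_weight x" for x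
    using C(2)[of x] japanese_weight_pos[of x] by (simp add: distrib_right del: inverse_positive_iff_positive)
  then have "\<bar>hermite_fun n x\<bar> \<le> C + 1" for x
    using order_trans[OF 1[of x] mult_left_mono[OF japanese_weight_le_1, of "C + 1" x]] C(1) by simp
  then show ?thesis using that[of "C + 1"] 1 C(1) by auto
qed

text \<open>The raising operator \<open>x - d/dx\<close> is the adjoint of the lowering operator \<open>x + d/dx\<close>.\<close>

lemma hermite_coeff_lowering:
  assumes "schwartz \<phi>"
  shows "hermite_coeff (\<lambda>x. vderiv \<phi> x + complex_of_real x * \<phi> x) k
    = complex_of_real (sqrt (2 * (real k + 1))) * hermite_coeff \<phi> (Suc k)"
proof -
  obtain C where C: "C \<ge> 0" "\<And>x. norm (\<phi> x) \<le> C * japanese_weight x"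
    "\<And>x. norm (vderiv \<phi> x) \<le> C * japanese_weight x"
    "\<And>x. norm (complex_of_real x * \<phi> x) \<le> C * japanese_weight x"
    using schwartz_bound0[OF assms] by blast
  obtain D where D: "D > 0" "\<And>x. \<bar>hermite_fun k x\<bar> \<le> D"
    by (rule hermite_bound[of k]) (use that in metis)
  obtain E where E: "E > 0" "\<And>x. \<bar>hermite_fun (Suc k) x\<bar> \<le> E"
    by (rule hermite_bound[of "Suc k"]) (use that in metis)
  define s where "s = sqrt (2 * (real k + 1))"
  have [measurable]: "\<phi> \<in> borel_measurable borel" "vderiv \<phi> \<in> borel_measurable borel"
    using schwartz_measurable0[OF assms] by auto
  have bd: "norm (a * complex_of_real b) \<le> (c * B) * w"
    if "norm a \<le> c * w" "\<bar>b\<bar> \<le> B" "c * w \<ge> 0" for a b c B w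
  proof -
    have "norm (a * complex_of_real b) \<le> (c * w) * B"
      unfolding norm_mult norm_of_real using that by (intro mult_mono) auto
    then show ?thesis by (simp only: mult.assoc mult.commute[of w B])
  qed
  have Cw: "C * japanese_weight x \<ge> 0" for x
    using C(1) japanese_weight_pos[of x] by simp
  note b1 = bd[OF C(2) D(2) Cw] and b2 = bd[OF C(3) D(2) Cw] and b3 = bd[OF C(4) D(2) Cw]
    and b4 = bd[OF C(2) E(2) Cw]
  define f where "f x = vderiv \<phi> x * hermite_cfun k x
    + (complex_of_real x * \<phi> x * hermite_cfun k x - complex_of_real s * (\<phi> x * hermite_cfun (Suc k) x))" for x
  have i1: "integrable lborel (\<lambda>x. vderiv \<phi> x * hermite_cfun k x)"
    by (rule integrable_japanese_weight_bound[OF _ b2]) measurable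
  have i2: "integrable lborel (\<lambda>x. complex_of_real x * \<phi> x * hermite_cfun k x)"
    by (rule integrable_japanese_weight_bound[OF _ b3]) measurable
  have i3: "integrable lborel (\<lambda>x. \<phi> x * hermite_cfun (Suc k) x)"
    by (rule integrable_japanese_weight_bound[OF _ b4]) measurable
  have s0: "s \<ge> 0" unfolding s_def by simp
  have "(\<integral>x. f x \<partial>lborel) = 0"
  proof (rule integral_derivative_decaying)
    fix x
    have h: "((\<lambda>x. hermite_cfun k x) has_vector_derivative
        complex_of_real (x * hermite_fun k x - s * hermite_fun (Suc k) x)) (at x)" for x
      unfolding s_def by (intro has_vector_derivative_of_real)
        (use hermite_has_derivative in \<open>simp add: has_real_derivative_iff_has_vector_derivative\<close>)
    have p: "(\<phi> has_vector_derivative vderiv \<phi> x) (at x)" for x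
      using schwartz_has_derivative[OF assms, of 0] by simp
    show "((\<lambda>x. \<phi> x * hermite_cfun k x) has_vector_derivative f x) (at x)"
      by (rule has_vector_derivative_eq_rhs[OF has_vector_derivative_mult[OF p h]])
         (simp add: f_def algebra_simps)
    have "isCont (hermite_fun k) x" for k
      by (rule DERIV_isCont[OF hermite_has_derivative])
    moreover have "isCont \<phi> x" "isCont (vderiv \<phi>) x"
      using schwartz_continuous[OF assms, of UNIV 0] schwartz_continuous[OF assms, of UNIV 1]
      by (auto simp: continuous_on_eq_continuous_at)
    ultimately show "isCont f x"
      unfolding f_def by (intro continuous_intros) auto
    define w where "w = japanese_weight x"
    have "norm (\<phi> x * hermite_cfun k x) \<le> (C * D) * w"
      using b1[of x] by (simp add: w_def)
    also have "\<dots> \<le> (C * D + C * D + s * (C * E)) * w"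
      using C(1) D(1) E(1) s0 japanese_weight_pos[of x]
      by (intro mult_right_mono) (auto simp: w_def)
    finally show "norm (\<phi> x * hermite_cfun k x) \<le> (C * D + C * D + s * (C * E)) * japanese_weight x"
      by (simp add: w_def)
    have "norm (f x) \<le> (C * D) * w + ((C * D) * w + s * ((C * E) * w))"
      unfolding f_def
      by (intro norm_triangle_mono order_trans[OF norm_triangle_ineq4] add_mono)
         (use b2[of x] b3[of x] b4[of x] s0 in \<open>auto simp: w_def norm_mult mult_left_mono\<close>)
    then show "norm (f x) \<le> (C * D + C * D + s * (C * E)) * japanese_weight x"
      by (simp add: w_def algebra_simps)
  qed
  moreover have "(\<integral>x. f x \<partial>lborel) = hermite_coeff (\<lambda>x. vderiv \<phi> x + complex_of_real x * \<phi> x) k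
      - complex_of_real s * hermite_coeff \<phi> (Suc k)"
    unfolding f_def hermite_coeff_def using i1 i2 i3 by (simp add: distrib_right)
  ultimately show ?thesis by (simp add: s_def)
qed

lemma vderiv_hermite:
  "vderiv (hermite_cfun n) x
     = complex_of_real (x * hermite_fun n x - sqrt (2 * (real n + 1)) * hermite_fun (Suc n) x)"
  unfolding vderiv_def
  by (intro vector_derivative_at has_vector_derivative_of_real)
     (use hermite_has_derivative in \<open>simp add: has_real_derivative_iff_has_vector_derivative\<close>)

lemma gaussian_integral:
  assumes "c > 0"
  shows "has_bochner_integral lborel (\<lambda>x::real. exp (- c * x\<^sup>2)) (sqrt (pi / c))"
proof -
  have "has_bochner_integral lborel (\<lambda>x::real. exp (- x\<^sup>2)) (sqrt pi)"
    using gaussian_moment_0 has_bochner_integral_even_function[of "\<lambda>x::real. exp (- x\<^sup>2)" "sqrt pi / 2"]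
    by (simp add: mult.commute)
  then have "has_bochner_integral lborel (\<lambda>x::real. exp (- (0 + sqrt c * x)\<^sup>2)) (sqrt pi /\<^sub>R \<bar>sqrt c\<bar>)"
    using assms by (subst (asm) lborel_has_bochner_integral_real_affine_iff[of "sqrt c" _ _ 0]) auto
  moreover have "(0 + sqrt c * x)\<^sup>2 = c * x\<^sup>2" for x
    using assms by (simp add: power_mult_distrib)
  ultimately show ?thesis
    using assms by (simp add: real_sqrt_divide field_simps)
qed

lemma hermite_0_norm: "(\<integral>x. (hermite_fun 0 x)\<^sup>2 \<partial>lborel) = 1"
proof -
  have "exp (- (x\<^sup>2) / 2) * exp (- (x\<^sup>2) / 2) = exp (- x\<^sup>2)" for x :: real
    by (simp flip: exp_add)
  moreover have "pi powr (1/4) * pi powr (1/4) = sqrt pi"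
    by (simp add: powr_half_sqrt flip: powr_add)
  ultimately have "(hermite_fun 0 x)\<^sup>2 = exp (- x\<^sup>2) / sqrt pi" for x
    by (simp add: hermite_0 power2_eq_square)
  moreover have "has_bochner_integral lborel (\<lambda>x::real. exp (- x\<^sup>2)) (sqrt pi)"
    using gaussian_integral[of 1] by simp
  ultimately show ?thesis
    by (simp add: has_bochner_integral_iff)
qed

lemma hermite_orthonormal: "hermite_coeff (hermite_cfun n) k = (if n = k then 1 else 0)"
proof (induction n arbitrary: k)
  case 0
  show ?case
  proof (cases k)
    case 0
    have "hermite_coeff (hermite_cfun 0) 0 = complex_of_real (\<integral>x. (hermite_fun 0 x)\<^sup>2 \<partial>lborel)"
      by (simp add: hermite_coeff_def power2_eq_square flip: of_real_mult)
    then show ?thesis using 0 by (simp add: hermite_0_norm)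
  next
    case (Suc k')
    have "vderiv (hermite_cfun 0) x + complex_of_real x * hermite_cfun 0 x = 0" for x
      using hermite_1[of x] by (simp add: vderiv_hermite flip: of_real_mult of_real_add)
    then have "hermite_coeff (\<lambda>x. vderiv (hermite_cfun 0) x + complex_of_real x * hermite_cfun 0 x) k' = 0"
      by (simp add: hermite_coeff_def)
    then have "complex_of_real (sqrt (2 * (real k' + 1))) * hermite_coeff (hermite_cfun 0) (Suc k') = 0"
      by (simp only: hermite_coeff_lowering[OF schwartz_hermite])
    then show ?thesis using Suc by (simp del: of_real_add of_real_mult)
  qed
next
  case (Suc n)
  have sym: "hermite_coeff (hermite_cfun a) b = hermite_coeff (hermite_cfun b) a" for a b
    by (simp add: hermite_coeff_def mult.commute)
  have low: "vderiv (hermite_cfun (Suc n)) x + complex_of_real x * hermite_cfun (Suc n) x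
      = complex_of_real (sqrt (2 * (real n + 1))) * hermite_cfun n x" for x
    using hermite_lower[of x n] unfolding vderiv_hermite
    by (simp only: of_real_mult[symmetric] of_real_add[symmetric])
  show ?case
  proof (cases k)
    case 0
    have "vderiv (hermite_cfun 0) x + complex_of_real x * hermite_cfun 0 x = 0" for x
      using hermite_1[of x] by (simp add: vderiv_hermite flip: of_real_mult of_real_add)
    then have "hermite_coeff (\<lambda>x. vderiv (hermite_cfun 0) x + complex_of_real x * hermite_cfun 0 x) n = 0"
      by (simp add: hermite_coeff_def)
    then have "complex_of_real (sqrt (2 * (real n + 1))) * hermite_coeff (hermite_cfun 0) (Suc n) = 0"
      by (simp only: hermite_coeff_lowering[OF schwartz_hermite])
    then show ?thesis using 0 sym[of 0 "Suc n"] by (simp del: of_real_add of_real_mult)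
  next
    case (Suc k')
    define s where "s n = complex_of_real (sqrt (2 * (real n + 1)))" for n
    have s: "s n \<noteq> 0" for n by (simp add: s_def)
    have "s n * hermite_coeff (hermite_cfun n) k' = s k' * hermite_coeff (hermite_cfun (Suc n)) (Suc k')"
      using hermite_coeff_lowering[OF schwartz_hermite, of "Suc n" k']
      unfolding low s_def[symmetric] by (simp add: hermite_coeff_def mult.assoc)
    then have "hermite_coeff (hermite_cfun (Suc n)) (Suc k') = s n / s k' * (if n = k' then 1 else 0)"
      using s[of k'] unfolding Suc.IH by (simp add: field_simps)
    then show ?thesis using Suc s by simp
  qed
qed

lemma integrable_mult_L2:
  fixes f g :: "real \<Rightarrow> complex"
  assumes [measurable]: "f \<in> borel_measurable lborel" "g \<in> borel_measurable lborel"
    and "integrable lborel (\<lambda>x. (norm (f x))\<^sup>2)" "integrable lborel (\<lambda>x. (norm (g x))\<^sup>2)"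
  shows "integrable lborel (\<lambda>x. f x * g x)"
proof (rule Bochner_Integration.integrable_bound[OF Bochner_Integration.integrable_add[OF assms(3,4)]])
  have "norm (f x * g x) \<le> (norm (f x))\<^sup>2 + (norm (g x))\<^sup>2" for x
    using sum_squares_bound[of "norm (f x)" "norm (g x)"] mult_nonneg_nonneg[OF norm_ge_zero norm_ge_zero, of "f x" "g x"]
    unfolding norm_mult by linarith
  then show "AE x in lborel. norm (f x * g x) \<le> norm ((norm (f x))\<^sup>2 + (norm (g x))\<^sup>2)"
    by (intro AE_I2) simp
qed measurable

lemma schwartz_L2:
  assumes "schwartz \<phi>"
  shows "integrable lborel (\<lambda>x. (norm (\<phi> x))\<^sup>2)"
    "integrable lborel (\<lambda>x. (norm (vderiv \<phi> x + complex_of_real x * \<phi> x))\<^sup>2)"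
proof -
  obtain C where C: "C \<ge> 0" "\<And>x. norm (\<phi> x) \<le> C * japanese_weight x"
    "\<And>x. norm (vderiv \<phi> x) \<le> C * japanese_weight x"
    "\<And>x. norm (complex_of_real x * \<phi> x) \<le> C * japanese_weight x"
    using schwartz_bound0[OF assms] by blast
  have [measurable]: "\<phi> \<in> borel_measurable borel" "vderiv \<phi> \<in> borel_measurable borel"
    using schwartz_measurable0[OF assms] by auto
  have sq: "norm ((norm a)\<^sup>2) \<le> B\<^sup>2 * japanese_weight x"
    if "norm a \<le> B * japanese_weight x" for a :: complex and B x
  proof -
    have "(norm a)\<^sup>2 \<le> (B * japanese_weight x)\<^sup>2"
      using that by (intro power_mono) auto
    also have "\<dots> = B\<^sup>2 * (japanese_weight x * japanese_weight x)"
      by (simp add: power2_eq_square algebra_simps)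
    also have "\<dots> \<le> B\<^sup>2 * (japanese_weight x * 1)"
      using japanese_weight_le_1[of x] japanese_weight_pos[of x] by (intro mult_left_mono) auto
    finally show ?thesis by simp
  qed
  show "integrable lborel (\<lambda>x. (norm (\<phi> x))\<^sup>2)"
    by (rule integrable_japanese_weight_bound[OF _ sq[OF C(2)]]) measurable
  have "norm (vderiv \<phi> x + complex_of_real x * \<phi> x) \<le> (2 * C) * japanese_weight x" for x
    using norm_triangle_mono[OF C(3,4)[of x]] by simp
  from sq[OF this] show "integrable lborel (\<lambda>x. (norm (vderiv \<phi> x + complex_of_real x * \<phi> x))\<^sup>2)"
    by (rule integrable_japanese_weight_bound[rotated]) measurable
qed

lemma hermite_L2: "integrable lborel (\<lambda>x. (norm (hermite_cfun n x))\<^sup>2)"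
  using schwartz_L2(1)[OF schwartz_hermite] .

lemma integrable_hermite_mult:
  assumes "f \<in> borel_measurable lborel" "integrable lborel (\<lambda>x. (norm (f x))\<^sup>2)"
  shows "integrable lborel (\<lambda>x. f x * hermite_cfun k x)"
  by (rule integrable_mult_L2[OF assms(1) _ assms(2) hermite_L2]) measurable

text \<open>One Gram-Schmidt step; iterating it gives Bessel's inequality.\<close>

lemma hermite_remove_component:
  fixes f :: "real \<Rightarrow> complex" and k :: nat
  assumes [measurable]: "f \<in> borel_measurable lborel" and f: "integrable lborel (\<lambda>x. (norm (f x))\<^sup>2)"
  defines "c \<equiv> hermite_coeff f k"
  defines "g \<equiv> (\<lambda>x. f x - c * hermite_cfun k x)"
  shows "integrable lborel (\<lambda>x. (norm (g x))\<^sup>2)"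
    and "(\<integral>x. (norm (g x))\<^sup>2 \<partial>lborel) = (\<integral>x. (norm (f x))\<^sup>2 \<partial>lborel) - (norm c)\<^sup>2"
    and "j \<noteq> k \<Longrightarrow> hermite_coeff g j = hermite_coeff f j"
proof -
  have fh: "integrable lborel (\<lambda>x. f x * hermite_cfun j x)" for j
    using integrable_hermite_mult[OF assms(1) f] .
  have hh: "integrable lborel (\<lambda>x. hermite_cfun k x * hermite_cfun j x)" for j
    by (rule integrable_hermite_mult[OF _ hermite_L2]) measurable
  have h2: "(\<integral>x. (norm (hermite_cfun k x))\<^sup>2 \<partial>lborel) = 1"
  proof -
    have "hermite_coeff (hermite_cfun k) k = complex_of_real (\<integral>x. (norm (hermite_cfun k x))\<^sup>2 \<partial>lborel)"
      by (simp add: hermite_coeff_def power2_eq_square flip: of_real_mult)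
    then show ?thesis by (simp add: hermite_orthonormal)
  qed
  have eq: "(norm (g x))\<^sup>2 = (norm (f x))\<^sup>2 - 2 * Re (cnj c * (f x * hermite_cfun k x))
      + (norm c)\<^sup>2 * (norm (hermite_cfun k x))\<^sup>2" for x
    unfolding g_def cmod_power2 by (simp add: power2_eq_square algebra_simps)
  have i: "integrable lborel (\<lambda>x. Re (cnj c * (f x * hermite_cfun k x)))"
    by (intro integrable_Re integrable_mult_right fh)
  show "integrable lborel (\<lambda>x. (norm (g x))\<^sup>2)"
    unfolding eq
    by (intro Bochner_Integration.integrable_add Bochner_Integration.integrable_diff
        integrable_mult_right i f hermite_L2)
  have "(\<integral>x. Re (cnj c * (f x * hermite_cfun k x)) \<partial>lborel) = Re (cnj c * c)"
    unfolding integral_Re[OF integrable_mult_right[OF fh]] by (simp add: c_def hermite_coeff_def)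
  also have "\<dots> = (norm c)\<^sup>2"
    unfolding cmod_power2 by (simp add: power2_eq_square)
  finally have *: "(\<integral>x. Re (cnj c * (f x * hermite_cfun k x)) \<partial>lborel) = (norm c)\<^sup>2" .
  have "(\<integral>x. (norm (g x))\<^sup>2 \<partial>lborel)
      = (\<integral>x. (norm (f x))\<^sup>2 - 2 * Re (cnj c * (f x * hermite_cfun k x)) \<partial>lborel)
        + (\<integral>x. (norm c)\<^sup>2 * (norm (hermite_cfun k x))\<^sup>2 \<partial>lborel)"
    unfolding eq
    by (intro Bochner_Integration.integral_add Bochner_Integration.integrable_diff
        integrable_mult_right i f hermite_L2)
  also have "(\<integral>x. (norm (f x))\<^sup>2 - 2 * Re (cnj c * (f x * hermite_cfun k x)) \<partial>lborel)
      = (\<integral>x. (norm (f x))\<^sup>2 \<partial>lborel) - (\<integral>x. 2 * Re (cnj c * (f x * hermite_cfun k x)) \<partial>lborel)"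
    by (intro Bochner_Integration.integral_diff integrable_mult_right i f)
  finally show "(\<integral>x. (norm (g x))\<^sup>2 \<partial>lborel) = (\<integral>x. (norm (f x))\<^sup>2 \<partial>lborel) - (norm c)\<^sup>2"
    unfolding integral_mult_right_zero * h2 by simp
  assume "j \<noteq> k"
  moreover have "hermite_coeff g j = hermite_coeff f j - c * hermite_coeff (hermite_cfun k) j"
    unfolding hermite_coeff_def g_def using fh[of j] hh[of j]
    by (simp add: left_diff_distrib mult.assoc)
  ultimately show "hermite_coeff g j = hermite_coeff f j"
    by (simp add: hermite_orthonormal)
qed

lemma hermite_bessel:
  fixes f :: "real \<Rightarrow> complex"
  assumes "f \<in> borel_measurable lborel" "integrable lborel (\<lambda>x. (norm (f x))\<^sup>2)"
  shows "(\<Sum>k<K. (norm (hermite_coeff f k))\<^sup>2) \<le> (\<integral>x. (norm (f x))\<^sup>2 \<partial>lborel)"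
  using assms
proof (induction K arbitrary: f)
  case 0
  then show ?case by simp
next
  case (Suc K)
  define g where "g = (\<lambda>x. f x - hermite_coeff f K * hermite_cfun K x)"
  have [measurable]: "f \<in> borel_measurable lborel" by fact
  have g: "g \<in> borel_measurable lborel" unfolding g_def by measurable
  have gx: "f x - hermite_coeff f K * hermite_cfun K x = g x" for x
    by (simp add: g_def)
  note r = hermite_remove_component[OF Suc.prems, where k = K, unfolded gx]
  have "(\<Sum>k<K. (norm (hermite_coeff f k))\<^sup>2) = (\<Sum>k<K. (norm (hermite_coeff g k))\<^sup>2)"
    using r(3) by (intro sum.cong) auto
  also have "\<dots> \<le> (\<integral>x. (norm (g x))\<^sup>2 \<partial>lborel)"
    using Suc.IH[OF g r(1)] .
  finally show ?case using r(2) by simp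
qed

text \<open>Bessel's inequality for \<open>\<phi>' + x \<phi>\<close>, whose coefficients are \<open>\<surd>(2k+2) \<langle>\<phi>, h\<^sub>k\<^sub>+\<^sub>1\<rangle>\<close>, controls the
  \<open>\<H>\<^sup>1\<close> norm of \<open>\<phi>\<close>.\<close>

lemma hermite_bessel_H1:
  assumes "schwartz \<phi>"
  shows "(\<Sum>k<K. (2 * real k + 1) * (norm (hermite_coeff \<phi> k))\<^sup>2)
    \<le> (\<integral>x. (norm (vderiv \<phi> x + complex_of_real x * \<phi> x))\<^sup>2 \<partial>lborel) + (\<integral>x. (norm (\<phi> x))\<^sup>2 \<partial>lborel)"
proof -
  have [measurable]: "\<phi> \<in> borel_measurable borel" "vderiv \<phi> \<in> borel_measurable borel"
    using schwartz_measurable0[OF assms] by auto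
  define f where "f x = vderiv \<phi> x + complex_of_real x * \<phi> x" for x
  have f: "f \<in> borel_measurable lborel" unfolding f_def by measurable
  have "(\<Sum>k<K. (2 * real k + 1) * (norm (hermite_coeff \<phi> k))\<^sup>2)
      = (\<Sum>k<K. 2 * real k * (norm (hermite_coeff \<phi> k))\<^sup>2) + (\<Sum>k<K. (norm (hermite_coeff \<phi> k))\<^sup>2)"
    by (simp add: distrib_right sum.distrib)
  also have "(\<Sum>k<K. 2 * real k * (norm (hermite_coeff \<phi> k))\<^sup>2)
      \<le> (\<Sum>k<Suc K. 2 * real k * (norm (hermite_coeff \<phi> k))\<^sup>2)"
    by simp
  also have "\<dots> = (\<Sum>k<K. (norm (hermite_coeff f k))\<^sup>2)"
    unfolding sum.lessThan_Suc_shift f_def[abs_def] hermite_coeff_lowering[OF assms]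
    by (simp add: norm_mult power_mult_distrib algebra_simps)
  also have "\<dots> \<le> (\<integral>x. (norm (f x))\<^sup>2 \<partial>lborel)"
    using hermite_bessel[OF f] schwartz_L2(2)[OF assms] by (simp add: f_def)
  finally show ?thesis
    using hermite_bessel[OF _ schwartz_L2(1)[OF assms], of K] by (simp add: f_def)
qed

section \<open>Mehler's formula on the diagonal\<close>

text \<open>Squaring two consecutive instances of the three-term recurrence, the first solved for \<open>h\<^sub>n\<^sub>+\<^sub>3\<close> and the
  second for \<open>h\<^sub>n\<close>, produces the same cross term \<open>h\<^sub>n\<^sub>+\<^sub>1 h\<^sub>n\<^sub>+\<^sub>2\<close>, which cancels.\<close>

lemma hermite_square_recurrence:
  fixes x :: real
  defines "f \<equiv> \<lambda>n. (hermite_fun n x)\<^sup>2"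
  shows "f 1 = 2 * x\<^sup>2 * f 0"
    and "2 * f 2 = (2 * x\<^sup>2 - 1) * f 1 + (1 - 2 * x\<^sup>2) * f 0"
    and "(real n + 3) * f (n + 3)
      = (2 * x\<^sup>2 - (real n + 2)) * f (n + 2) + (real n + 2 - 2 * x\<^sup>2) * f (n + 1) + (real n + 1) * f n"
proof -
  define s where "s k = sqrt (2 * (real k + 1))" for k
  have s: "s k * s k = 2 * (real k + 1)" for k by (simp add: s_def)
  have rec: "s (Suc k) * hermite_fun (k + 2) x = 2 * x * hermite_fun (k + 1) x - s k * hermite_fun k x" for k
    using hermite_recurrence[of k x] by (simp add: s_def add.commute)
  have 1: "s 0 * hermite_fun 1 x = 2 * x * hermite_fun 0 x"
    using hermite_1[of x] by (simp add: s_def)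
  have "(s 0 * s 0) * f 1 = (s 0 * hermite_fun 1 x)\<^sup>2"
    by (simp add: f_def power2_eq_square)
  then show f1: "f 1 = 2 * x\<^sup>2 * f 0"
    unfolding 1 s by (simp add: f_def power2_eq_square)
  have "(s 1 * s 1) * f 2 = (s (Suc 0) * hermite_fun (0 + 2) x)\<^sup>2"
    by (simp add: f_def power_mult_distrib power2_eq_square[of "s _"] flip: numeral_2_eq_2)
  also have "\<dots> = 4 * x\<^sup>2 * f 1 - 4 * x * (s 0 * hermite_fun 1 x) * hermite_fun 0 x + (s 0 * s 0) * f 0"
    unfolding rec by (simp add: f_def power2_eq_square algebra_simps)
  also have "4 * x * (s 0 * hermite_fun 1 x) * hermite_fun 0 x = 8 * (x\<^sup>2 * f 0)"
    unfolding 1 by (simp add: f_def power2_eq_square)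
  finally show "2 * f 2 = (2 * x\<^sup>2 - 1) * f 1 + (1 - 2 * x\<^sup>2) * f 0"
    unfolding s using f1 by (simp add: algebra_simps)
  define c where "c = 4 * x * s (n + 1) * hermite_fun (n + 2) x * hermite_fun (n + 1) x"
  have "(s (n + 2) * s (n + 2)) * f (n + 3) = (s (Suc (n + 1)) * hermite_fun (n + 1 + 2) x)\<^sup>2"
    by (simp add: f_def power2_eq_square numeral_3_eq_3)
  also have "\<dots> = 4 * x\<^sup>2 * f (n + 2) - c + (s (n + 1) * s (n + 1)) * f (n + 1)"
    unfolding rec by (simp add: f_def c_def power2_eq_square algebra_simps)
  finally have A: "2 * (real n + 3) * f (n + 3) = 4 * x\<^sup>2 * f (n + 2) - c + 2 * (real n + 2) * f (n + 1)"
    unfolding s by (simp add: algebra_simps)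
  have "(s n * s n) * f n = (s n * hermite_fun n x)\<^sup>2"
    by (simp add: f_def power2_eq_square)
  also have "s n * hermite_fun n x = 2 * x * hermite_fun (n + 1) x - s (n + 1) * hermite_fun (n + 2) x"
    using rec[of n] by simp
  also have "(\<dots>)\<^sup>2 = 4 * x\<^sup>2 * f (n + 1) - c + (s (n + 1) * s (n + 1)) * f (n + 2)"
    by (simp add: f_def c_def power2_eq_square algebra_simps)
  finally have B: "2 * (real n + 1) * f n = 4 * x\<^sup>2 * f (n + 1) - c + 2 * (real n + 2) * f (n + 2)"
    unfolding s by (simp add: algebra_simps)
  show "(real n + 3) * f (n + 3)
      = (2 * x\<^sup>2 - (real n + 2)) * f (n + 2) + (real n + 2 - 2 * x\<^sup>2) * f (n + 1) + (real n + 1) * f n"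
    using A B by (simp add: algebra_simps)
qed

text \<open>For fixed \<open>x\<close> the first coefficient of the three-term recurrence tends to \<open>0\<close> and the second is
  at most \<open>1\<close>. Hence the generating function of \<open>h\<^sub>n(x)\<^sup>2\<close> converges in the unit disc.\<close>

lemma hermite_subexponential:
  assumes "\<rho> > 1"
  shows "\<exists>C n0. \<forall>k. \<bar>hermite_fun (n0 + k) x\<bar> \<le> C * \<rho> ^ k"
proof -
  have "(\<lambda>n. 2 * \<bar>x\<bar> / sqrt (2 * (real n + 2))) \<longlonglongrightarrow> 0"
    by real_asymp
  then have "eventually (\<lambda>n. 2 * \<bar>x\<bar> / sqrt (2 * (real n + 2)) < \<rho> - 1) sequentially"
    using assms by (intro order_tendstoD(2)) auto
  then obtain n0 where n0: "\<And>n. n \<ge> n0 \<Longrightarrow> 2 * \<bar>x\<bar> / sqrt (2 * (real n + 2)) < \<rho> - 1"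
    by (auto simp: eventually_sequentially)
  define C where "C = \<bar>hermite_fun n0 x\<bar> + \<bar>hermite_fun (Suc n0) x\<bar>"
  have "\<bar>hermite_fun (n0 + k) x\<bar> \<le> C * \<rho> ^ k" for k
  proof (induction k rule: induct_nat_012)
    case 0
    then show ?case by (simp add: C_def)
  next
    case 1
    have "\<bar>hermite_fun (n0 + 1) x\<bar> \<le> C * 1" by (simp add: C_def)
    also have "\<dots> \<le> C * \<rho>" using assms by (intro mult_left_mono) (auto simp: C_def)
    finally show ?case by simp
  next
    case (ge2 k)
    define n where "n = n0 + k"
    define t where "t = sqrt (2 * (real n + 2))"
    define u where "u = sqrt (2 * (real n + 1))"
    have t: "t > 0" "u \<le> t" "u \<ge> 0" by (auto simp: t_def u_def)
    have x: "2 * \<bar>x\<bar> \<le> (\<rho> - 1) * t"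
      using n0[of n] t(1) by (simp add: n_def t_def field_simps)
    have "t * \<bar>hermite_fun (Suc (Suc n)) x\<bar> = \<bar>2 * x * hermite_fun (Suc n) x - u * hermite_fun n x\<bar>"
      using hermite_recurrence[of n x] t(1) unfolding t_def[symmetric] u_def[symmetric]
      by (metis abs_mult abs_of_pos)
    also have "\<dots> \<le> 2 * \<bar>x\<bar> * \<bar>hermite_fun (Suc n) x\<bar> + u * \<bar>hermite_fun n x\<bar>"
      using t by (intro order_trans[OF abs_triangle_ineq4]) (simp add: abs_mult)
    also have "\<dots> \<le> (\<rho> - 1) * t * (C * \<rho> ^ Suc k) + t * (C * \<rho> ^ k)"
      using ge2 t assms by (intro add_mono mult_mono[OF x] mult_mono[OF t(2)]) (auto simp: n_def)
    also have "\<dots> = t * (C * \<rho> ^ k * ((\<rho> - 1) * \<rho> + 1))"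
      by (simp add: algebra_simps)
    also have "\<dots> \<le> t * (C * \<rho> ^ k * (\<rho> * \<rho>))"
    proof -
      have "(\<rho> - 1) * \<rho> + 1 \<le> \<rho> * \<rho>" using assms by (simp add: algebra_simps)
      then show ?thesis using assms t by (intro mult_left_mono) (auto simp: C_def)
    qed
    finally show ?case using t by (simp add: n_def algebra_simps)
  qed
  then show ?thesis by blast
qed

lemma summable_hermite_squares:
  assumes "\<bar>r\<bar> < 1"
  shows "summable (\<lambda>n. (hermite_fun n x)\<^sup>2 * r ^ n)"
proof (cases "r = 0")
  case True
  then show ?thesis by (intro summable_finite[of "{0}"]) auto
next
  case False
  define \<rho> where "\<rho> = 1 / sqrt (sqrt \<bar>r\<bar>)"
  have "sqrt (sqrt \<bar>r\<bar>) < 1" "sqrt (sqrt \<bar>r\<bar>) > 0" using assms False by auto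
  then have "\<rho> > 1" by (simp add: \<rho>_def)
  then obtain C n0 where C: "\<And>k. \<bar>hermite_fun (n0 + k) x\<bar> \<le> C * \<rho> ^ k"
    using hermite_subexponential by blast
  have \<rho>2: "\<rho> * \<rho> * \<bar>r\<bar> = sqrt \<bar>r\<bar>"
    using False by (simp add: \<rho>_def field_simps)
  have "summable (\<lambda>k. (hermite_fun (k + n0) x)\<^sup>2 * r ^ (k + n0))"
  proof (rule summable_comparison_test')
    show "summable (\<lambda>k. (C\<^sup>2 * \<bar>r\<bar> ^ n0) * sqrt \<bar>r\<bar> ^ k)"
      using assms by (intro summable_mult summable_geometric) auto
    fix k
    have "(hermite_fun (k + n0) x)\<^sup>2 \<le> (C * \<rho> ^ k)\<^sup>2"
      using C[of k] by (metis abs_le_square_iff abs_of_nonneg abs_ge_zero add.commute order_trans)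
    then have "norm ((hermite_fun (k + n0) x)\<^sup>2 * r ^ (k + n0)) \<le> (C * \<rho> ^ k)\<^sup>2 * \<bar>r\<bar> ^ (k + n0)"
      by (simp add: abs_mult power_abs mult_right_mono)
    also have "\<dots> = (C\<^sup>2 * \<bar>r\<bar> ^ n0) * (\<rho> * \<rho> * \<bar>r\<bar>) ^ k"
      by (simp add: power_mult_distrib power_add power2_eq_square algebra_simps)
    finally show "norm ((hermite_fun (k + n0) x)\<^sup>2 * r ^ (k + n0)) \<le> (C\<^sup>2 * \<bar>r\<bar> ^ n0) * sqrt \<bar>r\<bar> ^ k"
      by (simp add: \<rho>2)
  qed
  then show ?thesis by (rule summable_iff_shift[THEN iffD1])
qed

text \<open>The recurrence of the squares says that the generating function \<open>F\<close> satisfies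
  \<open>(1+r)\<^sup>2(1-r) F' = (2x\<^sup>2(1-r) + r(1+r)) F\<close>, a linear equation of first order that the closed form
  satisfies as well; so their quotient is constant.\<close>

lemma mehler_diagonal:
  assumes "0 \<le> r" "r < 1"
  shows "(\<lambda>n. (hermite_fun n x)\<^sup>2 * r ^ n) sums
    (exp (- (x\<^sup>2 * (1 - r) / (1 + r))) / sqrt (pi * (1 - r\<^sup>2)))"
proof -
  define c where "c = 2 * x\<^sup>2"
  define F where "F = Abs_fps (\<lambda>n. (hermite_fun n x)\<^sup>2)"
  have rad: "fps_conv_radius F \<ge> 1"
    unfolding fps_conv_radius_def
  proof (rule conv_radius_geI_ex)
    fix r :: real assume "0 < r" "ereal r < 1"
    then have "norm r = r \<and> summable (\<lambda>n. fps_nth F n * r ^ n)"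
      using summable_hermite_squares[of r x] by (simp add: F_def)
    then show "\<exists>z::real. norm z = r \<and> summable (\<lambda>n. fps_nth F n * z ^ n)" by blast
  qed
  have rad': "ereal (norm z) < fps_conv_radius F" if "\<bar>z\<bar> < 1" for z :: real
    using that rad by (metis ereal_less_eq(3) less_ereal.simps(1) one_ereal_def order_less_le_trans real_norm_def)
  have rec: "fps_of_poly [:1, 1, -1, -1:] * fps_deriv F = fps_of_poly [:c, 1 - c, 1:] * F"
  proof (rule fps_ext)
    fix n :: nat
    consider "n = 0" | "n = 1" | m where "n = m + 2"
      by (metis One_nat_def add_2_eq_Suc' not0_implies_Suc)
    then show "fps_nth (fps_of_poly [:1, 1, -1, -1:] * fps_deriv F) n
        = fps_nth (fps_of_poly [:c, 1 - c, 1:] * F) n"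
    proof cases
      case 1
      then show ?thesis
        using hermite_square_recurrence(1)[of x] by (simp add: F_def c_def)
    next
      case 2
      then show ?thesis
        using hermite_square_recurrence(1,2)[of x]
        by (simp add: F_def c_def fps_mult_nth numeral_2_eq_2 algebra_simps)
    next
      case 3
      have *: "fps_nth (fps_of_poly [:a0, a1, a2, a3:] * G) (m + 2)
         = a0 * fps_nth G (m + 2) + a1 * fps_nth G (m + 1) + a2 * fps_nth G m
           + (if m = 0 then 0 else a3 * fps_nth G (m - 1))" for a0 a1 a2 a3 and G :: "real fps"
        by (simp add: fps_of_poly_pCons distrib_right mult.assoc fps_X_mult_nth mult.commute[of _ fps_X]
              mult.left_commute[of _ fps_X])
      define f where "f n = (hermite_fun n x)\<^sup>2" for n
      have f: "fps_nth F n = f n" for n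
        by (simp add: F_def f_def)
      have L: "fps_nth (fps_of_poly [:1, 1, -1, -1:] * fps_deriv F) (m + 2)
         = (real m + 3) * f (m + 3) + (real m + 2) * f (m + 2) - (real m + 1) * f (m + 1) - real m * f m"
        unfolding * by (cases m) (simp_all add: f algebra_simps eval_nat_numeral)
      have R: "fps_nth (fps_of_poly [:c, 1 - c, 1:] * F) (m + 2)
         = c * f (m + 2) + (1 - c) * f (m + 1) + f m"
        using *[of c "1 - c" 1 0 F] by (simp add: f)
      show ?thesis
        using hermite_square_recurrence(3)[of m x] unfolding 3 L R f_def[symmetric]
        by (simp add: c_def algebra_simps)
    qed
  qed
  have ode: "(1 + z)\<^sup>2 * (1 - z) * eval_fps (fps_deriv F) z = (c * (1 - z) + z * (1 + z)) * eval_fps F z"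
    if "\<bar>z\<bar> < 1" for z
  proof -
    have d: "ereal (norm z) < fps_conv_radius (fps_deriv F)"
      using rad'[OF that] fps_conv_radius_deriv[of F] by (meson order_less_le_trans)
    have "eval_fps (fps_of_poly [:1, 1, -1, -1:] * fps_deriv F) z
      = eval_fps (fps_of_poly [:c, 1 - c, 1:] * F) z"
      by (simp only: rec)
    then have "poly [:1, 1, -1, -1:] z * eval_fps (fps_deriv F) z = poly [:c, 1 - c, 1:] z * eval_fps F z"
      using d rad'[OF that] by (simp add: eval_fps_mult)
    then show ?thesis by (simp add: power2_eq_square algebra_simps)
  qed
  define G where "G z = sqrt (1 - z\<^sup>2) * exp (x\<^sup>2 * (1 - z) / (1 + z)) * eval_fps F z" for z
  have "\<exists>C. \<forall>z\<in>{-1<..<1}. G z = C"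
  proof (rule has_field_derivative_zero_constant)
    fix z :: real assume z: "z \<in> {-1<..<1}"
    then have z1: "\<bar>z\<bar> < 1" "1 + z > 0" "1 - z > 0" by auto
    have z2: "1 - z\<^sup>2 > 0"
      using mult_pos_pos[OF z1(2,3)] by (simp add: power2_eq_square algebra_simps)
    define S where "S = sqrt (1 - z\<^sup>2)"
    define E where "E = exp (x\<^sup>2 * (1 - z) / (1 + z))"
    have S: "S > 0" "S * S = (1 - z) * (1 + z)"
      using z2 by (auto simp: S_def power2_eq_square algebra_simps)
    have dF: "(eval_fps F has_field_derivative eval_fps (fps_deriv F) z) (at z within A)" for A
      by (rule has_field_derivative_eval_fps[OF rad'[OF z1(1)]])
    have dS: "((\<lambda>z. sqrt (1 - z\<^sup>2)) has_field_derivative (- z / S)) (at z within A)" for A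
      unfolding S_def using z2 by (auto intro!: derivative_eq_intros simp: field_simps)
    have dE: "((\<lambda>z. exp (x\<^sup>2 * (1 - z) / (1 + z))) has_field_derivative (E * (- c / (1 + z)\<^sup>2))) (at z within A)" for A
      unfolding E_def using z1
      by (auto intro!: derivative_eq_intros simp: c_def power2_eq_square divide_simps)
         (simp add: algebra_simps)
    have "(G has_field_derivative (- z / S * E + E * (- c / (1 + z)\<^sup>2) * S) * eval_fps F z
        + eval_fps (fps_deriv F) z * (S * E)) (at z within {-1<..<1})"
      unfolding G_def[abs_def]
      by (rule DERIV_cong[OF DERIV_mult[OF DERIV_mult[OF dS dE] dF]]) (simp add: S_def E_def)
    also have "(- z / S * E + E * (- c / (1 + z)\<^sup>2) * S) * eval_fps F z + eval_fps (fps_deriv F) z * (S * E)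
       = E / (S * (1 + z)\<^sup>2) * ((S * S) * (1 + z)\<^sup>2 * eval_fps (fps_deriv F) z
           - (z * (1 + z)\<^sup>2 + c * (S * S)) * eval_fps F z)"
    proof -
      have "(1 + z)\<^sup>2 \<noteq> 0" using z1(2) by simp
      moreover have "(- z / S * E + E * (- c / P) * S) * a + b * (S * E)
          = E / (S * P) * ((S * S) * P * b - (z * P + c * (S * S)) * a)" if "P \<noteq> 0" for P a b
        using S(1) that by (simp add: divide_simps) (simp add: algebra_simps)
      ultimately show ?thesis by blast
    qed
    also have "(S * S) * (1 + z)\<^sup>2 * eval_fps (fps_deriv F) z
       = (1 + z) * ((1 + z)\<^sup>2 * (1 - z) * eval_fps (fps_deriv F) z)"
      unfolding S(2) by (simp add: algebra_simps)
    also have "E / (S * (1 + z)\<^sup>2) * ((1 + z) * ((1 + z)\<^sup>2 * (1 - z) * eval_fps (fps_deriv F) z)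
           - (z * (1 + z)\<^sup>2 + c * (S * S)) * eval_fps F z) = 0"
      unfolding ode[OF z1(1)] S(2) by (simp add: algebra_simps power2_eq_square)
    finally show "(G has_field_derivative 0) (at z within {-1<..<1})" .
  qed auto
  then obtain C where "\<And>z. z \<in> {-1<..<1} \<Longrightarrow> G z = C" by blast
  from this[of r] this[of 0] assms have "G r = G 0" by auto
  also have "G 0 = exp (x\<^sup>2) * (hermite_fun 0 x)\<^sup>2"
    by (simp add: G_def F_def eval_fps_at_0)
  also have "\<dots> = 1 / sqrt pi"
  proof -
    have "pi powr (1/4) * pi powr (1/4) = sqrt pi"
      by (simp add: powr_half_sqrt flip: powr_add)
    moreover have "exp (x\<^sup>2) * (exp (- (x\<^sup>2) / 2) * exp (- (x\<^sup>2) / 2)) = 1"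
      by (simp flip: exp_add)
    ultimately show ?thesis by (simp add: hermite_0 power2_eq_square)
  qed
  finally have "eval_fps F r * sqrt (1 - r\<^sup>2) * exp (x\<^sup>2 * (1 - r) / (1 + r)) = 1 / sqrt pi"
    by (simp add: G_def mult.commute)
  moreover have "1 - r\<^sup>2 > 0"
    using assms by (simp add: abs_square_less_1)
  ultimately have "eval_fps F r = exp (- (x\<^sup>2 * (1 - r) / (1 + r))) / sqrt (pi * (1 - r\<^sup>2))"
  proof -
    assume r: "eval_fps F r * sqrt (1 - r\<^sup>2) * exp (x\<^sup>2 * (1 - r) / (1 + r)) = 1 / sqrt pi" "1 - r\<^sup>2 > 0"
    have "a = inverse e / (p * s)" if "a * s * e = 1 / p" "s > 0" "e > 0" "p > 0" for a s e p :: real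
      using that by (simp add: field_simps)
    from this[OF r(1)] r(2) show ?thesis
      unfolding real_sqrt_mult exp_minus by simp
  qed
  moreover have "(\<lambda>n. (hermite_fun n x)\<^sup>2 * r ^ n) sums eval_fps F r"
    using summable_sums[OF summable_hermite_squares[of r x]] assms by (simp add: eval_fps_def F_def)
  ultimately show ?thesis by simp
qed

section \<open>Gaussian majorants for weighted sums of squared Hermite functions\<close>

lemma dyadic_power_between:
  "\<exists>j. n \<le> 2 ^ j \<and> 2 ^ j \<le> 2 * n + (1::nat)"
proof (induction n)
  case 0
  then show ?case by (intro exI[of _ 0]) auto
next
  case (Suc n)
  then obtain j where j: "n \<le> 2 ^ j" "2 ^ j \<le> 2 * n + 1" by blast
  show ?case
  proof (cases "Suc n \<le> 2 ^ j")
    case True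
    then show ?thesis using j by (intro exI[of _ j]) auto
  next
    case False
    then have "2 ^ j = n" using j by simp
    then show ?thesis by (intro exI[of _ "Suc j"]) auto
  qed
qed

definition dyadic_gauss :: "nat \<Rightarrow> real \<Rightarrow> real" where
  "dyadic_gauss j x = exp (- ((1/2) ^ j / 4) * x\<^sup>2)"

lemma dyadic_gauss_pos: "dyadic_gauss j x > 0"
  and dyadic_gauss_le_1: "dyadic_gauss j x \<le> 1"
  by (auto simp: dyadic_gauss_def)

text \<open>Mehler's formula at \<open>r = 1 - 2\<^sup>-\<^sup>j\<^sup>-\<^sup>1\<close>, the radius that resolves the frequencies \<open>n \<le> 2\<^sup>j\<close>.\<close>

lemma hermite_dyadic_sum:
  "(\<Sum>n<N. (hermite_fun n x)\<^sup>2 * (1 - (1/2) ^ (j + 1)) ^ n) \<le> sqrt 2 * sqrt 2 ^ j * dyadic_gauss j x"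
proof -
  define y :: real where "y = (1/2) ^ (j + 1)"
  have y: "0 < y" "y \<le> 1/2"
    using power_decreasing[of 1 "j + 1" "1/2::real"] by (auto simp: y_def)
  have "(\<Sum>n<N. (hermite_fun n x)\<^sup>2 * (1 - y) ^ n) \<le> (\<Sum>n. (hermite_fun n x)\<^sup>2 * (1 - y) ^ n)"
    using mehler_diagonal[of "1 - y" x] y by (intro sum_le_suminf) (auto simp: sums_iff)
  also have "\<dots> = exp (- (x\<^sup>2 * (1 - (1 - y)) / (1 + (1 - y)))) / sqrt (pi * (1 - (1 - y)\<^sup>2))"
    using mehler_diagonal[of "1 - y" x] y by (simp add: sums_iff)
  also have "\<dots> \<le> exp (- (x\<^sup>2 * y / 2)) / sqrt y"
  proof (intro frac_le)
    have "x\<^sup>2 * y / 2 \<le> x\<^sup>2 * (1 - (1 - y)) / (1 + (1 - y))"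
      using y by (intro frac_le) auto
    then show "exp (- (x\<^sup>2 * (1 - (1 - y)) / (1 + (1 - y)))) \<le> exp (- (x\<^sup>2 * y / 2))" by simp
    have "1 * y \<le> (pi * (2 - y)) * y"
    proof (rule mult_right_mono)
      have "1 * 1 \<le> pi * (2 - y)"
        using y pi_gt3 by (intro mult_mono) auto
      then show "1 \<le> pi * (2 - y)" by simp
    qed (use y in auto)
    then show "sqrt y \<le> sqrt (pi * (1 - (1 - y)\<^sup>2))"
      by (simp add: power2_eq_square algebra_simps)
  qed (use y in auto)
  also have "exp (- (x\<^sup>2 * y / 2)) = dyadic_gauss j x"
    by (simp add: y_def dyadic_gauss_def algebra_simps)
  also have "dyadic_gauss j x / sqrt y = sqrt 2 * sqrt 2 ^ j * dyadic_gauss j x"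
    by (simp add: y_def real_sqrt_power real_sqrt_divide real_sqrt_mult power_divide field_simps)
  finally show ?thesis by (simp add: y_def)
qed

text \<open>A single \<open>j\<close> with \<open>n \<le> 2\<^sup>j \<le> 2n + 1\<close> suffices: the second inequality compares the powers, and by
  the first and Bernoulli's inequality \<open>(1 - 2\<^sup>-\<^sup>j\<^sup>-\<^sup>1)\<^sup>n \<ge> 1/2\<close>.\<close>

lemma odd_powr_dyadic:
  assumes "s \<ge> 0" "n < N"
  shows "(2 * real n + 1) powr (- s) \<le> (\<Sum>j<2 * N. 2 * (2 powr (- s)) ^ j * (1 - (1/2) ^ (j + 1)) ^ n)"
proof -
  obtain j where j: "n \<le> 2 ^ j" "2 ^ j \<le> 2 * n + 1" using dyadic_power_between by blast
  have "j < 2 ^ j" by (rule less_exp)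
  then have "j < 2 * N" using j(2) assms(2) by linarith
  then have jN: "j \<in> {..<2 * N}" by simp
  define y :: real where "y = (1/2) ^ (j + 1)"
  have y: "0 < y" "y \<le> 1"
    using power_decreasing[of 0 "j + 1" "1/2::real"] by (auto simp: y_def)
  have "real n * y \<le> 2 ^ j * y"
    using j(1) y by (intro mult_right_mono) (auto simp flip: of_nat_power simp: of_nat_le_iff[symmetric] simp del: of_nat_le_iff)
  also have "\<dots> = 1/2" by (simp add: y_def power_divide)
  finally have "1/2 \<le> 1 + real n * (- y)" by simp
  also have "\<dots> \<le> (1 + (- y)) ^ n" using y by (intro Bernoulli_inequality) auto
  finally have B: "1 \<le> 2 * (1 - y) ^ n" by simp
  have "(2 * real n + 1) powr (- s) \<le> (2 ^ j) powr (- s)"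
  proof (rule powr_mono2')
    have "real (2 ^ j) \<le> real (2 * n + 1)" using j(2) by (simp only: of_nat_le_iff)
    then show "2 ^ j \<le> 2 * real n + 1" by simp
  qed (use assms in auto)
  also have "\<dots> = (2 powr (- s)) ^ j"
    by (simp add: powr_power powr_powr mult.commute flip: powr_realpow)
  also have "\<dots> \<le> (2 powr (- s)) ^ j * (2 * (1 - y) ^ n)"
    using mult_left_mono[OF B, of "(2 powr (- s)) ^ j"] by simp
  also have "\<dots> = 2 * (2 powr (- s)) ^ j * (1 - (1/2) ^ (j + 1)) ^ n"
    by (simp add: y_def)
  also have "\<dots> \<le> (\<Sum>j<2 * N. 2 * (2 powr (- s)) ^ j * (1 - (1/2) ^ (j + 1)) ^ n)"
  proof (rule member_le_sum[OF jN])
    fix i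
    have "(1/2) ^ (i + 1) \<le> (1::real)" by (intro power_le_one) auto
    then show "0 \<le> 2 * (2 powr (- s)) ^ i * (1 - (1/2) ^ (i + 1)) ^ n"
      by (intro mult_nonneg_nonneg zero_le_power) auto
  qed simp
  finally show ?thesis .
qed

lemma hermite_weighted_sum:
  assumes "s \<ge> 0"
  shows "(\<Sum>n<N. (2 * real n + 1) powr (- s) * (hermite_fun n x)\<^sup>2)
    \<le> 3 * (\<Sum>j<2 * N. (2 powr (1/2 - s)) ^ j * dyadic_gauss j x)"
proof -
  have "(\<Sum>n<N. (2 * real n + 1) powr (- s) * (hermite_fun n x)\<^sup>2)
      \<le> (\<Sum>n<N. (\<Sum>j<2 * N. 2 * (2 powr (- s)) ^ j * (1 - (1/2) ^ (j + 1)) ^ n) * (hermite_fun n x)\<^sup>2)"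
    using odd_powr_dyadic[OF assms] by (intro sum_mono mult_right_mono) auto
  also have "\<dots> = (\<Sum>j<2 * N. 2 * (2 powr (- s)) ^ j * (\<Sum>n<N. (hermite_fun n x)\<^sup>2 * (1 - (1/2) ^ (j + 1)) ^ n))"
    unfolding sum_distrib_right sum_distrib_left by (subst sum.swap) (simp only: mult_ac)
  also have "\<dots> \<le> (\<Sum>j<2 * N. 2 * (2 powr (- s)) ^ j * (sqrt 2 * sqrt 2 ^ j * dyadic_gauss j x))"
    using hermite_dyadic_sum by (intro sum_mono mult_left_mono) auto
  also have "\<dots> = (\<Sum>j<2 * N. (2 * sqrt 2) * ((2 powr (1/2 - s)) ^ j * dyadic_gauss j x))"
  proof (rule sum.cong)
    fix j
    have "2 powr (1/2 - s) = 2 powr (- s) * sqrt 2"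
      by (simp add: powr_half_sqrt[symmetric] flip: powr_add)
    then show "2 * (2 powr (- s)) ^ j * (sqrt 2 * sqrt 2 ^ j * dyadic_gauss j x)
        = (2 * sqrt 2) * ((2 powr (1/2 - s)) ^ j * dyadic_gauss j x)"
      by (simp add: power_mult_distrib)
  qed simp
  also have "\<dots> = (2 * sqrt 2) * (\<Sum>j<2 * N. (2 powr (1/2 - s)) ^ j * dyadic_gauss j x)"
    by (simp only: sum_distrib_left)
  also have "\<dots> \<le> 3 * (\<Sum>j<2 * N. (2 powr (1/2 - s)) ^ j * dyadic_gauss j x)"
  proof (rule mult_right_mono)
    have "sqrt 2 \<le> 3/2" by (rule real_le_lsqrt) (auto simp: power2_eq_square)
    then show "2 * sqrt 2 \<le> 3" by simp
  qed (intro sum_nonneg mult_nonneg_nonneg less_imp_le[OF dyadic_gauss_pos], auto)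
  finally show ?thesis .
qed

lemma geometric_partial_sum_le:
  fixes q :: real
  assumes "0 \<le> q" "q < 1"
  shows "(\<Sum>j<N. q ^ j) \<le> 1 / (1 - q)"
  using sum_le_suminf[OF summable_geometric, of q "{..<N}"] suminf_geometric[of q] assms by auto

text \<open>Each majorant is at most \<open>1\<close>, and for the exponent \<open>s = 1\<close> their coefficients form a convergent
  geometric series. This controls the variance of the random series in every weighted \<open>L\<^sup>2\<close> space of
  finite total weight.\<close>

lemma hermite_inverse_weighted_bounded:
  "\<exists>C. \<forall>N x. (\<Sum>n<N. (hermite_fun n x)\<^sup>2 / (2 * real n + 1)) \<le> C"
proof (intro exI allI)
  fix N x
  have q: "(2::real) powr (1/2 - 1) < 1" by (simp add: powr_less_one)
  have "(\<Sum>n<N. (hermite_fun n x)\<^sup>2 / (2 * real n + 1))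
      = (\<Sum>n<N. (2 * real n + 1) powr (- 1) * (hermite_fun n x)\<^sup>2)"
    by (simp add: powr_minus divide_inverse mult.commute)
  also have "\<dots> \<le> 3 * (\<Sum>j<2 * N. (2 powr (1/2 - 1)) ^ j * dyadic_gauss j x)"
    by (rule hermite_weighted_sum) simp
  also have "\<dots> \<le> 3 * (\<Sum>j<2 * N. (2 powr (1/2 - 1)) ^ j * 1)"
    using dyadic_gauss_le_1 by (intro mult_left_mono sum_mono) auto
  also have "\<dots> \<le> 3 * (1 / (1 - 2 powr (1/2 - 1)))"
    using geometric_partial_sum_le[OF _ q] by (intro mult_left_mono) auto
  finally show "(\<Sum>n<N. (hermite_fun n x)\<^sup>2 / (2 * real n + 1)) \<le> 3 * (1 / (1 - 2 powr (1/2 - 1)))" .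
qed

text \<open>The integral is of order \<open>(a + b)\<^sup>-\<^sup>1\<^sup>/\<^sup>2\<close> with \<open>a = 2\<^sup>-\<^sup>i\<close> and \<open>b = 2\<^sup>-\<^sup>j\<close>. Bounding \<open>a + b\<close> below by the
  geometric mean \<open>a\<^bsup>\<epsilon>\<^esup> b\<^bsup>1-\<epsilon>\<^esup>\<close> separates the two indices; \<open>\<epsilon>\<close> decides which of them carries the growth.\<close>

lemma dyadic_gauss_mult_integral:
  assumes e: "0 \<le> \<epsilon>" "\<epsilon> \<le> 1"
  shows "integrable lborel (\<lambda>x. dyadic_gauss i x * dyadic_gauss j x)"
    and "(\<integral>x. dyadic_gauss i x * dyadic_gauss j x \<partial>lborel)
      \<le> 4 * (2 powr (\<epsilon> / 2)) ^ i * (2 powr ((1 - \<epsilon>) / 2)) ^ j"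
proof -
  define a b :: real where "a = (1/2) ^ i" and "b = (1/2) ^ j"
  have ab: "a > 0" "b > 0" by (auto simp: a_def b_def)
  have eq: "dyadic_gauss i x * dyadic_gauss j x = exp (- ((a + b) / 4) * x\<^sup>2)" for x
    unfolding dyadic_gauss_def a_def b_def by (simp add: algebra_simps add_divide_distrib flip: exp_add)
  have I: "has_bochner_integral lborel (\<lambda>x. exp (- ((a + b) / 4) * x\<^sup>2)) (sqrt (pi / ((a + b) / 4)))"
    using ab by (intro gaussian_integral) auto
  show "integrable lborel (\<lambda>x. dyadic_gauss i x * dyadic_gauss j x)"
    unfolding eq using I by (simp only: has_bochner_integral_iff)
  have "a powr \<epsilon> * b powr (1 - \<epsilon>) \<le> (a + b) powr \<epsilon> * (a + b) powr (1 - \<epsilon>)"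
    using ab e by (intro mult_mono powr_mono2) auto
  also have "\<dots> = a + b"
    using ab by (simp flip: powr_add)
  finally have le: "a powr \<epsilon> * b powr (1 - \<epsilon>) \<le> a + b" .
  have "(\<integral>x. dyadic_gauss i x * dyadic_gauss j x \<partial>lborel) = sqrt (pi / ((a + b) / 4))"
    unfolding eq using I by (simp only: has_bochner_integral_iff)
  also have "\<dots> \<le> sqrt (16 / (a powr \<epsilon> * b powr (1 - \<epsilon>)))"
  proof (rule real_sqrt_le_mono)
    have "4 * pi / (a + b) \<le> 16 / (a powr \<epsilon> * b powr (1 - \<epsilon>))"
      using le ab pi_less_4 by (intro frac_le) auto
    then show "pi / ((a + b) / 4) \<le> 16 / (a powr \<epsilon> * b powr (1 - \<epsilon>))" by (simp add: mult.commute)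
  qed
  also have "\<dots> = 4 * sqrt (1 / a powr \<epsilon>) * sqrt (1 / b powr (1 - \<epsilon>))"
    by (simp add: real_sqrt_divide real_sqrt_mult)
  also have "sqrt (1 / a powr \<epsilon>) = (2 powr (\<epsilon> / 2)) ^ i"
    by (simp add: a_def powr_half_sqrt[symmetric] powr_divide powr_powr powr_power
        mult.commute flip: powr_realpow powr_minus_divide)
  also have "sqrt (1 / b powr (1 - \<epsilon>)) = (2 powr ((1 - \<epsilon>) / 2)) ^ j"
    by (simp add: b_def powr_half_sqrt[symmetric] powr_divide powr_powr powr_power
        mult.commute flip: powr_realpow powr_minus_divide)
  finally show "(\<integral>x. dyadic_gauss i x * dyadic_gauss j x \<partial>lborel)
      \<le> 4 * (2 powr (\<epsilon> / 2)) ^ i * (2 powr ((1 - \<epsilon>) / 2)) ^ j" .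
qed

definition hermite_overlap :: "nat \<Rightarrow> nat \<Rightarrow> real" where
  "hermite_overlap n m = (\<integral>x. (hermite_fun n x)\<^sup>2 * (hermite_fun m x)\<^sup>2 \<partial>lborel)"

lemma hermite_overlap_integrable:
  "integrable lborel (\<lambda>x. (hermite_fun n x)\<^sup>2 * (hermite_fun m x)\<^sup>2)"
  using schwartz_L2(1)[OF schwartz_hermite_mult[of n m]]
  by (simp add: norm_mult power_mult_distrib)

lemma hermite_overlap_nonneg: "hermite_overlap n m \<ge> 0"
  by (simp add: hermite_overlap_def)

lemma hermite_overlap_commute: "hermite_overlap n m = hermite_overlap m n"
  by (simp add: hermite_overlap_def mult.commute)

text \<open>The double series is the integral of a product of two weighted sums of squares. With their Gaussian
  majorants it becomes a double geometric series; the choice \<open>\<epsilon> = s - 1/2\<close> gives both indices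
  the same ratio \<open>2\<^bsup>-\<epsilon>/2\<^esup>\<close>.\<close>

lemma hermite_overlap_sum_bounded:
  assumes "1/2 < s" "s \<le> 1"
  shows "\<exists>B. \<forall>N. (\<Sum>n<N. \<Sum>m<N. (2 * real n + 1) powr (- s) * (2 * real m + 1) powr (- 1)
    * hermite_overlap n m) \<le> B"
proof (intro exI allI)
  fix N
  define \<epsilon> where "\<epsilon> = s - 1/2"
  have e: "0 \<le> \<epsilon>" "\<epsilon> \<le> 1" "\<epsilon> > 0" using assms by (auto simp: \<epsilon>_def)
  define q :: real where "q = 2 powr (- \<epsilon> / 2)"
  have q: "0 \<le> q" "q < 1" using e by (auto simp: q_def powr_less_one)
  define u where "u n = (2 * real n + 1) powr (- s)" for n
  define v where "v n = (2 * real n + 1) powr (- 1)" for n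
  define \<alpha> :: real where "\<alpha> = 2 powr (1/2 - s)"
  define \<beta> :: real where "\<beta> = 2 powr (1/2 - 1)"
  have ineq: "(\<Sum>n<N. \<Sum>m<N. u n * v m * ((hermite_fun n x)\<^sup>2 * (hermite_fun m x)\<^sup>2))
      \<le> (\<Sum>i<2 * N. \<Sum>j<2 * N. 9 * \<alpha> ^ i * \<beta> ^ j * (dyadic_gauss i x * dyadic_gauss j x))" for x
  proof -
    have "(\<Sum>n<N. \<Sum>m<N. u n * v m * ((hermite_fun n x)\<^sup>2 * (hermite_fun m x)\<^sup>2))
        = (\<Sum>n<N. u n * (hermite_fun n x)\<^sup>2) * (\<Sum>m<N. v m * (hermite_fun m x)\<^sup>2)"
      by (simp add: sum_product mult_ac)
    also have "\<dots> \<le> (3 * (\<Sum>i<2 * N. \<alpha> ^ i * dyadic_gauss i x)) * (3 * (\<Sum>j<2 * N. \<beta> ^ j * dyadic_gauss j x))"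
      unfolding u_def v_def \<alpha>_def \<beta>_def using assms
      by (intro mult_mono hermite_weighted_sum sum_nonneg mult_nonneg_nonneg
          less_imp_le[OF dyadic_gauss_pos]) auto
    also have "\<dots> = 9 * (\<Sum>i<2 * N. \<Sum>j<2 * N. (\<alpha> ^ i * dyadic_gauss i x) * (\<beta> ^ j * dyadic_gauss j x))"
      by (simp add: sum_product)
    also have "\<dots> = (\<Sum>i<2 * N. \<Sum>j<2 * N. 9 * \<alpha> ^ i * \<beta> ^ j * (dyadic_gauss i x * dyadic_gauss j x))"
      by (simp add: sum_distrib_left mult_ac)
    finally show ?thesis .
  qed
  have gi: "integrable lborel (\<lambda>x. dyadic_gauss i x * dyadic_gauss j x)" for i j
    using dyadic_gauss_mult_integral(1)[OF e(1,2)] .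
  have "(\<Sum>n<N. \<Sum>m<N. u n * v m * hermite_overlap n m)
      = (\<integral>x. (\<Sum>n<N. \<Sum>m<N. u n * v m * ((hermite_fun n x)\<^sup>2 * (hermite_fun m x)\<^sup>2)) \<partial>lborel)"
    unfolding hermite_overlap_def using hermite_overlap_integrable
    by (simp add: Bochner_Integration.integral_sum)
  also have "\<dots> \<le> (\<integral>x. (\<Sum>i<2 * N. \<Sum>j<2 * N. 9 * \<alpha> ^ i * \<beta> ^ j * (dyadic_gauss i x * dyadic_gauss j x)) \<partial>lborel)"
    using hermite_overlap_integrable gi ineq
    by (intro integral_mono Bochner_Integration.integrable_sum integrable_mult_right) auto
  also have "\<dots> = (\<Sum>i<2 * N. \<Sum>j<2 * N. 9 * \<alpha> ^ i * \<beta> ^ j * (\<integral>x. dyadic_gauss i x * dyadic_gauss j x \<partial>lborel))"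
    using gi by (simp add: Bochner_Integration.integral_sum)
  also have "\<dots> \<le> (\<Sum>i<2 * N. \<Sum>j<2 * N. 9 * \<alpha> ^ i * \<beta> ^ j * (4 * (2 powr (\<epsilon> / 2)) ^ i * (2 powr ((1 - \<epsilon>) / 2)) ^ j))"
    using dyadic_gauss_mult_integral(2)[OF e(1,2)]
    by (intro sum_mono mult_left_mono) (auto simp: \<alpha>_def \<beta>_def)
  also have "\<dots> = (\<Sum>i<2 * N. \<Sum>j<2 * N. 36 * (q ^ i * q ^ j))"
  proof -
    have "1/2 - s + \<epsilon> / 2 = - \<epsilon> / 2" "1/2 - 1 + (1 - \<epsilon>) / 2 = - \<epsilon> / 2"
      by (simp_all add: \<epsilon>_def field_simps)
    then have "\<alpha> * 2 powr (\<epsilon> / 2) = q" "\<beta> * 2 powr ((1 - \<epsilon>) / 2) = q"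
      unfolding \<alpha>_def \<beta>_def q_def powr_add[symmetric] by (simp_all only:)
    then have *: "\<alpha> ^ i * (2 powr (\<epsilon> / 2)) ^ i = q ^ i" "\<beta> ^ j * (2 powr ((1 - \<epsilon>) / 2)) ^ j = q ^ j" for i j
      unfolding power_mult_distrib[symmetric] by auto
    have "9 * \<alpha> ^ i * \<beta> ^ j * (4 * (2 powr (\<epsilon> / 2)) ^ i * (2 powr ((1 - \<epsilon>) / 2)) ^ j) = 36 * (q ^ i * q ^ j)" for i j
      unfolding *(1)[of i, symmetric] *(2)[of j, symmetric] by simp
    then show ?thesis by simp
  qed
  also have "\<dots> = 36 * ((\<Sum>i<2 * N. q ^ i) * (\<Sum>j<2 * N. q ^ j))"
    by (subst sum_product) (simp only: sum_distrib_left)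
  also have "\<dots> \<le> 36 * (1 / (1 - q) * (1 / (1 - q)))"
    using geometric_partial_sum_le[OF q] q
    by (intro mult_left_mono mult_mono) (auto intro: sum_nonneg)
  finally show "(\<Sum>n<N. \<Sum>m<N. (2 * real n + 1) powr (- s) * (2 * real m + 1) powr (- 1)
      * hermite_overlap n m) \<le> 36 * (1 / (1 - 2 powr (- (s - 1/2) / 2)) * (1 / (1 - 2 powr (- (s - 1/2) / 2))))"
    by (simp only: u_def v_def q_def \<epsilon>_def)
qed

section \<open>The norm of a product of two Hermite functions\<close>

lemma vderiv_hermite_mult:
  "vderiv (\<lambda>x. hermite_cfun n x * hermite_cfun m x) x + complex_of_real x * (hermite_cfun n x * hermite_cfun m x)
   = complex_of_real (sqrt (2 * real n) * (hermite_fun (n - 1) x * hermite_fun m x)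
       + (sqrt (2 * real m) / 2 * (hermite_fun n x * hermite_fun (m - 1) x)
          - sqrt (2 * (real m + 1)) / 2 * (hermite_fun n x * hermite_fun (Suc m) x)))"
proof -
  have low: "2 * x * hermite_fun k x - sqrt (2 * (real k + 1)) * hermite_fun (Suc k) x
      = sqrt (2 * real k) * hermite_fun (k - 1) x" for k
    using hermite_lower[of x "k - 1"] hermite_1[of x] by (cases k) (simp_all add: add.commute)
  have d: "((\<lambda>x. hermite_fun n x * hermite_fun m x) has_field_derivative
      (x * hermite_fun n x - sqrt (2 * (real n + 1)) * hermite_fun (Suc n) x) * hermite_fun m x
      + (x * hermite_fun m x - sqrt (2 * (real m + 1)) * hermite_fun (Suc m) x) * hermite_fun n x) (at x)"
    by (rule DERIV_mult[OF hermite_has_derivative hermite_has_derivative])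
  have "vderiv (\<lambda>x. hermite_cfun n x * hermite_cfun m x) x = complex_of_real
      ((x * hermite_fun n x - sqrt (2 * (real n + 1)) * hermite_fun (Suc n) x) * hermite_fun m x
      + (x * hermite_fun m x - sqrt (2 * (real m + 1)) * hermite_fun (Suc m) x) * hermite_fun n x)"
    unfolding vderiv_def of_real_mult[symmetric]
    by (intro vector_derivative_at has_vector_derivative_of_real)
       (use d in \<open>simp add: has_real_derivative_iff_has_vector_derivative\<close>)
  then have "vderiv (\<lambda>x. hermite_cfun n x * hermite_cfun m x) x + complex_of_real x * (hermite_cfun n x * hermite_cfun m x)
    = complex_of_real ((2 * x * hermite_fun n x - sqrt (2 * (real n + 1)) * hermite_fun (Suc n) x) * hermite_fun m x
      + hermite_fun n x * ((2 * x * hermite_fun m x - sqrt (2 * (real m + 1)) * hermite_fun (Suc m) x)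
          - sqrt (2 * (real m + 1)) * hermite_fun (Suc m) x) / 2)"
    by (simp only: of_real_mult[symmetric] of_real_add[symmetric]) (simp add: field_simps)
  also have "\<dots> = complex_of_real (sqrt (2 * real n) * (hermite_fun (n - 1) x * hermite_fun m x)
       + (sqrt (2 * real m) / 2 * (hermite_fun n x * hermite_fun (m - 1) x)
          - sqrt (2 * (real m + 1)) / 2 * (hermite_fun n x * hermite_fun (Suc m) x)))"
    unfolding low by (rule arg_cong[of _ _ complex_of_real]) (simp add: field_simps)
  finally show ?thesis .
qed

definition hermite_triple :: "nat \<Rightarrow> nat \<Rightarrow> nat \<Rightarrow> complex" where
  "hermite_triple n m k = hermite_coeff (\<lambda>x. hermite_cfun n x * hermite_cfun m x) k"

text \<open>The elementary interpolation \<open>(2k+1)\<^sup>\<theta> \<le> L\<^sup>\<theta> + L\<^sup>\<theta>\<^sup>-\<^sup>1 (2k+1)\<close> with \<open>L = max (2n+1) (2m+1)\<close>, the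
  larger of the frequencies of the factors, reduces the \<open>\<H>\<^sup>\<theta>\<close> norm to the \<open>L\<^sup>2\<close> and
  \<open>\<H>\<^sup>1\<close> norms; the lowering operator replaces the latter by neighbouring \<open>L\<^sup>2\<close> norms.\<close>

lemma hermite_product_norm:
  fixes n m :: nat
  assumes th: "0 \<le> \<theta>" "\<theta> \<le> 1"
  defines "L \<equiv> max (2 * real n + 1) (2 * real m + 1)"
  shows "(\<Sum>k<K. (2 * real k + 1) powr \<theta> * (norm (hermite_triple n m k))\<^sup>2)
    \<le> L powr \<theta> * (2 * hermite_overlap n m
        + 3 * (hermite_overlap (n - 1) m + hermite_overlap n (m - 1) + hermite_overlap n (Suc m)))"
proof -
  define \<phi> where "\<phi> x = hermite_cfun n x * hermite_cfun m x" for x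
  have sch: "schwartz \<phi>" unfolding \<phi>_def[abs_def] by (rule schwartz_hermite_mult)
  define A where "A = hermite_overlap n m"
  define R where "R = hermite_overlap (n - 1) m + hermite_overlap n (m - 1) + hermite_overlap n (Suc m)"
  have A: "A \<ge> 0" "R \<ge> 0" unfolding A_def R_def using hermite_overlap_nonneg by (auto intro!: add_nonneg_nonneg)
  have L: "L \<ge> 1" "2 * real n \<le> L" "2 * real m + 1 \<le> L" by (auto simp: L_def)
  have n0: "(\<integral>x. (norm (\<phi> x))\<^sup>2 \<partial>lborel) = A"
    by (simp add: A_def hermite_overlap_def \<phi>_def norm_mult power_mult_distrib)
  define H where "H a b x = (hermite_fun a x)\<^sup>2 * (hermite_fun b x)\<^sup>2" for a b x
  have H: "integrable lborel (H a b)" "integral\<^sup>L lborel (H a b) = hermite_overlap a b" for a b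
    unfolding H_def[abs_def] hermite_overlap_def using hermite_overlap_integrable by auto
  have n1: "(\<integral>x. (norm (vderiv \<phi> x + complex_of_real x * \<phi> x))\<^sup>2 \<partial>lborel) \<le> 3 * L * R"
  proof -
    have sq: "(a + (b - c))\<^sup>2 \<le> 3 * (a\<^sup>2 + b\<^sup>2 + c\<^sup>2)" for a b c :: real
      using sum_squares_ge_zero[of "a - b" "a + c"] zero_le_power2[of "b + c"] 
      by (simp add: power2_eq_square algebra_simps)
    have "(norm (vderiv \<phi> x + complex_of_real x * \<phi> x))\<^sup>2
        \<le> 3 * (L * H (n - 1) m x + L * H n (m - 1) x + L * H n (Suc m) x)" for x
    proof -
      have "(norm (vderiv \<phi> x + complex_of_real x * \<phi> x))\<^sup>2
          \<le> 3 * ((sqrt (2 * real n) * (hermite_fun (n - 1) x * hermite_fun m x))\<^sup>2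
              + (sqrt (2 * real m) / 2 * (hermite_fun n x * hermite_fun (m - 1) x))\<^sup>2
              + (sqrt (2 * (real m + 1)) / 2 * (hermite_fun n x * hermite_fun (Suc m) x))\<^sup>2)"
        unfolding \<phi>_def vderiv_hermite_mult norm_of_real power2_abs by (rule sq)
      also have "\<dots> = 3 * (2 * real n * H (n - 1) m x + real m / 2 * H n (m - 1) x
          + (real m + 1) / 2 * H n (Suc m) x)"
        by (simp add: power_mult_distrib power_divide H_def)
      also have "\<dots> \<le> 3 * (L * H (n - 1) m x + L * H n (m - 1) x + L * H n (Suc m) x)"
        using L by (intro mult_left_mono add_mono mult_right_mono) (auto simp: H_def)
      finally show ?thesis .
    qed
    then have "(\<integral>x. (norm (vderiv \<phi> x + complex_of_real x * \<phi> x))\<^sup>2 \<partial>lborel)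
        \<le> (\<integral>x. 3 * (L * H (n - 1) m x + L * H n (m - 1) x + L * H n (Suc m) x) \<partial>lborel)"
      using schwartz_L2(2)[OF sch] H(1)
      by (intro integral_mono Bochner_Integration.integrable_add integrable_mult_right) auto
    also have "\<dots> = 3 * L * R"
      using H by (simp add: R_def algebra_simps)
    finally show ?thesis .
  qed
  have pw: "(2 * real k + 1) powr \<theta> \<le> L powr \<theta> + L powr (\<theta> - 1) * (2 * real k + 1)" for k
  proof (cases "2 * real k + 1 \<le> L")
    case True
    then have "(2 * real k + 1) powr \<theta> \<le> L powr \<theta>" using th by (intro powr_mono2) auto
    then show ?thesis by (simp add: add_increasing2)
  next
    case False
    have "(2 * real k + 1) powr \<theta> = (2 * real k + 1) powr (\<theta> - 1) * (2 * real k + 1)"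
      by (simp add: powr_diff)
    also have "\<dots> \<le> L powr (\<theta> - 1) * (2 * real k + 1)"
      using False L th by (intro mult_right_mono powr_mono2') auto
    finally show ?thesis by (simp add: add_increasing)
  qed
  have "(\<Sum>k<K. (2 * real k + 1) powr \<theta> * (norm (hermite_triple n m k))\<^sup>2)
      \<le> (\<Sum>k<K. (L powr \<theta> + L powr (\<theta> - 1) * (2 * real k + 1)) * (norm (hermite_coeff \<phi> k))\<^sup>2)"
    unfolding hermite_triple_def \<phi>_def[abs_def, symmetric] using pw by (intro sum_mono mult_right_mono) auto
  also have "\<dots> = L powr \<theta> * (\<Sum>k<K. (norm (hermite_coeff \<phi> k))\<^sup>2)
      + L powr (\<theta> - 1) * (\<Sum>k<K. (2 * real k + 1) * (norm (hermite_coeff \<phi> k))\<^sup>2)"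
    unfolding sum_distrib_left sum.distrib[symmetric] by (intro sum.cong) (simp_all only: distrib_right mult.assoc)
  also have "\<dots> \<le> L powr \<theta> * A + L powr (\<theta> - 1) * (3 * L * R + A)"
  proof (intro add_mono mult_left_mono)
    show "(\<Sum>k<K. (norm (hermite_coeff \<phi> k))\<^sup>2) \<le> A"
      using hermite_bessel[OF _ schwartz_L2(1)[OF sch], of K] schwartz_measurable0(1)[OF sch] by (simp add: n0)
    show "(\<Sum>k<K. (2 * real k + 1) * (norm (hermite_coeff \<phi> k))\<^sup>2) \<le> 3 * L * R + A"
      using hermite_bessel_H1[OF sch, of K] n1 n0 by simp
  qed auto
  also have "L powr (\<theta> - 1) * (3 * L * R + A) = L powr \<theta> * (3 * R) + L powr (\<theta> - 1) * A"
    using L(1) by (simp add: powr_diff field_simps)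
  also have "L powr (\<theta> - 1) * A \<le> L powr \<theta> * A"
    using A L by (intro mult_right_mono powr_mono) auto
  finally show ?thesis by (simp add: A_def R_def algebra_simps)
qed

text \<open>Shifting an index by one changes a sum with slowly varying weights by at most a constant factor.
  The predecessor of \<open>0\<close> is \<open>0\<close>, so the first term is counted twice.\<close>

lemma sum_pred_le:
  fixes a f :: "nat \<Rightarrow> real"
  assumes "\<And>n. a n \<ge> 0" "\<And>n. a (Suc n) \<le> a n" "\<And>n. f n \<ge> 0"
  shows "(\<Sum>n<N. a n * f (n - 1)) \<le> 2 * (\<Sum>n<Suc N. a n * f n)"
proof -
  have "(\<Sum>n<N. a n * f (n - 1)) \<le> (\<Sum>n<Suc N. a n * f (n - 1))"
    using assms by simp
  also have "\<dots> = a 0 * f 0 + (\<Sum>n<N. a (Suc n) * f n)"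
    unfolding sum.lessThan_Suc_shift by simp
  also have "\<dots> \<le> (\<Sum>n<Suc N. a n * f n) + (\<Sum>n<Suc N. a n * f n)"
  proof (rule add_mono)
    show "a 0 * f 0 \<le> (\<Sum>n<Suc N. a n * f n)"
      unfolding sum.lessThan_Suc_shift using assms by (simp add: sum_nonneg)
    have "(\<Sum>n<N. a (Suc n) * f n) \<le> (\<Sum>n<N. a n * f n)"
      using assms by (intro sum_mono mult_right_mono) auto
    then show "(\<Sum>n<N. a (Suc n) * f n) \<le> (\<Sum>n<Suc N. a n * f n)"
      using assms by (simp add: add_increasing2)
  qed
  finally show ?thesis by simp
qed

lemma sum_succ_le:
  fixes a f :: "nat \<Rightarrow> real"
  assumes "\<And>n. a n \<ge> 0" "\<And>n. a n \<le> 3 * a (Suc n)" "\<And>n. f n \<ge> 0"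
  shows "(\<Sum>n<N. a n * f (Suc n)) \<le> 3 * (\<Sum>n<Suc N. a n * f n)"
proof -
  have "(\<Sum>n<N. a n * f (Suc n)) \<le> (\<Sum>n<N. 3 * a (Suc n) * f (Suc n))"
    using assms by (intro sum_mono mult_right_mono) auto
  also have "\<dots> = 3 * (\<Sum>n<N. a (Suc n) * f (Suc n))"
    by (simp add: sum_distrib_left mult.assoc)
  also have "\<dots> \<le> 3 * (\<Sum>n<Suc N. a n * f n)"
    unfolding sum.lessThan_Suc_shift using assms by simp
  finally show ?thesis .
qed

text \<open>Bounding the power \<open>L\<^bsup>\<theta>\<^esup>\<close> of the larger frequency by the sum of both powers leaves the weights
  \<open>(2n+1)\<^bsup>\<theta>-1\<^esup>\<close> and \<open>(2m+1)\<^bsup>-1\<^esup>\<close>, or the same with \<open>n\<close> and \<open>m\<close> exchanged. This is where \<open>\<theta> < 1/2\<close> enters: the overlaps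
  are summable as long as \<open>1 - \<theta> > 1/2\<close>. A negative \<open>\<theta>\<close> is replaced by \<open>0\<close>.\<close>

theorem hermite_product_norms_summable:
  assumes "\<theta> < 1/2"
  shows "\<exists>B\<ge>0. \<forall>N K. (\<Sum>n<N. \<Sum>m<N. (\<Sum>k<K. (2 * real k + 1) powr \<theta> * (norm (hermite_triple n m k))\<^sup>2)
    / ((2 * real n + 1) * (2 * real m + 1))) \<le> B"
proof -
  define t where "t = max \<theta> 0"
  have t: "0 \<le> t" "t \<le> 1" "t < 1/2" "\<theta> \<le> t" using assms by (auto simp: t_def)
  define p where "p n = (2 * real n + 1) powr (- 1)" for n
  define q where "q n = (2 * real n + 1) powr (- (1 - t))" for n
  obtain B where B: "\<And>N. (\<Sum>n<N. \<Sum>m<N. q n * p m * hermite_overlap n m) \<le> B"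
    using hermite_overlap_sum_bounded[of "1 - t"] t unfolding p_def q_def by auto
  have B': "(\<Sum>n<N. \<Sum>m<N. p n * q m * hermite_overlap n m) \<le> B" for N
    using B[of N] by (subst sum.swap) (simp add: hermite_overlap_commute mult.commute)
  have dec: "(2 * real (Suc n) + 1) powr (- s) \<le> (2 * real n + 1) powr (- s)" if "0 \<le> s" for n s
    using that by (intro powr_mono2') auto
  have inc: "(2 * real n + 1) powr (- s) \<le> 3 * (2 * real (Suc n) + 1) powr (- s)" if "0 \<le> s" "s \<le> 1" for n s
  proof -
    have "(2 * real (Suc n) + 1) powr s \<le> (3 * (2 * real n + 1)) powr s"
      using that by (intro powr_mono2) auto
    also have "\<dots> = 3 powr s * (2 * real n + 1) powr s"
      by (rule powr_mult)
    also have "\<dots> \<le> 3 * (2 * real n + 1) powr s"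
      using that powr_mono[of s 1 3] by (intro mult_right_mono) auto
    finally show ?thesis by (simp add: powr_minus field_simps)
  qed
  have p: "p n \<ge> 0" "p (Suc n) \<le> p n" "p n \<le> 3 * p (Suc n)" for n
    unfolding p_def using dec[of 1 n] inc[of 1 n] by auto
  have q: "q n \<ge> 0" "q (Suc n) \<le> q n" "q n \<le> 3 * q (Suc n)" for n
    unfolding q_def using dec[of "1 - t" n] inc[of "1 - t" n] t by auto
  have shifts: "(\<Sum>n<N. \<Sum>m<N. a n * b m * (2 * hermite_overlap n m
        + 3 * (hermite_overlap (n - 1) m + hermite_overlap n (m - 1) + hermite_overlap n (Suc m)))) \<le> 23 * B"
    if a: "\<And>n. a n \<ge> 0" "\<And>n. a (Suc n) \<le> a n" and b: "\<And>n. b n \<ge> 0" "\<And>n. b (Suc n) \<le> b n" "\<And>n. b n \<le> 3 * b (Suc n)"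
    and ab: "\<And>N. (\<Sum>n<N. \<Sum>m<N. a n * b m * hermite_overlap n m) \<le> B" for a b :: "nat \<Rightarrow> real" and N
  proof -
    define T where "T = (\<Sum>n<Suc N. \<Sum>m<Suc N. a n * b m * hermite_overlap n m)"
    have T: "T \<le> B" unfolding T_def by (rule ab)
    have nn: "a n * b m * hermite_overlap i j \<ge> 0" for n m i j
      using a b hermite_overlap_nonneg by simp
    have 1: "(\<Sum>n<N. \<Sum>m<N. a n * b m * hermite_overlap n m) \<le> T"
      unfolding T_def by (intro order_trans[OF sum_mono[OF sum_mono2] sum_mono2]) (auto intro!: sum_nonneg add_nonneg_nonneg nn)
    have 2: "(\<Sum>n<N. \<Sum>m<N. a n * b m * hermite_overlap (n - 1) m) \<le> 2 * T"
    proof -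
      have "(\<Sum>n<N. \<Sum>m<N. a n * b m * hermite_overlap (n - 1) m)
          = (\<Sum>m<N. b m * (\<Sum>n<N. a n * hermite_overlap (n - 1) m))"
        by (subst sum.swap) (simp add: sum_distrib_left mult_ac)
      also have "\<dots> \<le> (\<Sum>m<N. b m * (2 * (\<Sum>n<Suc N. a n * hermite_overlap n m)))"
        using a b hermite_overlap_nonneg by (intro sum_mono mult_left_mono sum_pred_le) auto
      also have "\<dots> \<le> (\<Sum>m<Suc N. b m * (2 * (\<Sum>n<Suc N. a n * hermite_overlap n m)))"
        using a b hermite_overlap_nonneg by (intro sum_mono2 mult_nonneg_nonneg sum_nonneg) auto
      also have "\<dots> = 2 * T"
        unfolding T_def by (subst sum.swap) (simp add: sum_distrib_left mult_ac del: sum.lessThan_Suc)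
      finally show ?thesis .
    qed
    have 3: "(\<Sum>n<N. \<Sum>m<N. a n * b m * hermite_overlap n (m - 1)) \<le> 2 * T"
    proof -
      have "(\<Sum>n<N. \<Sum>m<N. a n * b m * hermite_overlap n (m - 1))
          = (\<Sum>n<N. a n * (\<Sum>m<N. b m * hermite_overlap n (m - 1)))"
        by (simp add: sum_distrib_left mult_ac)
      also have "\<dots> \<le> (\<Sum>n<N. a n * (2 * (\<Sum>m<Suc N. b m * hermite_overlap n m)))"
        using a b hermite_overlap_nonneg
        by (intro sum_mono mult_left_mono sum_pred_le[where f = "hermite_overlap _"]) auto
      also have "\<dots> \<le> (\<Sum>n<Suc N. a n * (2 * (\<Sum>m<Suc N. b m * hermite_overlap n m)))"
        using a b hermite_overlap_nonneg by (intro sum_mono2 mult_nonneg_nonneg sum_nonneg) auto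
      also have "\<dots> = 2 * T"
        unfolding T_def by (simp add: sum_distrib_left mult_ac del: sum.lessThan_Suc)
      finally show ?thesis .
    qed
    have 4: "(\<Sum>n<N. \<Sum>m<N. a n * b m * hermite_overlap n (Suc m)) \<le> 3 * T"
    proof -
      have "(\<Sum>n<N. \<Sum>m<N. a n * b m * hermite_overlap n (Suc m))
          = (\<Sum>n<N. a n * (\<Sum>m<N. b m * hermite_overlap n (Suc m)))"
        by (simp add: sum_distrib_left mult_ac)
      also have "\<dots> \<le> (\<Sum>n<N. a n * (3 * (\<Sum>m<Suc N. b m * hermite_overlap n m)))"
        using a b hermite_overlap_nonneg
        by (intro sum_mono mult_left_mono sum_succ_le[where f = "hermite_overlap _"]) auto
      also have "\<dots> \<le> (\<Sum>n<Suc N. a n * (3 * (\<Sum>m<Suc N. b m * hermite_overlap n m)))"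
        using a b hermite_overlap_nonneg by (intro sum_mono2 mult_nonneg_nonneg sum_nonneg) auto
      also have "\<dots> = 3 * T"
        unfolding T_def by (simp add: sum_distrib_left mult_ac del: sum.lessThan_Suc)
      finally show ?thesis .
    qed
    have "(\<Sum>n<N. \<Sum>m<N. a n * b m * (2 * hermite_overlap n m
        + 3 * (hermite_overlap (n - 1) m + hermite_overlap n (m - 1) + hermite_overlap n (Suc m))))
      = 2 * (\<Sum>n<N. \<Sum>m<N. a n * b m * hermite_overlap n m)
        + 3 * ((\<Sum>n<N. \<Sum>m<N. a n * b m * hermite_overlap (n - 1) m)
          + (\<Sum>n<N. \<Sum>m<N. a n * b m * hermite_overlap n (m - 1))
          + (\<Sum>n<N. \<Sum>m<N. a n * b m * hermite_overlap n (Suc m)))"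
      by (simp add: algebra_simps sum.distrib sum_distrib_left)
    \<comment> \<open>\<open>23 = 2 + 3 (2 + 2 + 3)\<close>\<close>
    also have "\<dots> \<le> 23 * T" using 1 2 3 4 by simp
    finally show ?thesis using T by simp
  qed
  have main: "(\<Sum>n<N. \<Sum>m<N. (\<Sum>k<K. (2 * real k + 1) powr \<theta> * (norm (hermite_triple n m k))\<^sup>2)
    / ((2 * real n + 1) * (2 * real m + 1))) \<le> 23 * B + 23 * B" for N K
  proof -
    define R where "R n m = 2 * hermite_overlap n m
        + 3 * (hermite_overlap (n - 1) m + hermite_overlap n (m - 1) + hermite_overlap n (Suc m))" for n m
    have R: "R n m \<ge> 0" for n m
      unfolding R_def using hermite_overlap_nonneg by (intro add_nonneg_nonneg mult_nonneg_nonneg) auto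
    have "(\<Sum>k<K. (2 * real k + 1) powr \<theta> * (norm (hermite_triple n m k))\<^sup>2) / ((2 * real n + 1) * (2 * real m + 1))
        \<le> q n * p m * R n m + p n * q m * R n m" for n m
    proof -
      define L where "L = max (2 * real n + 1) (2 * real m + 1)"
      have "(\<Sum>k<K. (2 * real k + 1) powr \<theta> * (norm (hermite_triple n m k))\<^sup>2)
          \<le> (\<Sum>k<K. (2 * real k + 1) powr t * (norm (hermite_triple n m k))\<^sup>2)"
        using t by (intro sum_mono mult_right_mono powr_mono) auto
      also have "\<dots> \<le> L powr t * R n m"
        unfolding L_def R_def using t by (intro hermite_product_norm) auto
      finally have le: "(\<Sum>k<K. (2 * real k + 1) powr \<theta> * (norm (hermite_triple n m k))\<^sup>2) * (p n * p m)
          \<le> (L powr t * R n m) * (p n * p m)"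
        using p by (intro mult_right_mono) auto
      have pq: "(2 * real n + 1) powr t * p n = q n" for n
        unfolding p_def q_def powr_add[symmetric] by simp
      have "L powr t \<le> (2 * real n + 1) powr t + (2 * real m + 1) powr t"
        unfolding L_def max_def by auto
      then have "L powr t * (p n * p m * R n m)
          \<le> ((2 * real n + 1) powr t + (2 * real m + 1) powr t) * (p n * p m * R n m)"
        using p R by (intro mult_right_mono) auto
      also have "\<dots> = ((2 * real n + 1) powr t * p n) * p m * R n m + p n * ((2 * real m + 1) powr t * p m) * R n m"
        by (simp only: distrib_right distrib_left mult_ac)
      finally have "(L powr t * R n m) * (p n * p m) \<le> q n * p m * R n m + p n * q m * R n m"
        unfolding pq by (simp only: mult_ac)
      with le have "(\<Sum>k<K. (2 * real k + 1) powr \<theta> * (norm (hermite_triple n m k))\<^sup>2) * (p n * p m)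
          \<le> q n * p m * R n m + p n * q m * R n m" by (rule order_trans)
      moreover have "p n = 1 / (2 * real n + 1)" for n
        by (simp add: p_def powr_minus divide_inverse)
      ultimately show ?thesis by simp
    qed
    then have "(\<Sum>n<N. \<Sum>m<N. (\<Sum>k<K. (2 * real k + 1) powr \<theta> * (norm (hermite_triple n m k))\<^sup>2)
        / ((2 * real n + 1) * (2 * real m + 1)))
      \<le> (\<Sum>n<N. \<Sum>m<N. q n * p m * R n m + p n * q m * R n m)"
      by (intro sum_mono) auto
    also have "\<dots> = (\<Sum>n<N. \<Sum>m<N. q n * p m * R n m) + (\<Sum>n<N. \<Sum>m<N. p n * q m * R n m)"
      by (simp only: sum.distrib)
    also have "\<dots> \<le> 23 * B + 23 * B"
      unfolding R_def by (intro add_mono shifts p q B B')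
    finally show ?thesis .
  qed
  have "0 \<le> B" using B[of 0] by simp
  then show ?thesis using main by (intro exI[of _ "23 * B + 23 * B"]) auto
qed

section \<open>Functions as tempered distributions\<close>

lemma schwartz_lincomb:
  assumes "schwartz \<phi>" "schwartz \<psi>"
  shows "schwartz (\<lambda>x. a * \<phi> x + b * \<psi> x)"
proof -
  have der: "((\<lambda>x. a * (vderiv ^^ k) \<phi> x + b * (vderiv ^^ k) \<psi> x) has_vector_derivative
      a * (vderiv ^^ Suc k) \<phi> x + b * (vderiv ^^ Suc k) \<psi> x) (at x)" for k x
    by (intro has_vector_derivative_add has_vector_derivative_mult_right schwartz_has_derivative assms)
  have k: "(vderiv ^^ k) (\<lambda>x. a * \<phi> x + b * \<psi> x) = (\<lambda>x. a * (vderiv ^^ k) \<phi> x + b * (vderiv ^^ k) \<psi> x)" for k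
  proof (induction k)
    case (Suc k)
    have "(vderiv ^^ Suc k) (\<lambda>x. a * \<phi> x + b * \<psi> x) x
        = vector_derivative (\<lambda>x. a * (vderiv ^^ k) \<phi> x + b * (vderiv ^^ k) \<psi> x) (at x)" for x
      by (simp only: funpow.simps(2) comp_apply Suc
          vderiv_def[of "\<lambda>x. a * (vderiv ^^ k) \<phi> x + b * (vderiv ^^ k) \<psi> x" x])
    then show ?case
      unfolding vector_derivative_at[OF der] by blast
  qed simp
  show ?thesis
    unfolding schwartz_def k
  proof safe
    fix k x
    show "(\<lambda>x. a * (vderiv ^^ k) \<phi> x + b * (vderiv ^^ k) \<psi> x) differentiable at x"
      using der by (rule differentiableI_vector)
  next
    fix j k
    show "bounded (range (\<lambda>x. x ^ j *\<^sub>R (a * (vderiv ^^ k) \<phi> x + b * (vderiv ^^ k) \<psi> x)))"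
    proof (rule boundedI)
      fix y assume "y \<in> range (\<lambda>x. x ^ j *\<^sub>R (a * (vderiv ^^ k) \<phi> x + b * (vderiv ^^ k) \<psi> x))"
      then obtain x where y: "y = x ^ j *\<^sub>R (a * (vderiv ^^ k) \<phi> x + b * (vderiv ^^ k) \<psi> x)" by blast
      have "y = a * (x ^ j *\<^sub>R (vderiv ^^ k) \<phi> x) + b * (x ^ j *\<^sub>R (vderiv ^^ k) \<psi> x)"
        by (simp add: y scaleR_add_right)
      then have "norm y \<le> norm (a * (x ^ j *\<^sub>R (vderiv ^^ k) \<phi> x)) + norm (b * (x ^ j *\<^sub>R (vderiv ^^ k) \<psi> x))"
        by (simp only: norm_triangle_ineq)
      also have "\<dots> = norm a * (\<bar>x\<bar> ^ j * norm ((vderiv ^^ k) \<phi> x)) + norm b * (\<bar>x\<bar> ^ j * norm ((vderiv ^^ k) \<psi> x))"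
        by (simp add: norm_mult power_abs)
      also have "\<dots> \<le> norm a * schwartz_seminorm j k \<phi> + norm b * schwartz_seminorm j k \<psi>"
        by (intro add_mono mult_left_mono schwartz_seminorm_bound assms) auto
      finally show "norm y \<le> norm a * schwartz_seminorm j k \<phi> + norm b * schwartz_seminorm j k \<psi>" .
    qed
  qed
qed

lemma schwartz_weight_bound:
  "schwartz \<phi> \<Longrightarrow> norm (\<phi> x) \<le> (schwartz_seminorm 0 0 \<phi> + schwartz_seminorm 2 0 \<phi>) * japanese_weight x"
  using schwartz_decay_bound[of \<phi> x 0 0] by (simp only: add_0 power_0 mult_1 funpow_0)

lemma integrable_mult_schwartz:
  assumes [measurable]: "f \<in> borel_measurable lborel"
    and f: "integrable lborel (\<lambda>x. norm (f x) * japanese_weight x)" and \<phi>: "schwartz \<phi>"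
  shows "integrable lborel (\<lambda>x. f x * \<phi> x)"
    and "norm (\<integral>x. f x * \<phi> x \<partial>lborel) \<le> (\<integral>x. norm (f x) * japanese_weight x \<partial>lborel)
      * (schwartz_seminorm 0 0 \<phi> + schwartz_seminorm 2 0 \<phi>)"
proof -
  define S where "S = schwartz_seminorm 0 0 \<phi> + schwartz_seminorm 2 0 \<phi>"
  have [measurable]: "\<phi> \<in> borel_measurable borel"
    using schwartz_measurable0[OF \<phi>] by auto
  have le: "norm (f x * \<phi> x) \<le> S * (norm (f x) * japanese_weight x)" for x
    using mult_left_mono[OF schwartz_weight_bound[OF \<phi>, of x], of "norm (f x)"]
    unfolding norm_mult S_def by (simp only: mult_ac norm_ge_zero simp_thms)
  have i: "integrable lborel (\<lambda>x. S * (norm (f x) * japanese_weight x))"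
    by (intro integrable_mult_right f)
  show int: "integrable lborel (\<lambda>x. f x * \<phi> x)"
  proof (rule Bochner_Integration.integrable_bound[OF i])
    show "AE x in lborel. norm (f x * \<phi> x) \<le> norm (S * (norm (f x) * japanese_weight x))"
      using order_trans[OF le abs_ge_self] by (intro AE_I2) simp
  qed measurable
  have "norm (\<integral>x. f x * \<phi> x \<partial>lborel) \<le> (\<integral>x. norm (f x * \<phi> x) \<partial>lborel)"
    by (rule integral_norm_bound)
  also have "\<dots> \<le> (\<integral>x. S * (norm (f x) * japanese_weight x) \<partial>lborel)"
    using le int i by (intro integral_mono integrable_norm)
  finally show "norm (\<integral>x. f x * \<phi> x \<partial>lborel) \<le> (\<integral>x. norm (f x) * japanese_weight x \<partial>lborel)
      * (schwartz_seminorm 0 0 \<phi> + schwartz_seminorm 2 0 \<phi>)"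
    by (simp add: S_def mult.commute)
qed

text \<open>By \<open>|\<phi>| \<le> C (1 + x\<^sup>2)\<^sup>-\<^sup>1\<close>, with \<open>C\<close> a sum of two Schwartz seminorms, pairing with such a function
  is continuous.\<close>

lemma represents_regular:
  assumes f: "f \<in> borel_measurable lborel" "integrable lborel (\<lambda>x. norm (f x) * japanese_weight x)"
  shows "represents f (regular f)"
  unfolding represents_def tempered_def
proof (intro conjI allI impI)
  fix \<phi> assume "schwartz \<phi>"
  then show "integrable lborel (\<lambda>x. f x * \<phi> x)" by (rule integrable_mult_schwartz(1)[OF f])
next
  fix \<phi> \<psi> a b assume s: "schwartz \<phi>" "schwartz \<psi>"
  have "regular f (\<lambda>x. a * \<phi> x + b * \<psi> x) = (\<integral>x. a * (f x * \<phi> x) + b * (f x * \<psi> x) \<partial>lborel)"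
    using schwartz_lincomb[OF s] by (simp add: regular_def algebra_simps)
  then show "regular f (\<lambda>x. a * \<phi> x + b * \<psi> x) = a * regular f \<phi> + b * regular f \<psi>"
    using s integrable_mult_schwartz(1)[OF f] by (simp add: regular_def)
next
  show "\<exists>C K. \<forall>\<phi>. schwartz \<phi> \<longrightarrow>
      norm (regular f \<phi>) \<le> C * (\<Sum>j\<le>K. \<Sum>k\<le>K. schwartz_seminorm j k \<phi>)"
  proof (intro exI allI impI)
    fix \<phi> assume s: "schwartz \<phi>"
    have row: "schwartz_seminorm j 0 \<phi> \<le> (\<Sum>k\<le>2. schwartz_seminorm j k \<phi>)" for j
      by (rule member_le_sum) (auto intro: schwartz_seminorm_nonneg[OF s])
    have "schwartz_seminorm 0 0 \<phi> + schwartz_seminorm 2 0 \<phi> = (\<Sum>j\<in>{0,2}. schwartz_seminorm j 0 \<phi>)"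
      by simp
    also have "\<dots> \<le> (\<Sum>j\<in>{0,2}. \<Sum>k\<le>2. schwartz_seminorm j k \<phi>)"
      by (intro sum_mono row)
    also have "\<dots> \<le> (\<Sum>j\<le>2. \<Sum>k\<le>2. schwartz_seminorm j k \<phi>)"
      by (rule sum_mono2) (auto intro!: sum_nonneg schwartz_seminorm_nonneg[OF s])
    finally have *: "schwartz_seminorm 0 0 \<phi> + schwartz_seminorm 2 0 \<phi>
        \<le> (\<Sum>j\<le>2. \<Sum>k\<le>2. schwartz_seminorm j k \<phi>)" .
    have "0 \<le> (\<integral>x. norm (f x) * japanese_weight x \<partial>lborel)"
      by (intro Bochner_Integration.integral_nonneg) simp
    from order_trans[OF integrable_mult_schwartz(2)[OF f s] mult_left_mono[OF * this]]
    have "norm (\<integral>x. f x * \<phi> x \<partial>lborel) \<le> (\<integral>x. norm (f x) * japanese_weight x \<partial>lborel)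
        * (\<Sum>j\<le>2. \<Sum>k\<le>2. schwartz_seminorm j k \<phi>)" .
    with s show "norm (regular f \<phi>) \<le> (\<integral>x. norm (f x) * japanese_weight x \<partial>lborel)
        * (\<Sum>j\<le>2. \<Sum>k\<le>2. schwartz_seminorm j k \<phi>)"
      by (simp only: regular_def if_True)
  qed
qed (use f in \<open>auto simp: regular_def\<close>)

lemma integrable_weight_of_square:
  fixes f :: "real \<Rightarrow> complex"
  assumes [measurable]: "f \<in> borel_measurable lborel"
    and f: "integrable lborel (\<lambda>x. (norm (f x))\<^sup>2 * japanese_weight x)"
  shows "integrable lborel (\<lambda>x. norm (f x) * japanese_weight x)"
proof (rule Bochner_Integration.integrable_bound[OF Bochner_Integration.integrable_add[OF f integrable_japanese_weight]])
  have "norm (f x) * japanese_weight x \<le> (norm (f x))\<^sup>2 * japanese_weight x + japanese_weight x" for x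
  proof -
    have "norm (f x) \<le> (norm (f x))\<^sup>2 + 1"
      using sum_squares_bound[of "norm (f x)" 1] norm_ge_zero[of "f x"]
      unfolding power_one mult_1_right by linarith
    then have "norm (f x) * japanese_weight x \<le> ((norm (f x))\<^sup>2 + 1) * japanese_weight x"
      by (intro mult_right_mono) auto
    then show ?thesis by (simp add: distrib_right)
  qed
  then show "AE x in lborel. norm (norm (f x) * japanese_weight x)
      \<le> norm ((norm (f x))\<^sup>2 * japanese_weight x + japanese_weight x)"
    by (intro AE_I2) (simp add: abs_mult)
qed measurable

section \<open>Lacunary convergence in weighted mean square\<close>

text \<open>With \<open>\<Sum> 2\<^sup>j \<parallel>D\<^sub>j\<parallel>\<^sup>2 < \<infinity>\<close> the Cauchy-Schwarz inequality against \<open>2\<^sup>-\<^sup>j\<close> gives absolute convergence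
  almost everywhere and one integrable majorant for all squared partial sums.\<close>

lemma lacunary_series_majorant:
  fixes D :: "nat \<Rightarrow> real \<Rightarrow> complex"
  assumes [measurable]: "\<And>j. D j \<in> borel_measurable lborel"
    and fin: "(\<Sum>j. \<integral>\<^sup>+x. ennreal (2 ^ j * (norm (D j x))\<^sup>2) \<partial>lborel) < \<infinity>"
  shows "\<exists>f F. f \<in> borel_measurable lborel \<and> integrable lborel F
    \<and> (AE x in lborel. (\<lambda>J. \<Sum>j<J. D j x) \<longlonglongrightarrow> f x)
    \<and> (AE x in lborel. \<forall>J. (norm (\<Sum>j<J. D j x))\<^sup>2 \<le> F x)"
proof -
  define a where "a j x = 2 ^ j * (norm (D j x))\<^sup>2" for j x
  have a0: "a j x \<ge> 0" for j x by (simp add: a_def)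
  have [measurable]: "a j \<in> borel_measurable lborel" for j unfolding a_def by measurable
  define G where "G x = (\<Sum>j. ennreal (a j x))" for x
  have [measurable]: "G \<in> borel_measurable lborel" unfolding G_def by measurable
  have intG: "(\<integral>\<^sup>+x. G x \<partial>lborel) < \<infinity>"
    unfolding G_def using fin by (subst nn_integral_suminf) (auto simp: a_def)
  then have aeG: "AE x in lborel. G x \<noteq> \<infinity>"
    by (intro nn_integral_PInf_AE) auto
  define F where "F x = 2 * enn2real (G x)" for x
  have "integrable lborel F"
    unfolding integrable_iff_bounded
  proof
    have "(\<integral>\<^sup>+x. ennreal (norm (F x)) \<partial>lborel) \<le> (\<integral>\<^sup>+x. 2 * G x \<partial>lborel)"
    proof (rule nn_integral_mono)
      fix x show "ennreal (norm (F x)) \<le> 2 * G x"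
        by (cases "G x") (auto simp: F_def ennreal_mult ennreal_mult_top)
    qed
    also have "\<dots> = 2 * (\<integral>\<^sup>+x. G x \<partial>lborel)" by (rule nn_integral_cmult) measurable
    also have "\<dots> < \<infinity>" using intG by (simp add: ennreal_mult_less_top)
    finally show "(\<integral>\<^sup>+x. ennreal (norm (F x)) \<partial>lborel) < \<infinity>" .
    show "F \<in> borel_measurable lborel" unfolding F_def[abs_def] by measurable
  qed
  moreover define f where "f x = (\<Sum>j. D j x)" for x
  have "f \<in> borel_measurable lborel" unfolding f_def by measurable
  moreover have "(\<lambda>J. \<Sum>j<J. D j x) \<longlonglongrightarrow> f x \<and> (\<forall>J. (norm (\<Sum>j<J. D j x))\<^sup>2 \<le> F x)"
    if "G x \<noteq> \<infinity>" for x
  proof -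
    have sa: "summable (\<lambda>j. a j x)"
      using that a0 unfolding G_def by (intro summable_suminf_not_top) auto
    have Gx: "enn2real (G x) = (\<Sum>j. a j x)"
      unfolding G_def using suminf_nonneg[OF sa a0] sa a0 by (simp add: suminf_ennreal2)
    have geo: "summable (\<lambda>j. (1/2::real) ^ j)" by (rule summable_geometric) auto
    have "norm (D j x) \<le> (1/2) ^ j + a j x" for j
    proof -
      define n p :: real where "n = norm (D j x)" and "p = 2 ^ j"
      have np: "n \<ge> 0" "p > 0" by (auto simp: n_def p_def)
      have "2 * 1 * (n * p) \<le> 1\<^sup>2 + (n * p)\<^sup>2" by (rule sum_squares_bound)
      moreover have "n * p \<ge> 0" using np by simp
      ultimately have "n * p \<le> 1 + (n * p)\<^sup>2" unfolding power_one mult_1_right by linarith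
      then have "n \<le> (1 + (n * p)\<^sup>2) / p" using np by (simp add: pos_le_divide_eq)
      also have "\<dots> = 1 / p + p * n\<^sup>2" using np by (simp add: add_divide_distrib power2_eq_square)
      finally show ?thesis by (simp add: a_def n_def p_def power_divide)
    qed
    then have "summable (\<lambda>j. D j x)"
      by (intro summable_comparison_test'[OF summable_add[OF geo sa]]) auto
    then have lim: "(\<lambda>J. \<Sum>j<J. D j x) \<longlonglongrightarrow> f x"
      unfolding f_def by (rule summable_LIMSEQ)
    have "(norm (\<Sum>j<J. D j x))\<^sup>2 \<le> F x" for J
    proof -
      have "(norm (\<Sum>j<J. D j x))\<^sup>2 \<le> (\<Sum>j<J. norm (D j x))\<^sup>2"
        by (intro power_mono norm_sum) auto
      also have "(\<Sum>j<J. norm (D j x)) = (\<Sum>j<J. sqrt ((1/2) ^ j) * sqrt (a j x))"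
        by (intro sum.cong) (auto simp: a_def power_divide real_sqrt_divide real_sqrt_mult)
      also have "(\<Sum>j<J. sqrt ((1/2) ^ j) * sqrt (a j x))\<^sup>2
          \<le> (\<Sum>j<J. (sqrt ((1/2) ^ j))\<^sup>2) * (\<Sum>j<J. (sqrt (a j x))\<^sup>2)"
        by (rule Cauchy_Schwarz_ineq_sum)
      also have "\<dots> = (\<Sum>j<J. (1/2) ^ j) * (\<Sum>j<J. a j x)"
        using a0 by (simp del: sum_gp_strict)
      also have "\<dots> \<le> 2 * (\<Sum>j. a j x)"
        using sum_le_suminf[OF geo, of "{..<J}"] suminf_geometric[of "1/2::real"] sum_le_suminf[OF sa, of "{..<J}"] a0
        by (intro mult_mono sum_nonneg) auto
      finally show ?thesis by (simp add: F_def Gx)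
    qed
    with lim show ?thesis by blast
  qed
  then have "AE x in lborel. (\<lambda>J. \<Sum>j<J. D j x) \<longlonglongrightarrow> f x"
    "AE x in lborel. \<forall>J. (norm (\<Sum>j<J. D j x))\<^sup>2 \<le> F x"
    using aeG by auto
  ultimately show ?thesis by blast
qed

text \<open>Cutting where the tails of the series fall below \<open>4\<^sup>-\<^sup>j\<close> leaves room for the factor \<open>2\<^sup>j\<close>.\<close>

lemma lacunary_blocks:
  fixes a :: "nat \<Rightarrow> real"
  assumes a: "\<And>n. a n \<ge> 0" "summable a"
  shows "\<exists>N. strict_mono N \<and> N 0 = 0 \<and> summable (\<lambda>j. 2 ^ j * (\<Sum>n\<in>{N j..<N (Suc j)}. a n))"
proof -
  have "\<exists>K. \<forall>m\<ge>K. \<forall>n. (\<Sum>i\<in>{m..<n}. a i) < (1/4) ^ j" for j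
  proof -
    have "\<exists>K. \<forall>m\<ge>K. \<forall>n. norm (sum a {m..<n}) < (1/4) ^ j"
      using a(2)[unfolded summable_Cauchy, rule_format, of "(1/4) ^ j"] by simp
    then show ?thesis using abs_ge_self order_le_less_trans by (metis real_norm_def)
  qed
  then obtain K where K: "\<And>j m n. m \<ge> K j \<Longrightarrow> (\<Sum>i\<in>{m..<n}. a i) < (1/4) ^ j" by metis
  define N where "N = rec_nat 0 (\<lambda>j r. max (Suc r) (K (Suc j)))"
  have N: "N 0 = 0" "N (Suc j) = max (Suc (N j)) (K (Suc j))" for j by (simp_all add: N_def)
  have "strict_mono N" unfolding strict_mono_Suc_iff N(2) by (simp add: less_max_iff_disj)
  moreover have "summable (\<lambda>j. 2 ^ j * (\<Sum>n\<in>{N j..<N (Suc j)}. a n))"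
  proof (rule summable_comparison_test_ev)
    show "summable (\<lambda>j. (1/2::real) ^ j)" by (rule summable_geometric) auto
    have "norm (2 ^ j * (\<Sum>n\<in>{N j..<N (Suc j)}. a n)) \<le> (1/2) ^ j" if j: "j \<ge> 1" for j
    proof -
      obtain i where i: "j = Suc i" using j by (cases j) auto
      have "N j \<ge> K j" unfolding i N by simp
      then have "(\<Sum>n\<in>{N j..<N (Suc j)}. a n) \<le> (1/4) ^ j" using K less_imp_le by blast
      then have "2 ^ j * (\<Sum>n\<in>{N j..<N (Suc j)}. a n) \<le> 2 ^ j * (1/4) ^ j" by simp
      also have "\<dots> = (1/2) ^ j" by (simp flip: power_mult_distrib)
      finally show ?thesis using a by (simp add: abs_mult abs_of_nonneg sum_nonneg)
    qed
    then show "\<forall>\<^sub>F j in sequentially. norm (2 ^ j * (\<Sum>n\<in>{N j..<N (Suc j)}. a n)) \<le> (1/2) ^ j"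
      by (auto simp: eventually_sequentially)
  qed
  ultimately show ?thesis using N(1) by blast
qed

definition hermite_partial :: "(nat \<Rightarrow> complex) \<Rightarrow> nat set \<Rightarrow> real \<Rightarrow> complex" where
  "hermite_partial b A x = (\<Sum>n\<in>A. b n * hermite_cfun n x)"

lemma hermite_partial_measurable [measurable]: "hermite_partial b A \<in> borel_measurable borel"
  unfolding hermite_partial_def[abs_def] by measurable

lemma hermite_partial_blocks:
  assumes "strict_mono N" "N 0 = 0"
  shows "(\<Sum>j<J. hermite_partial b {N j..<N (Suc j)} x) = hermite_partial b {..<N J} x"
proof (induction J)
  case 0
  then show ?case using assms by (simp add: hermite_partial_def)
next
  case (Suc J)
  have "N J \<le> N (Suc J)" using assms by (simp add: strict_mono_leD)
  then have *: "{..<N (Suc J)} = {..<N J} \<union> {N J..<N (Suc J)}" by auto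
  have "hermite_partial b {..<N (Suc J)} x = hermite_partial b {..<N J} x + hermite_partial b {N J..<N (Suc J)} x"
    unfolding hermite_partial_def * by (rule sum.union_disjoint) auto
  then show ?case by (simp only: sum.lessThan_Suc Suc)
qed

lemma hermite_coeff_partial:
  assumes "schwartz \<phi>"
  shows "(\<integral>x. hermite_partial b {..<K} x * \<phi> x \<partial>lborel) = (\<Sum>k<K. b k * hermite_coeff \<phi> k)"
proof -
  have i: "integrable lborel (\<lambda>x. \<phi> x * hermite_cfun k x)" for k
    using integrable_hermite_mult[OF _ schwartz_L2(1)[OF assms]] schwartz_measurable0(1)[OF assms] by simp
  have "(\<integral>x. hermite_partial b {..<K} x * \<phi> x \<partial>lborel) = (\<integral>x. (\<Sum>k<K. b k * (\<phi> x * hermite_cfun k x)) \<partial>lborel)"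
    by (simp add: hermite_partial_def sum_distrib_left mult_ac)
  also have "\<dots> = (\<Sum>k<K. b k * hermite_coeff \<phi> k)"
    unfolding hermite_coeff_def using i by (simp add: Bochner_Integration.integral_sum)
  finally show ?thesis .
qed

text \<open>The weight \<open>(1 + x\<^sup>2)\<^sup>-\<^sup>1\<close> serves for the random series itself, the weight \<open>1\<close> for the
  Riesz-Fischer theorem. Since a Schwartz function is dominated by either weight, the majorant \<open>F\<close> of \<open>|S\<^sub>J|\<^sup>2 w\<close>
  gives dominated convergence both for the partial sums and for their squares.\<close>

lemma hermite_series_converges:
  fixes w :: "real \<Rightarrow> real"
  assumes [measurable]: "w \<in> borel_measurable borel"
    and w: "\<And>x. japanese_weight x \<le> w x"
    and N: "strict_mono N" "N 0 = 0"
    and fin: "(\<Sum>j. \<integral>\<^sup>+x. ennreal (2 ^ j * ((norm (hermite_partial b {N j..<N (Suc j)} x))\<^sup>2 * w x)) \<partial>lborel) < \<infinity>"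
  shows "\<exists>f. f \<in> borel_measurable lborel \<and> integrable lborel (\<lambda>x. (norm (f x))\<^sup>2 * w x)
    \<and> (\<forall>\<phi>. schwartz \<phi> \<longrightarrow>
        (\<lambda>J. \<integral>x. hermite_partial b {..<N J} x * \<phi> x \<partial>lborel) \<longlonglongrightarrow> (\<integral>x. f x * \<phi> x \<partial>lborel)
      \<and> (\<lambda>J. \<integral>x. (hermite_partial b {..<N J} x)\<^sup>2 * \<phi> x \<partial>lborel) \<longlonglongrightarrow> (\<integral>x. (f x)\<^sup>2 * \<phi> x \<partial>lborel))"
proof -
  have wpos: "w x > 0" for x using less_le_trans[OF japanese_weight_pos w] .
  define S where "S J x = hermite_partial b {..<N J} x" for J x
  have [measurable]: "S J \<in> borel_measurable borel" for J unfolding S_def[abs_def] by measurable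
  define D where "D j x = hermite_partial b {N j..<N (Suc j)} x * complex_of_real (sqrt (w x))" for j x
  have D2: "(norm (D j x))\<^sup>2 = (norm (hermite_partial b {N j..<N (Suc j)} x))\<^sup>2 * w x" for j x
    using wpos[of x] by (simp add: D_def norm_mult power_mult_distrib)
  have Dm: "D j \<in> borel_measurable lborel" for j unfolding D_def[abs_def] by measurable
  have DS: "(\<Sum>j<J. D j x) = S J x * complex_of_real (sqrt (w x))" for J x
    unfolding D_def S_def sum_distrib_right[symmetric] hermite_partial_blocks[OF N] ..
  obtain f' F where f': "f' \<in> borel_measurable lborel" "integrable lborel F"
    "AE x in lborel. (\<lambda>J. S J x * complex_of_real (sqrt (w x))) \<longlonglongrightarrow> f' x"
    "AE x in lborel. \<forall>J. (norm (S J x * complex_of_real (sqrt (w x))))\<^sup>2 \<le> F x"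
    using lacunary_series_majorant[of D, OF Dm, unfolded D2 DS, OF fin] by blast
  define f where "f x = f' x / complex_of_real (sqrt (w x))" for x
  have fm [measurable]: "f \<in> borel_measurable borel" unfolding f_def[abs_def] using f'(1) by measurable
  have lim: "AE x in lborel. (\<lambda>J. S J x) \<longlonglongrightarrow> f x"
    using f'(3)
  proof eventually_elim
    case (elim x)
    have nz: "complex_of_real (sqrt (w x)) \<noteq> 0" using wpos[of x] by simp
    show ?case
      using tendsto_divide[OF elim tendsto_const nz] nz by (simp add: f_def)
  qed
  have maj: "AE x in lborel. \<forall>J. (norm (S J x))\<^sup>2 * w x \<le> F x"
    using f'(4) by eventually_elim (use wpos in \<open>simp add: norm_mult power_mult_distrib less_imp_le\<close>)
  have "AE x in lborel. (norm (f x))\<^sup>2 * w x \<le> F x"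
    using lim maj
  proof eventually_elim
    case (elim x)
    have "(\<lambda>J. (norm (S J x))\<^sup>2 * w x) \<longlonglongrightarrow> (norm (f x))\<^sup>2 * w x"
      by (intro tendsto_intros elim)
    then show ?case using elim(2) by (intro LIMSEQ_le_const2) auto
  qed
  then have "AE x in lborel. norm ((norm (f x))\<^sup>2 * w x) \<le> norm (F x)"
  proof eventually_elim
    case (elim x)
    then show ?case using wpos[of x] abs_ge_self[of "F x"] by (simp add: abs_mult)
  qed
  then have intf: "integrable lborel (\<lambda>x. (norm (f x))\<^sup>2 * w x)"
    by (intro Bochner_Integration.integrable_bound[OF f'(2)]) auto
  have "(\<lambda>J. \<integral>x. S J x * \<phi> x \<partial>lborel) \<longlonglongrightarrow> (\<integral>x. f x * \<phi> x \<partial>lborel)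
      \<and> (\<lambda>J. \<integral>x. (S J x)\<^sup>2 * \<phi> x \<partial>lborel) \<longlonglongrightarrow> (\<integral>x. (f x)\<^sup>2 * \<phi> x \<partial>lborel)" if \<phi>: "schwartz \<phi>" for \<phi>
  proof
    define C where "C = schwartz_seminorm 0 0 \<phi> + schwartz_seminorm 2 0 \<phi>"
    have C0: "C \<ge> 0" using schwartz_seminorm_nonneg[OF \<phi>] by (simp add: C_def)
    have C: "norm (\<phi> x) \<le> C * japanese_weight x" for x
      unfolding C_def by (rule schwartz_weight_bound[OF \<phi>])
    have [measurable]: "\<phi> \<in> borel_measurable borel" using schwartz_measurable0[OF \<phi>] by auto
    have sq: "(norm (S J x))\<^sup>2 * japanese_weight x \<le> F x" if "(norm (S J x))\<^sup>2 * w x \<le> F x" for J x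
      using mult_left_mono[OF w[of x], of "(norm (S J x))\<^sup>2"] that by simp
    show "(\<lambda>J. \<integral>x. (S J x)\<^sup>2 * \<phi> x \<partial>lborel) \<longlonglongrightarrow> (\<integral>x. (f x)\<^sup>2 * \<phi> x \<partial>lborel)"
    proof (rule integral_dominated_convergence)
      show "integrable lborel (\<lambda>x. C * F x)" using f'(2) by (rule integrable_mult_right)
      show "AE x in lborel. (\<lambda>J. (S J x)\<^sup>2 * \<phi> x) \<longlonglongrightarrow> (f x)\<^sup>2 * \<phi> x"
        using lim by eventually_elim (intro tendsto_intros)
      show "AE x in lborel. norm ((S J x)\<^sup>2 * \<phi> x) \<le> C * F x" for J
        using maj
      proof eventually_elim
        case (elim x)
        have "norm ((S J x)\<^sup>2 * \<phi> x) \<le> (norm (S J x))\<^sup>2 * (C * japanese_weight x)"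
          unfolding norm_mult norm_power by (intro mult_left_mono C) auto
        also have "\<dots> = C * ((norm (S J x))\<^sup>2 * japanese_weight x)" by simp
        also have "\<dots> \<le> C * F x" using elim sq C0 by (intro mult_left_mono) auto
        finally show ?case .
      qed
    qed measurable
    show "(\<lambda>J. \<integral>x. S J x * \<phi> x \<partial>lborel) \<longlonglongrightarrow> (\<integral>x. f x * \<phi> x \<partial>lborel)"
    proof (rule integral_dominated_convergence)
      show "integrable lborel (\<lambda>x. C * (F x + japanese_weight x))"
        by (intro integrable_mult_right Bochner_Integration.integrable_add f'(2) integrable_japanese_weight)
      show "AE x in lborel. (\<lambda>J. S J x * \<phi> x) \<longlonglongrightarrow> f x * \<phi> x"
        using lim by eventually_elim (intro tendsto_intros)
      show "AE x in lborel. norm (S J x * \<phi> x) \<le> C * (F x + japanese_weight x)" for J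
        using maj
      proof eventually_elim
        case (elim x)
        have "norm (S J x) \<le> (norm (S J x))\<^sup>2 + 1"
          using sum_squares_bound[of "norm (S J x)" 1] norm_ge_zero[of "S J x"]
          unfolding power_one mult_1_right by linarith
        then have "norm (S J x) * japanese_weight x \<le> ((norm (S J x))\<^sup>2 + 1) * japanese_weight x"
          by (rule mult_right_mono) simp
        also have "\<dots> \<le> F x + japanese_weight x"
          using sq elim by (simp add: distrib_right)
        finally have le: "norm (S J x) * japanese_weight x \<le> F x + japanese_weight x" .
        have "norm (S J x * \<phi> x) \<le> norm (S J x) * (C * japanese_weight x)"
          unfolding norm_mult by (intro mult_left_mono C) auto
        also have "\<dots> = C * (norm (S J x) * japanese_weight x)" by simp
        also have "\<dots> \<le> C * (F x + japanese_weight x)" using le C0 by (rule mult_left_mono)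
        finally show ?case .
      qed
    qed measurable
  qed
  then show ?thesis
    using intf fm unfolding S_def by (intro exI[of _ f]) auto
qed

lemma hermite_partial_norm_integral:
  fixes w :: "real \<Rightarrow> real"
  assumes [measurable]: "w \<in> borel_measurable borel" and w: "\<And>x. 0 \<le> w x" "\<And>x. w x \<le> 1"
  shows "integrable lborel (\<lambda>x. (norm (hermite_partial b A x))\<^sup>2 * w x)"
    and "complex_of_real (\<integral>x. (norm (hermite_partial b A x))\<^sup>2 * w x \<partial>lborel)
      = (\<Sum>n\<in>A. \<Sum>m\<in>A. b n * cnj (b m) * complex_of_real (\<integral>x. hermite_fun n x * hermite_fun m x * w x \<partial>lborel))"
proof -
  have i: "integrable lborel (\<lambda>x. complex_of_real (hermite_fun n x * hermite_fun m x * w x))" for n m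
  proof (rule Bochner_Integration.integrable_bound[OF integrable_hermite_mult[OF _ hermite_L2, of n m]])
    have "\<bar>hermite_fun n x * hermite_fun m x * w x\<bar> \<le> \<bar>hermite_fun n x * hermite_fun m x\<bar>" for x
      using w[of x] mult_left_mono[of "w x" 1 "\<bar>hermite_fun n x * hermite_fun m x\<bar>"] by (simp add: abs_mult)
    then show "AE x in lborel. norm (complex_of_real (hermite_fun n x * hermite_fun m x * w x))
        \<le> norm (hermite_cfun n x * hermite_cfun m x)"
      by (intro AE_I2) (simp only: norm_of_real of_real_mult[symmetric])
  qed measurable
  have eq: "complex_of_real ((norm (hermite_partial b A x))\<^sup>2 * w x)
      = (\<Sum>n\<in>A. \<Sum>m\<in>A. b n * cnj (b m) * complex_of_real (hermite_fun n x * hermite_fun m x * w x))" for x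
  proof -
    have "complex_of_real ((norm (hermite_partial b A x))\<^sup>2 * w x)
        = hermite_partial b A x * cnj (hermite_partial b A x) * complex_of_real (w x)"
      by (simp only: of_real_mult complex_norm_square)
    also have "\<dots> = (\<Sum>n\<in>A. \<Sum>m\<in>A. (b n * hermite_cfun n x) * (cnj (b m) * hermite_cfun m x)) * complex_of_real (w x)"
      by (simp add: hermite_partial_def sum_product)
    also have "\<dots> = (\<Sum>n\<in>A. \<Sum>m\<in>A. b n * cnj (b m) * complex_of_real (hermite_fun n x * hermite_fun m x * w x))"
      unfolding sum_distrib_right by (intro sum.cong refl) simp
    finally show ?thesis .
  qed
  have ii: "integrable lborel (\<lambda>x. complex_of_real ((norm (hermite_partial b A x))\<^sup>2 * w x))"
    unfolding eq by (intro Bochner_Integration.integrable_sum integrable_mult_right i)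
  then show "integrable lborel (\<lambda>x. (norm (hermite_partial b A x))\<^sup>2 * w x)"
    by (rule complex_of_real_integrable_eq[THEN iffD1])
  have "complex_of_real (\<integral>x. (norm (hermite_partial b A x))\<^sup>2 * w x \<partial>lborel)
      = (\<integral>x. complex_of_real ((norm (hermite_partial b A x))\<^sup>2 * w x) \<partial>lborel)"
    by (rule integral_complex_of_real[symmetric])
  also have "\<dots> = (\<Sum>n\<in>A. \<Sum>m\<in>A. b n * cnj (b m) * complex_of_real (\<integral>x. hermite_fun n x * hermite_fun m x * w x \<partial>lborel))"
    unfolding eq integral_complex_of_real[symmetric]
    by (subst Bochner_Integration.integral_sum, intro Bochner_Integration.integrable_sum integrable_mult_right i)
       (intro sum.cong refl, subst Bochner_Integration.integral_sum, intro integrable_mult_right i,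
        intro sum.cong refl integral_mult_right_zero)
  finally show "complex_of_real (\<integral>x. (norm (hermite_partial b A x))\<^sup>2 * w x \<partial>lborel)
      = (\<Sum>n\<in>A. \<Sum>m\<in>A. b n * cnj (b m) * complex_of_real (\<integral>x. hermite_fun n x * hermite_fun m x * w x \<partial>lborel))" .
qed

lemma hermite_parseval_finite:
  assumes "finite A"
  shows "integrable lborel (\<lambda>x. (norm (hermite_partial b A x))\<^sup>2)"
    and "(\<integral>x. (norm (hermite_partial b A x))\<^sup>2 \<partial>lborel) = (\<Sum>n\<in>A. (norm (b n))\<^sup>2)"
proof -
  note g = hermite_partial_norm_integral[of "\<lambda>_. 1", where b = b and A = A, simplified]
  show "integrable lborel (\<lambda>x. (norm (hermite_partial b A x))\<^sup>2)" by (rule g(1))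
  have o: "complex_of_real (\<integral>x. hermite_fun n x * hermite_fun m x \<partial>lborel) = (if n = m then 1 else 0)" for n m
    using hermite_orthonormal[of n m]
    unfolding hermite_coeff_def of_real_mult[symmetric] integral_complex_of_real .
  have "complex_of_real (\<integral>x. (norm (hermite_partial b A x))\<^sup>2 \<partial>lborel)
      = (\<Sum>n\<in>A. \<Sum>m\<in>A. if n = m then b n * cnj (b m) else 0)"
    unfolding g(2) o by (intro sum.cong) auto
  also have "\<dots> = (\<Sum>n\<in>A. b n * cnj (b n))"
    using assms by (intro sum.cong) (auto simp: sum.delta)
  also have "\<dots> = complex_of_real (\<Sum>n\<in>A. (norm (b n))\<^sup>2)"
    by (simp only: of_real_sum complex_norm_square)
  finally show "(\<integral>x. (norm (hermite_partial b A x))\<^sup>2 \<partial>lborel) = (\<Sum>n\<in>A. (norm (b n))\<^sup>2)"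
    by (simp only: of_real_eq_iff)
qed

lemma summable_hermite_coeff:
  assumes "schwartz \<phi>"
  shows "summable (\<lambda>k. (2 * real k + 1) * (norm (hermite_coeff \<phi> k))\<^sup>2)"
  by (rule summableI_nonneg_bounded[OF _ hermite_bessel_H1[OF assms]]) simp

text \<open>Split \<open>b\<^sub>k \<langle>\<phi>, h\<^sub>k\<rangle>\<close> into \<open>b\<^sub>k / \<lambda>\<^sub>k\<close> and \<open>\<lambda>\<^sub>k \<langle>\<phi>, h\<^sub>k\<rangle>\<close>, both of which are square-summable.\<close>

lemma summable_hermite_pairing:
  assumes \<phi>: "schwartz \<phi>" and b: "summable (\<lambda>k. (norm (b k))\<^sup>2 / (2 * real k + 1))"
  shows "summable (\<lambda>k. b k * hermite_coeff \<phi> k)"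
proof (rule summable_comparison_test')
  show "summable (\<lambda>k. (norm (b k))\<^sup>2 / (2 * real k + 1) + (2 * real k + 1) * (norm (hermite_coeff \<phi> k))\<^sup>2)"
    by (intro summable_add b summable_hermite_coeff \<phi>)
  fix k
  define s where "s = sqrt (2 * real k + 1)"
  have s: "s > 0" "s\<^sup>2 = 2 * real k + 1" by (auto simp: s_def)
  define p q where "p = norm (b k) / s" and "q = s * norm (hermite_coeff \<phi> k)"
  have pq: "p \<ge> 0" "q \<ge> 0" using s by (auto simp: p_def q_def)
  have "norm (b k * hermite_coeff \<phi> k) = p * q" using s by (simp add: p_def q_def norm_mult)
  also have "\<dots> \<le> p\<^sup>2 + q\<^sup>2" using sum_squares_bound[of p q] mult_nonneg_nonneg[OF pq] by linarith
  also have "\<dots> = (norm (b k))\<^sup>2 / (2 * real k + 1) + (2 * real k + 1) * (norm (hermite_coeff \<phi> k))\<^sup>2"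
    using s by (simp add: p_def q_def power_divide power_mult_distrib)
  finally show "norm (b k * hermite_coeff \<phi> k)
      \<le> (norm (b k))\<^sup>2 / (2 * real k + 1) + (2 * real k + 1) * (norm (hermite_coeff \<phi> k))\<^sup>2" .
qed

lemma hermite_sums_from_blocks:
  assumes "strict_mono N" "schwartz \<phi>" "summable (\<lambda>k. (norm (b k))\<^sup>2 / (2 * real k + 1))"
    and lim: "(\<lambda>J. \<integral>x. hermite_partial b {..<N J} x * \<phi> x \<partial>lborel) \<longlonglongrightarrow> l"
  shows "(\<lambda>k. b k * hermite_coeff \<phi> k) sums l"
proof -
  have "(\<lambda>K. \<Sum>k<K. b k * hermite_coeff \<phi> k) \<longlonglongrightarrow> (\<Sum>k. b k * hermite_coeff \<phi> k)"
    by (rule summable_LIMSEQ[OF summable_hermite_pairing[OF assms(2,3)]])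
  then have "(\<lambda>J. \<Sum>k<N J. b k * hermite_coeff \<phi> k) \<longlonglongrightarrow> (\<Sum>k. b k * hermite_coeff \<phi> k)"
    using LIMSEQ_subseq_LIMSEQ[OF _ assms(1)] by (simp add: o_def)
  then have "l = (\<Sum>k. b k * hermite_coeff \<phi> k)"
    using lim unfolding hermite_coeff_partial[OF assms(2)] by (rule LIMSEQ_unique[rotated])
  then show ?thesis
    using summable_sums[OF summable_hermite_pairing[OF assms(2,3)]] by simp
qed

text \<open>The partial sums along lacunary blocks converge almost everywhere with a square-integrable
  majorant; the full series of pairings then has the same limit because it converges absolutely.\<close>

lemma hermite_riesz_fischer:
  assumes b: "summable (\<lambda>k. (norm (b k))\<^sup>2)"
  shows "\<exists>f. f \<in> borel_measurable lborel \<and> integrable lborel (\<lambda>x. (norm (f x))\<^sup>2)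
    \<and> (\<forall>\<phi>. schwartz \<phi> \<longrightarrow> (\<lambda>k. b k * hermite_coeff \<phi> k) sums (\<integral>x. f x * \<phi> x \<partial>lborel))"
proof -
  obtain N where N: "strict_mono N" "N 0 = 0"
    and sN: "summable (\<lambda>j. 2 ^ j * (\<Sum>n\<in>{N j..<N (Suc j)}. (norm (b n))\<^sup>2))"
    using lacunary_blocks[OF _ b] by auto
  have "(\<Sum>j. \<integral>\<^sup>+x. ennreal (2 ^ j * ((norm (hermite_partial b {N j..<N (Suc j)} x))\<^sup>2 * 1)) \<partial>lborel)
      = (\<Sum>j. ennreal (2 ^ j * (\<Sum>n\<in>{N j..<N (Suc j)}. (norm (b n))\<^sup>2)))"
    using hermite_parseval_finite[of "{N j..<N (Suc j)}" b for j]
    by (subst nn_integral_eq_integral) auto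
  also have "\<dots> < \<infinity>"
    by (subst suminf_ennreal2[OF _ sN]) (auto intro!: sum_nonneg mult_nonneg_nonneg)
  finally have fin: "(\<Sum>j. \<integral>\<^sup>+x. ennreal (2 ^ j * ((norm (hermite_partial b {N j..<N (Suc j)} x))\<^sup>2 * 1)) \<partial>lborel) < \<infinity>" .
  obtain f where f: "f \<in> borel_measurable lborel" "integrable lborel (\<lambda>x. (norm (f x))\<^sup>2 * 1)"
    "\<And>\<phi>. schwartz \<phi> \<Longrightarrow> (\<lambda>J. \<integral>x. hermite_partial b {..<N J} x * \<phi> x \<partial>lborel) \<longlonglongrightarrow> (\<integral>x. f x * \<phi> x \<partial>lborel)"
    using hermite_series_converges[OF _ japanese_weight_le_1 N fin] by auto
  have b': "summable (\<lambda>k. (norm (b k))\<^sup>2 / (2 * real k + 1))"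
    by (rule summable_comparison_test'[OF b]) (auto simp: divide_le_eq mult_le_cancel_left1)
  show ?thesis
    using f hermite_sums_from_blocks[OF N(1) _ b' f(3)] by (intro exI[of _ f]) auto
qed

lemma hermite_freq_square: "(hermite_freq n)\<^sup>2 = 2 * real n + 1"
  by (simp add: hermite_freq_def)

lemma regular_hermite: "schwartz \<phi> \<Longrightarrow> regular (hermite_cfun k) \<phi> = hermite_coeff \<phi> k"
  by (simp add: regular_def hermite_coeff_def mult.commute)

lemma H_calculus_not_schwartz: "\<not> schwartz \<phi> \<Longrightarrow> H_calculus F T \<phi> = 0"
  by (simp add: H_calculus_def regular_def)

lemma sobolev_norm_finite:
  assumes "summable (\<lambda>k. (2 * real k + 1) powr s * (norm (T (hermite_cfun k)))\<^sup>2)"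
  shows "sobolev_norm s T < \<infinity>"
proof -
  define b where "b k = complex_of_real ((2 * real k + 1) powr (s / 2)) * T (hermite_cfun k)" for k
  have "(norm (b k))\<^sup>2 = (2 * real k + 1) powr s * (norm (T (hermite_cfun k)))\<^sup>2" for k
    by (simp add: b_def norm_mult power_mult_distrib powr_power)
  then have "summable (\<lambda>k. (norm (b k))\<^sup>2)" using assms by simp
  then obtain f where f: "f \<in> borel_measurable lborel" "integrable lborel (\<lambda>x. (norm (f x))\<^sup>2)"
    "\<And>\<phi>. schwartz \<phi> \<Longrightarrow> (\<lambda>k. b k * hermite_coeff \<phi> k) sums (\<integral>x. f x * \<phi> x \<partial>lborel)"
    using hermite_riesz_fischer by blast
  have "H_power (s / 2) T \<phi> = regular f \<phi>" for \<phi>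
  proof (cases "schwartz \<phi>")
    case True
    then show ?thesis
      using sums_unique[OF f(3)[OF True]]
      by (simp add: H_power_def H_calculus_def hermite_freq_square regular_hermite b_def regular_def[of f])
  next
    case False
    then show ?thesis by (simp add: H_power_def H_calculus_not_schwartz regular_def)
  qed
  then have eq: "H_power (s / 2) T = regular f" by blast
  have [measurable]: "f \<in> borel_measurable borel" using f(1) by simp
  have "integrable lborel (\<lambda>x. (norm (f x))\<^sup>2 * japanese_weight x)"
  proof (rule Bochner_Integration.integrable_bound[OF f(2)])
    have "(norm (f x))\<^sup>2 * japanese_weight x \<le> (norm (f x))\<^sup>2 * 1" for x
      by (rule mult_left_mono[OF japanese_weight_le_1]) simp
    then show "AE x in lborel. norm ((norm (f x))\<^sup>2 * japanese_weight x) \<le> norm ((norm (f x))\<^sup>2)"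
      by (intro AE_I2) (simp add: abs_mult)
  qed measurable
  then have "represents f (regular f)"
    by (rule represents_regular[OF f(1) integrable_weight_of_square[OF f(1)]])
  then have "L2_norm (H_power (s / 2) T) \<le> ennreal (sqrt (\<integral>x. (norm (f x))\<^sup>2 \<partial>lborel))"
    unfolding L2_norm_def eq using f(2) by (intro Inf_lower) auto
  then show ?thesis
    unfolding sobolev_norm_def by (rule le_less_trans) simp
qed

text \<open>The squared \<open>\<H>\<^sup>\<theta>\<close> norm of the square of a partial sum, truncated to as many frequencies as the sum
  has terms, so that it is a polynomial in finitely many coefficients.\<close>

definition hermite_square_energy :: "real \<Rightarrow> (nat \<Rightarrow> complex) \<Rightarrow> nat \<Rightarrow> real" where
  "hermite_square_energy \<theta> d K = (\<Sum>k<K. (2 * real k + 1) powr \<theta>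
     * (norm (\<integral>x. (hermite_partial d {..<K} x)\<^sup>2 * hermite_cfun k x \<partial>lborel))\<^sup>2)"

text \<open>The partial sums \<open>S\<close> along \<open>N\<close> converge to the representing function \<open>f\<close>, and \<open>\<langle>S\<^sup>2, h\<^sub>k\<rangle>\<close> converges to \<open>\<langle>f\<^sup>2, h\<^sub>k\<rangle>\<close>
  for each \<open>k\<close>. Lower semicontinuity then transfers a bound on the energy that holds for infinitely many
  partial sums to \<open>f\<^sup>2\<close>.\<close>

proposition square_in_sobolev_space:
  assumes N: "strict_mono N" "N 0 = 0"
    and d: "summable (\<lambda>n. (norm (d n))\<^sup>2 / (2 * real n + 1))"
    and fin: "(\<Sum>j. \<integral>\<^sup>+x. ennreal (2 ^ j * ((norm (hermite_partial d {N j..<N (Suc j)} x))\<^sup>2 * japanese_weight x)) \<partial>lborel) < \<infinity>"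
    and energy: "liminf (\<lambda>j. ennreal (hermite_square_energy \<theta> d (N j))) < \<infinity>"
    and T: "\<And>\<phi>. T \<phi> = (\<Sum>n. d n * regular (hermite_cfun n) \<phi>)"
  shows "\<exists>v. has_square T v \<and> sobolev_norm \<theta> v < \<infinity>"
proof -
  obtain f where f: "f \<in> borel_measurable lborel"
    and f2: "integrable lborel (\<lambda>x. (norm (f x))\<^sup>2 * japanese_weight x)"
    and lim1: "\<And>\<phi>. schwartz \<phi> \<Longrightarrow> (\<lambda>J. \<integral>x. hermite_partial d {..<N J} x * \<phi> x \<partial>lborel) \<longlonglongrightarrow> (\<integral>x. f x * \<phi> x \<partial>lborel)"
    and lim2: "\<And>\<phi>. schwartz \<phi> \<Longrightarrow> (\<lambda>J. \<integral>x. (hermite_partial d {..<N J} x)\<^sup>2 * \<phi> x \<partial>lborel) \<longlonglongrightarrow> (\<integral>x. (f x)\<^sup>2 * \<phi> x \<partial>lborel)"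
    using hermite_series_converges[OF _ order_refl N fin] by auto
  have [measurable]: "f \<in> borel_measurable borel" using f by simp
  have "T \<phi> = regular f \<phi>" for \<phi>
  proof (cases "schwartz \<phi>")
    case True
    then show ?thesis
      using sums_unique[OF hermite_sums_from_blocks[OF N(1) True d lim1[OF True]]]
      by (simp add: T regular_hermite regular_def[of f])
  next
    case False
    then show ?thesis by (simp add: T regular_def)
  qed
  then have "T = regular f" by blast
  then have rep1: "represents f T"
    using represents_regular[OF f integrable_weight_of_square[OF f f2]] by simp
  define v where "v = regular (\<lambda>x. (f x)\<^sup>2)"
  have rep2: "represents (\<lambda>x. (f x)\<^sup>2) v"
    unfolding v_def using f2 by (intro represents_regular) (auto simp: norm_power)
  define a where "a J k = (2 * real k + 1) powr \<theta>
     * (norm (\<integral>x. (hermite_partial d {..<N J} x)\<^sup>2 * hermite_cfun k x \<partial>lborel))\<^sup>2" for J k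
  define l where "l k = (2 * real k + 1) powr \<theta> * (norm (v (hermite_cfun k)))\<^sup>2" for k
  have al: "(\<lambda>J. a J k) \<longlonglongrightarrow> l k" for k
    unfolding a_def l_def v_def regular_def using lim2[OF schwartz_hermite[of k]] schwartz_hermite[of k]
    by (auto intro!: tendsto_intros)
  obtain R where R: "R \<ge> 0" "liminf (\<lambda>j. ennreal (hermite_square_energy \<theta> d (N j))) < ennreal R"
  proof -
    obtain r where r: "r \<ge> 0" "liminf (\<lambda>j. ennreal (hermite_square_energy \<theta> d (N j))) = ennreal r"
      using energy by (cases "liminf (\<lambda>j. ennreal (hermite_square_energy \<theta> d (N j)))") auto
    then show ?thesis using that[of "r + 1"] by (simp add: ennreal_less_iff)
  qed
  have "(\<Sum>k<K. l k) \<le> R" for K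
  proof (rule ccontr)
    assume "\<not> (\<Sum>k<K. l k) \<le> R"
    then have "eventually (\<lambda>J. R < (\<Sum>k<K. a J k)) sequentially"
      using tendsto_sum[of "{..<K}" "\<lambda>k J. a J k" l sequentially] al by (intro order_tendstoD(1)) auto
    moreover have "eventually (\<lambda>J. K \<le> N J) sequentially"
      using strict_mono_imp_increasing[OF N(1)] order_trans
      by (auto simp: eventually_sequentially intro!: exI[of _ K])
    ultimately have "eventually (\<lambda>J. ennreal R \<le> ennreal (hermite_square_energy \<theta> d (N J))) sequentially"
    proof eventually_elim
      case (elim J)
      have "(\<Sum>k<K. a J k) \<le> (\<Sum>k<N J. a J k)"
        using elim by (intro sum_mono2) (auto simp: a_def)
      then have "R \<le> hermite_square_energy \<theta> d (N J)"
        using elim by (simp add: hermite_square_energy_def a_def)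
      then show ?case by (rule ennreal_leI)
    qed
    then have "ennreal R \<le> liminf (\<lambda>j. ennreal (hermite_square_energy \<theta> d (N j)))"
      by (rule Liminf_bounded)
    then show False using R(2) by simp
  qed
  then have "summable l"
    by (intro summableI_nonneg_bounded[of l R]) (auto simp: l_def)
  then have "sobolev_norm \<theta> v < \<infinity>"
    unfolding l_def by (rule sobolev_norm_finite)
  then show ?thesis
    using rep1 rep2 unfolding has_square_def by blast
qed

section \<open>Moments of independent complex Gaussians\<close>

lemma lborel_mult_ii: "distr lborel borel (\<lambda>z. \<i> * z) = (lborel :: complex measure)"
proof (rule lborel_eqI[symmetric])
  fix l u :: complex
  assume le: "\<And>b. b \<in> Basis \<Longrightarrow> l \<bullet> b \<le> u \<bullet> b"
  have le': "Re l \<le> Re u" "Im l \<le> Im u"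
    using le[of 1] le[of \<i>] by (auto simp: Basis_complex_def)
  have "(\<lambda>z. \<i> * z) -` box l u = box (Complex (Im l) (- Re u)) (Complex (Im u) (- Re l))"
    by (auto simp: box_def Basis_complex_def inner_complex_def)
  then have "emeasure (distr lborel borel (\<lambda>z. \<i> * z)) (box l u)
      = emeasure lborel (box (Complex (Im l) (- Re u)) (Complex (Im u) (- Re l)))"
    by (subst emeasure_distr) auto
  also have "\<dots> = (\<Prod>b\<in>Basis. (Complex (Im u) (- Re l) - Complex (Im l) (- Re u)) \<bullet> b)"
    using le' by (intro emeasure_lborel_box) (auto simp: Basis_complex_def inner_complex_def)
  also have "\<dots> = (\<Prod>b\<in>Basis. (u - l) \<bullet> b)"
    by (simp add: Basis_complex_def inner_complex_def mult.commute)
  finally show "emeasure (distr lborel borel (\<lambda>z. \<i> * z)) (box l u) = (\<Prod>b\<in>Basis. (u - l) \<bullet> b)" .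
qed simp

abbreviation gauss_density :: "complex \<Rightarrow> real" where
  "gauss_density z \<equiv> exp (- (norm z)\<^sup>2) / pi"

lemma standard_complex_gaussian_measurable:
  "standard_complex_gaussian M X \<Longrightarrow> X \<in> borel_measurable M"
  unfolding standard_complex_gaussian_def using distributed_measurable by fastforce

lemma gaussian_rotation:
  fixes F :: "complex \<Rightarrow> complex"
  assumes X: "standard_complex_gaussian M X" and [measurable]: "F \<in> borel_measurable borel"
  shows "(\<integral>\<omega>. F (\<i> * X \<omega>) \<partial>M) = (\<integral>\<omega>. F (X \<omega>) \<partial>M)"
proof -
  have D: "distr M lborel X = density lborel gauss_density"
    using X unfolding standard_complex_gaussian_def by (rule distributed_distr_eq_density)
  have [measurable]: "X \<in> measurable M lborel"
    using standard_complex_gaussian_measurable[OF X] by simp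
  have "(\<integral>\<omega>. F (\<i> * X \<omega>) \<partial>M) = (\<integral>z. F (\<i> * z) \<partial>distr M lborel X)"
    by (rule integral_distr[symmetric]) measurable
  also have "\<dots> = (\<integral>z. gauss_density z *\<^sub>R F (\<i> * z) \<partial>lborel)"
    unfolding D by (rule integral_density) auto
  also have "\<dots> = (\<integral>z. gauss_density (\<i> * z) *\<^sub>R F (\<i> * z) \<partial>lborel)"
    by (simp add: norm_mult)
  also have "\<dots> = (\<integral>z. gauss_density z *\<^sub>R F z \<partial>distr lborel borel (\<lambda>z. \<i> * z))"
    by (rule integral_distr[symmetric]) measurable
  also have "\<dots> = (\<integral>z. F z \<partial>distr M lborel X)"
    unfolding lborel_mult_ii D by (rule integral_density[symmetric]) auto
  also have "\<dots> = (\<integral>\<omega>. F (X \<omega>) \<partial>M)"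
    by (rule integral_distr) measurable
  finally show ?thesis .
qed

text \<open>Scaling by \<open>\<surd>2\<close> turns \<open>e\<^bsup>|z|\<^sup>2/2\<^esup>\<close> times the density into twice the density.\<close>

lemma gaussian_exp_moment:
  assumes "prob_space M" and X: "standard_complex_gaussian M X"
  shows "(\<integral>\<^sup>+\<omega>. ennreal (exp ((norm (X \<omega>))\<^sup>2 / 2)) \<partial>M) = 2"
proof -
  have dist: "distributed M lborel X (\<lambda>z. ennreal (gauss_density z))"
    using X unfolding standard_complex_gaussian_def .
  have "(\<integral>\<^sup>+z. ennreal (gauss_density z) * 1 \<partial>(lborel :: complex measure)) = (\<integral>\<^sup>+\<omega>. 1 \<partial>M)"
    by (rule distributed_nn_integral[OF dist]) simp
  then have one: "(\<integral>\<^sup>+z. ennreal (gauss_density z) \<partial>(lborel :: complex measure)) = 1"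
    using prob_space.emeasure_space_1[OF assms(1)] by simp
  have "(\<integral>\<^sup>+\<omega>. ennreal (exp ((norm (X \<omega>))\<^sup>2 / 2)) \<partial>M)
      = (\<integral>\<^sup>+z. ennreal (gauss_density z) * ennreal (exp ((norm z)\<^sup>2 / 2)) \<partial>(lborel :: complex measure))"
    by (rule distributed_nn_integral[OF dist, symmetric]) measurable
  also have "\<dots> = (\<integral>\<^sup>+z. ennreal (exp (- ((norm z)\<^sup>2 / 2)) / pi) \<partial>(lborel :: complex measure))"
  proof -
    have "exp (- a) / pi * exp (a / 2) = exp (- (a / 2)) / pi" for a :: real
    proof -
      have "exp (- a) * exp (a / 2) = exp (- (a / 2))"
        unfolding exp_add[symmetric] by (rule arg_cong[of _ _ exp]) simp
      then show ?thesis by simp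
    qed
    then have "ennreal (gauss_density z) * ennreal (exp ((norm z)\<^sup>2 / 2)) = ennreal (exp (- ((norm z)\<^sup>2 / 2)) / pi)" for z :: complex
      by (simp only: ennreal_mult''[symmetric] exp_ge_zero)
    then show ?thesis by simp
  qed
  also have "\<dots> = (\<integral>\<^sup>+z. ennreal (exp (- ((norm z)\<^sup>2 / 2)) / pi)
      \<partial>density (distr lborel borel (\<lambda>x::complex. 0 + sqrt 2 *\<^sub>R x)) (\<lambda>_. ennreal (\<bar>sqrt 2\<bar> ^ DIM(complex))))"
    by (subst lborel_affine[of "sqrt 2" "0::complex", symmetric]) auto
  also have "\<dots> = (\<integral>\<^sup>+z. 2 * ennreal (exp (- ((norm z)\<^sup>2 / 2)) / pi) \<partial>distr lborel borel (\<lambda>x::complex. 0 + sqrt 2 *\<^sub>R x))"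
    by (subst nn_integral_density) auto
  also have "\<dots> = (\<integral>\<^sup>+z. 2 * ennreal (exp (- ((norm (0 + sqrt 2 *\<^sub>R z))\<^sup>2 / 2)) / pi) \<partial>(lborel :: complex measure))"
    by (rule nn_integral_distr) measurable
  also have "\<dots> = (\<integral>\<^sup>+z. 2 * ennreal (gauss_density z) \<partial>(lborel :: complex measure))"
    by (simp add: power_mult_distrib)
  also have "\<dots> = 2 * (\<integral>\<^sup>+z. ennreal (gauss_density z) \<partial>(lborel :: complex measure))"
    by (rule nn_integral_cmult) measurable
  finally show ?thesis by (simp add: one)
qed

lemma gaussian_fourth_moment:
  assumes M: "prob_space M" and X: "standard_complex_gaussian M X"
  shows "integrable M (\<lambda>\<omega>. (norm (X \<omega>)) ^ 4)" "(\<integral>\<omega>. (norm (X \<omega>)) ^ 4 \<partial>M) \<le> 16"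
proof -
  have [measurable]: "X \<in> borel_measurable M" by (rule standard_complex_gaussian_measurable[OF X])
  \<comment> \<open>\<open>y\<^sup>2 / 2 \<le> e\<^sup>y\<close> for \<open>y = |z|\<^sup>2 / 2\<close>\<close>
  have le: "(norm z) ^ 4 \<le> 8 * exp ((norm z)\<^sup>2 / 2)" for z :: complex
  proof -
    define y where "y = (norm z)\<^sup>2 / 2"
    have "y \<ge> 0" by (simp add: y_def)
    then have "y\<^sup>2 / 2 \<le> exp y" using exp_lower_Taylor_quadratic[of y] by linarith
    moreover have "(norm z) ^ 4 = 4 * y\<^sup>2"
      by (simp add: y_def power_divide flip: power_mult)
    ultimately show ?thesis by (simp add: y_def)
  qed
  have "(\<integral>\<^sup>+\<omega>. ennreal ((norm (X \<omega>)) ^ 4) \<partial>M) \<le> (\<integral>\<^sup>+\<omega>. 8 * ennreal (exp ((norm (X \<omega>))\<^sup>2 / 2)) \<partial>M)"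
  proof (rule nn_integral_mono)
    fix \<omega>
    have "ennreal ((norm (X \<omega>)) ^ 4) \<le> ennreal (8 * exp ((norm (X \<omega>))\<^sup>2 / 2))"
      by (rule ennreal_leI[OF le])
    then show "ennreal ((norm (X \<omega>)) ^ 4) \<le> 8 * ennreal (exp ((norm (X \<omega>))\<^sup>2 / 2))"
      by (simp add: ennreal_mult)
  qed
  also have "\<dots> = 8 * (\<integral>\<^sup>+\<omega>. ennreal (exp ((norm (X \<omega>))\<^sup>2 / 2)) \<partial>M)"
    by (rule nn_integral_cmult) measurable
  also have "\<dots> = 16"
    unfolding gaussian_exp_moment[OF M X] by simp
  finally have 16: "(\<integral>\<^sup>+\<omega>. ennreal ((norm (X \<omega>)) ^ 4) \<partial>M) \<le> ennreal 16" by simp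
  then show int: "integrable M (\<lambda>\<omega>. (norm (X \<omega>)) ^ 4)"
    unfolding integrable_iff_bounded by (auto intro: le_less_trans)
  have "ennreal (\<integral>\<omega>. (norm (X \<omega>)) ^ 4 \<partial>M) \<le> ennreal 16"
    using 16 by (subst nn_integral_eq_integral[OF int, symmetric]) auto
  then show "(\<integral>\<omega>. (norm (X \<omega>)) ^ 4 \<partial>M) \<le> 16"
    by (subst (asm) ennreal_le_iff) auto
qed

lemma cnj_measurable [measurable]: "cnj \<in> borel_measurable borel"
  by (intro borel_measurable_continuous_onI continuous_intros)

text \<open>The law is invariant under the quarter turn \<open>z \<mapsto> \<i> z\<close>, which multiplies \<open>z\<^sup>a\<close> times the \<open>b\<close>-th power of the
  conjugate by \<open>\<i>\<^bsup>a-b\<^esup> \<noteq> 1\<close> when \<open>0 < |a - b| < 4\<close>.\<close>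

lemma gaussian_mixed_moment:
  assumes M: "prob_space M" and X: "standard_complex_gaussian M X" and ab: "a \<le> 2" "b \<le> 2"
  shows "integrable M (\<lambda>\<omega>. X \<omega> ^ a * cnj (X \<omega>) ^ b)"
    and "a \<noteq> b \<Longrightarrow> (\<integral>\<omega>. X \<omega> ^ a * cnj (X \<omega>) ^ b \<partial>M) = 0"
proof -
  interpret prob_space M by fact
  have [measurable]: "X \<in> borel_measurable M" by (rule standard_complex_gaussian_measurable[OF X])
  show "integrable M (\<lambda>\<omega>. X \<omega> ^ a * cnj (X \<omega>) ^ b)"
  proof (rule Bochner_Integration.integrable_bound)
    show "integrable M (\<lambda>\<omega>. 1 + (norm (X \<omega>)) ^ 4)"
      using gaussian_fourth_moment(1)[OF M X] by simp
    have "norm (z ^ a * cnj z ^ b) \<le> 1 + (norm z) ^ 4" for z :: complex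
    proof (cases "norm z \<le> 1")
      case True
      then have "norm z ^ (a + b) \<le> 1" by (intro power_le_one) auto
      also have "\<dots> \<le> 1 + (norm z) ^ 4" by simp
      finally show ?thesis by (simp add: norm_mult norm_power power_add)
    next
      case False
      then have "norm z ^ (a + b) \<le> norm z ^ 4" using ab by (intro power_increasing) auto
      also have "\<dots> \<le> 1 + (norm z) ^ 4" by simp
      finally show ?thesis by (simp add: norm_mult norm_power power_add)
    qed
    then show "AE \<omega> in M. norm (X \<omega> ^ a * cnj (X \<omega>) ^ b) \<le> norm (1 + (norm (X \<omega>)) ^ 4)"
      by (intro AE_I2) (simp add: abs_of_nonneg)
  qed measurable
  assume ne: "a \<noteq> b"
  define E where "E = (\<integral>\<omega>. X \<omega> ^ a * cnj (X \<omega>) ^ b \<partial>M)"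
  have "E = (\<integral>\<omega>. (\<i> * X \<omega>) ^ a * cnj (\<i> * X \<omega>) ^ b \<partial>M)"
    unfolding E_def by (rule gaussian_rotation[OF X, of "\<lambda>z. z ^ a * cnj z ^ b", symmetric]) measurable
  also have "\<dots> = (\<integral>\<omega>. (\<i> ^ a * (- \<i>) ^ b) * (X \<omega> ^ a * cnj (X \<omega>) ^ b) \<partial>M)"
    by (intro Bochner_Integration.integral_cong refl) (simp add: power_mult_distrib power_minus[of \<i>] power_minus[of "\<i> * _"])
  also have "\<dots> = (\<i> ^ a * (- \<i>) ^ b) * E"
    unfolding E_def by (rule integral_mult_right_zero)
  finally have "E = (\<i> ^ a * (- \<i>) ^ b) * E" .
  moreover have "\<i> ^ a * (- \<i>) ^ b \<noteq> 1"
  proof -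
    have "a \<in> {0, 1, 2}" "b \<in> {0, 1, 2}" using ab by auto
    then show ?thesis using ne by (auto simp: complex_eq_iff)
  qed
  ultimately have "E = 0" by (metis mult_cancel_right1 mult.commute)
  then show "(\<integral>\<omega>. X \<omega> ^ a * cnj (X \<omega>) ^ b \<partial>M) = 0" by (simp add: E_def)
qed

locale gaussian_sequence = prob_space M for M :: "'w measure" +
  fixes g :: "nat \<Rightarrow> 'w \<Rightarrow> complex"
  assumes indep: "indep_vars (\<lambda>_. borel) g UNIV"
    and gaussian: "\<And>n. standard_complex_gaussian M (g n)"
begin

lemma g_measurable [measurable]: "g n \<in> borel_measurable M"
  by (rule standard_complex_gaussian_measurable[OF gaussian])

lemma product_moment:
  assumes I: "finite I" and ab: "\<And>i. a i \<le> 2" "\<And>i. b i \<le> (2::nat)"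
  shows "integrable M (\<lambda>\<omega>. \<Prod>i\<in>I. g i \<omega> ^ a i * cnj (g i \<omega>) ^ b i)"
    and "i \<in> I \<Longrightarrow> a i \<noteq> b i \<Longrightarrow> (\<integral>\<omega>. (\<Prod>i\<in>I. g i \<omega> ^ a i * cnj (g i \<omega>) ^ b i) \<partial>M) = 0"
proof -
  have iv: "indep_vars (\<lambda>_. borel) (\<lambda>i \<omega>. g i \<omega> ^ a i * cnj (g i \<omega>) ^ b i) I"
    by (rule indep_vars_compose2[OF indep_vars_subset[OF indep]]) auto
  note int = gaussian_mixed_moment(1)[OF prob_space_axioms gaussian ab]
  show "integrable M (\<lambda>\<omega>. \<Prod>i\<in>I. g i \<omega> ^ a i * cnj (g i \<omega>) ^ b i)"
    by (rule indep_vars_integrable[OF I iv int])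
  assume "i \<in> I" "a i \<noteq> b i"
  then show "(\<integral>\<omega>. (\<Prod>i\<in>I. g i \<omega> ^ a i * cnj (g i \<omega>) ^ b i) \<partial>M) = 0"
    unfolding indep_vars_lebesgue_integral[OF I iv int]
    using I gaussian_mixed_moment(2)[OF prob_space_axioms gaussian ab] by (intro prod_zero) auto
qed

lemma prod_power_delta:
  fixes x :: "'i \<Rightarrow> complex"
  assumes "finite I" "n \<in> I"
  shows "(\<Prod>i\<in>I. x i ^ (if n = i then 1 else 0)) = x n"
proof -
  have "(\<Prod>i\<in>I. x i ^ (if n = i then 1 else 0)) = (\<Prod>i\<in>I. if n = i then x i else 1)"
    by (intro prod.cong) auto
  then show ?thesis using assms by (simp add: prod.delta)
qed

lemma pair_moment:
  shows "integrable M (\<lambda>\<omega>. g n \<omega> * cnj (g m \<omega>))"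
    and "n \<noteq> m \<Longrightarrow> (\<integral>\<omega>. g n \<omega> * cnj (g m \<omega>) \<partial>M) = 0"
    and "norm (\<integral>\<omega>. g n \<omega> * cnj (g m \<omega>) \<partial>M) \<le> 17"
proof -
  define a b where "a i = (if n = i then 1 else 0::nat)" and "b i = (if m = i then 1 else 0::nat)" for i
  have eq: "(\<Prod>i\<in>{n,m}. g i \<omega> ^ a i * cnj (g i \<omega>) ^ b i) = g n \<omega> * cnj (g m \<omega>)" for \<omega>
    unfolding prod.distrib a_def b_def by (subst (1 2) prod_power_delta) auto
  have ab: "a i \<le> 2" "b i \<le> 2" for i by (auto simp: a_def b_def)
  note p = product_moment[of "{n,m}" a b, OF _ ab, unfolded eq]
  show int: "integrable M (\<lambda>\<omega>. g n \<omega> * cnj (g m \<omega>))" by (rule p(1)) simp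
  show "n \<noteq> m \<Longrightarrow> (\<integral>\<omega>. g n \<omega> * cnj (g m \<omega>) \<partial>M) = 0"
    by (rule p(2)[of n]) (auto simp: a_def b_def)
  note m4 = gaussian_fourth_moment[OF prob_space_axioms gaussian]
  have "norm (\<integral>\<omega>. g n \<omega> * cnj (g m \<omega>) \<partial>M) \<le> (\<integral>\<omega>. norm (g n \<omega> * cnj (g m \<omega>)) \<partial>M)"
    by (rule integral_norm_bound)
  also have "\<dots> \<le> (\<integral>\<omega>. 1 + ((norm (g n \<omega>)) ^ 4 + (norm (g m \<omega>)) ^ 4) / 2 \<partial>M)"
  proof (intro integral_mono integrable_norm int)
    show "integrable M (\<lambda>\<omega>. 1 + ((norm (g n \<omega>)) ^ 4 + (norm (g m \<omega>)) ^ 4) / 2)"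
      using m4(1)[of n] m4(1)[of m] by auto
    fix \<omega>
    define u v where "u = norm (g n \<omega>)" and "v = norm (g m \<omega>)"
    have "2 * (u * v) \<le> u\<^sup>2 + v\<^sup>2" using sum_squares_bound[of u v] by simp
    moreover have "2 * u\<^sup>2 \<le> 1 + u ^ 4" "2 * v\<^sup>2 \<le> 1 + v ^ 4"
      using sum_squares_bound[of 1 "u\<^sup>2"] sum_squares_bound[of 1 "v\<^sup>2"] by (simp_all flip: power_mult)
    moreover have "u ^ 4 \<ge> 0" "v ^ 4 \<ge> 0" by (simp_all add: u_def v_def)
    ultimately have "u * v \<le> 1 + (u ^ 4 + v ^ 4) / 2" unfolding add_divide_distrib by linarith
    then show "norm (g n \<omega> * cnj (g m \<omega>)) \<le> 1 + ((norm (g n \<omega>)) ^ 4 + (norm (g m \<omega>)) ^ 4) / 2"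
      unfolding norm_mult complex_mod_cnj u_def v_def .
  qed
  also have "\<dots> = 1 + ((\<integral>\<omega>. (norm (g n \<omega>)) ^ 4 \<partial>M) + (\<integral>\<omega>. (norm (g m \<omega>)) ^ 4 \<partial>M)) / 2"
    using m4(1)[of n] m4(1)[of m] by (simp add: prob_space)
  also have "\<dots> \<le> 17" using m4(2)[of n] m4(2)[of m] by simp
  finally show "norm (\<integral>\<omega>. g n \<omega> * cnj (g m \<omega>) \<partial>M) \<le> 17" .
qed

text \<open>If the multisets \<open>{n, m}\<close> and \<open>{k, l}\<close> differ, one variable occurs with different powers
  of itself and of its conjugate, and independence isolates the corresponding vanishing factor.\<close>

lemma quartic_moment:
  shows "integrable M (\<lambda>\<omega>. g n \<omega> * g m \<omega> * cnj (g k \<omega> * g l \<omega>))"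
    and "\<not> (n = k \<and> m = l) \<Longrightarrow> \<not> (n = l \<and> m = k) \<Longrightarrow> (\<integral>\<omega>. g n \<omega> * g m \<omega> * cnj (g k \<omega> * g l \<omega>) \<partial>M) = 0"
    and "norm (\<integral>\<omega>. g n \<omega> * g m \<omega> * cnj (g k \<omega> * g l \<omega>) \<partial>M) \<le> 16"
proof -
  define I where "I = {n, m, k, l}"
  define a where "a i = (if n = i then 1 else 0::nat) + (if m = i then 1 else 0)" for i
  define b where "b i = (if k = i then 1 else 0::nat) + (if l = i then 1 else 0)" for i
  have eq: "(\<Prod>i\<in>I. g i \<omega> ^ a i * cnj (g i \<omega>) ^ b i) = g n \<omega> * g m \<omega> * cnj (g k \<omega> * g l \<omega>)" for \<omega>
  proof -
    have d: "(\<Prod>i\<in>I. g i \<omega> ^ (if j = i then 1 else 0)) = g j \<omega>"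
      "(\<Prod>i\<in>I. cnj (g i \<omega>) ^ (if j = i then 1 else 0)) = cnj (g j \<omega>)" if "j \<in> I" for j
      using that by (intro prod_power_delta; simp add: I_def)+
    show ?thesis
      unfolding prod.distrib a_def b_def power_add
      using d[of n] d[of m] d[of k] d[of l] by (simp only: I_def insert_iff simp_thms complex_cnj_mult)
  qed
  have ab: "a i \<le> 2" "b i \<le> 2" for i by (auto simp: a_def b_def)
  have fI: "finite I" by (simp add: I_def)
  note p = product_moment[of I a b, OF fI ab, unfolded eq]
  show int: "integrable M (\<lambda>\<omega>. g n \<omega> * g m \<omega> * cnj (g k \<omega> * g l \<omega>))" by (rule p(1))
  show "(\<integral>\<omega>. g n \<omega> * g m \<omega> * cnj (g k \<omega> * g l \<omega>) \<partial>M) = 0"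
    if "\<not> (n = k \<and> m = l)" "\<not> (n = l \<and> m = k)"
  proof -
    have "a n \<noteq> b n \<or> a m \<noteq> b m" using that by (auto simp: a_def b_def)
    then show ?thesis using p(2)[of n] p(2)[of m] by (auto simp: I_def)
  qed
  note m4 = gaussian_fourth_moment[OF prob_space_axioms gaussian]
  have "norm (\<integral>\<omega>. g n \<omega> * g m \<omega> * cnj (g k \<omega> * g l \<omega>) \<partial>M) \<le> (\<integral>\<omega>. norm (g n \<omega> * g m \<omega> * cnj (g k \<omega> * g l \<omega>)) \<partial>M)"
    by (rule integral_norm_bound)
  also have "\<dots> \<le> (\<integral>\<omega>. ((norm (g n \<omega>)) ^ 4 + (norm (g m \<omega>)) ^ 4 + (norm (g k \<omega>)) ^ 4 + (norm (g l \<omega>)) ^ 4) / 4 \<partial>M)"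
  proof (intro integral_mono integrable_norm int)
    show "integrable M (\<lambda>\<omega>. ((norm (g n \<omega>)) ^ 4 + (norm (g m \<omega>)) ^ 4 + (norm (g k \<omega>)) ^ 4 + (norm (g l \<omega>)) ^ 4) / 4)"
      using m4(1) by (intro integrable_divide Bochner_Integration.integrable_add) auto
    fix \<omega>
    have amgm: "p * q * r * s \<le> (p ^ 4 + q ^ 4 + r ^ 4 + s ^ 4) / 4" for p q r s :: real
    proof -
      have "2 * ((p * q) * (r * s)) \<le> (p * q)\<^sup>2 + (r * s)\<^sup>2" using sum_squares_bound[of "p * q" "r * s"] by simp
      moreover have "2 * (p\<^sup>2 * q\<^sup>2) \<le> p ^ 4 + q ^ 4" "2 * (r\<^sup>2 * s\<^sup>2) \<le> r ^ 4 + s ^ 4"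
        using sum_squares_bound[of "p\<^sup>2" "q\<^sup>2"] sum_squares_bound[of "r\<^sup>2" "s\<^sup>2"] by (simp_all flip: power_mult)
      ultimately show ?thesis by (simp add: power_mult_distrib mult.assoc)
    qed
    show "norm (g n \<omega> * g m \<omega> * cnj (g k \<omega> * g l \<omega>))
        \<le> ((norm (g n \<omega>)) ^ 4 + (norm (g m \<omega>)) ^ 4 + (norm (g k \<omega>)) ^ 4 + (norm (g l \<omega>)) ^ 4) / 4"
      using amgm[of "norm (g n \<omega>)" "norm (g m \<omega>)" "norm (g k \<omega>)" "norm (g l \<omega>)"]
      by (simp add: norm_mult mult.assoc)
  qed
  also have "\<dots> = ((\<integral>\<omega>. (norm (g n \<omega>)) ^ 4 \<partial>M) + (\<integral>\<omega>. (norm (g m \<omega>)) ^ 4 \<partial>M)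
      + (\<integral>\<omega>. (norm (g k \<omega>)) ^ 4 \<partial>M) + (\<integral>\<omega>. (norm (g l \<omega>)) ^ 4 \<partial>M)) / 4"
    using m4(1) by simp
  also have "\<dots> \<le> 16" using m4(2)[of n] m4(2)[of m] m4(2)[of k] m4(2)[of l] by simp
  finally show "norm (\<integral>\<omega>. g n \<omega> * g m \<omega> * cnj (g k \<omega> * g l \<omega>) \<partial>M) \<le> 16" .
qed

text \<open>Since \<open>E g\<^sub>n\<^sup>2 = 0\<close>, only the pairings \<open>{n, m} = {k, l}\<close> survive in the expansion of the square.\<close>

lemma quadratic_chaos_bound:
  fixes B :: "nat \<Rightarrow> nat \<Rightarrow> complex"
  shows "integrable M (\<lambda>\<omega>. (norm (\<Sum>n<K. \<Sum>m<K. B n m * (g n \<omega> * g m \<omega>)))\<^sup>2)"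
    and "(\<integral>\<omega>. (norm (\<Sum>n<K. \<Sum>m<K. B n m * (g n \<omega> * g m \<omega>)))\<^sup>2 \<partial>M) \<le> 32 * (\<Sum>n<K. \<Sum>m<K. (norm (B n m))\<^sup>2)"
proof -
  define X where "X \<omega> = (\<Sum>n<K. \<Sum>m<K. B n m * (g n \<omega> * g m \<omega>))" for \<omega>
  define P where "P = {..<K} \<times> {..<K}"
  have fP: "finite P" by (simp add: P_def)
  define W where "W p q \<omega> = g (fst p) \<omega> * g (snd p) \<omega> * cnj (g (fst q) \<omega> * g (snd q) \<omega>)" for p q \<omega>
  define \<beta> where "\<beta> p = B (fst p) (snd p)" for p
  have XP: "X \<omega> = (\<Sum>p\<in>P. \<beta> p * (g (fst p) \<omega> * g (snd p) \<omega>))" for \<omega>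
    unfolding X_def P_def \<beta>_def by (simp add: sum.cartesian_product case_prod_beta)
  have eq: "complex_of_real ((norm (X \<omega>))\<^sup>2) = (\<Sum>p\<in>P. \<Sum>q\<in>P. (\<beta> p * cnj (\<beta> q)) * W p q \<omega>)" for \<omega>
    unfolding complex_norm_square XP W_def by (simp add: sum_product mult_ac)
  have iW: "integrable M (W p q)" for p q unfolding W_def[abs_def] by (rule quartic_moment(1))
  have i: "integrable M (\<lambda>\<omega>. complex_of_real ((norm (X \<omega>))\<^sup>2))"
    unfolding eq by (intro Bochner_Integration.integrable_sum integrable_mult_right iW)
  then show "integrable M (\<lambda>\<omega>. (norm (\<Sum>n<K. \<Sum>m<K. B n m * (g n \<omega> * g m \<omega>)))\<^sup>2)"
    unfolding X_def[symmetric] by (rule complex_of_real_integrable_eq[THEN iffD1])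
  define sw :: "nat \<times> nat \<Rightarrow> nat \<times> nat" where "sw p = (snd p, fst p)" for p
  have bnd: "norm (integral\<^sup>L M (W p q)) \<le> (if q = p then 16 else 0) + (if q = sw p then 16 else 0)" for p q
  proof (cases "q = p \<or> q = sw p")
    case True
    have "norm (integral\<^sup>L M (W p q)) \<le> 16" unfolding W_def[abs_def] by (rule quartic_moment(3))
    then show ?thesis using True by auto
  next
    case False
    then have "integral\<^sup>L M (W p q) = 0"
      unfolding W_def[abs_def] by (intro quartic_moment(2)) (auto simp: sw_def prod_eq_iff)
    then show ?thesis by simp
  qed
  have swP: "sw p \<in> P" if "p \<in> P" for p using that by (auto simp: sw_def P_def)
  have bij: "(\<Sum>p\<in>P. (norm (\<beta> (sw p)))\<^sup>2) = (\<Sum>p\<in>P. (norm (\<beta> p))\<^sup>2)"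
    by (rule sum.reindex_bij_witness[of _ sw sw]) (auto simp: sw_def P_def)
  have "complex_of_real (\<integral>\<omega>. (norm (X \<omega>))\<^sup>2 \<partial>M) = (\<integral>\<omega>. complex_of_real ((norm (X \<omega>))\<^sup>2) \<partial>M)"
    by (rule integral_complex_of_real[symmetric])
  also have "\<dots> = (\<Sum>p\<in>P. \<Sum>q\<in>P. (\<beta> p * cnj (\<beta> q)) * integral\<^sup>L M (W p q))"
    unfolding eq using iW by (simp add: Bochner_Integration.integral_sum)
  finally have "norm (complex_of_real (\<integral>\<omega>. (norm (X \<omega>))\<^sup>2 \<partial>M))
      = norm (\<Sum>p\<in>P. \<Sum>q\<in>P. (\<beta> p * cnj (\<beta> q)) * integral\<^sup>L M (W p q))"
    by (rule arg_cong)
  moreover have "(\<integral>\<omega>. (norm (X \<omega>))\<^sup>2 \<partial>M) \<ge> 0"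
    by (rule Bochner_Integration.integral_nonneg) simp
  ultimately have "(\<integral>\<omega>. (norm (X \<omega>))\<^sup>2 \<partial>M) = norm (\<Sum>p\<in>P. \<Sum>q\<in>P. (\<beta> p * cnj (\<beta> q)) * integral\<^sup>L M (W p q))"
    by (simp only: norm_of_real abs_of_nonneg)
  also have "\<dots> \<le> (\<Sum>p\<in>P. \<Sum>q\<in>P. norm (\<beta> p) * norm (\<beta> q) * ((if q = p then 16 else 0) + (if q = sw p then 16 else 0)))"
  proof (intro sum_norm_le)
    fix p q
    show "norm ((\<beta> p * cnj (\<beta> q)) * integral\<^sup>L M (W p q))
        \<le> norm (\<beta> p) * norm (\<beta> q) * ((if q = p then 16 else 0) + (if q = sw p then 16 else 0))"
      unfolding norm_mult complex_mod_cnj by (intro mult_left_mono bnd mult_nonneg_nonneg norm_ge_zero)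
  qed
  also have "\<dots> = (\<Sum>p\<in>P. 16 * (norm (\<beta> p))\<^sup>2 + 16 * (norm (\<beta> p) * norm (\<beta> (sw p))))"
  proof (rule sum.cong)
    fix p assume p: "p \<in> P"
    have "(\<Sum>q\<in>P. norm (\<beta> p) * norm (\<beta> q) * ((if q = p then 16 else 0) + (if q = sw p then 16 else 0)))
        = (\<Sum>q\<in>P. if q = p then 16 * (norm (\<beta> p) * norm (\<beta> q)) else 0) + (\<Sum>q\<in>P. if q = sw p then 16 * (norm (\<beta> p) * norm (\<beta> q)) else 0)"
      unfolding sum.distrib[symmetric] by (intro sum.cong) (auto simp: distrib_left)
    also have "\<dots> = 16 * (norm (\<beta> p))\<^sup>2 + 16 * (norm (\<beta> p) * norm (\<beta> (sw p)))"
      using fP p swP[OF p] by (simp add: power2_eq_square)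
    finally show "(\<Sum>q\<in>P. norm (\<beta> p) * norm (\<beta> q) * ((if q = p then 16 else 0) + (if q = sw p then 16 else 0)))
      = 16 * (norm (\<beta> p))\<^sup>2 + 16 * (norm (\<beta> p) * norm (\<beta> (sw p)))" .
  qed simp
  also have "\<dots> \<le> (\<Sum>p\<in>P. 24 * (norm (\<beta> p))\<^sup>2 + 8 * (norm (\<beta> (sw p)))\<^sup>2)"
  proof (rule sum_mono)
    fix p show "16 * (norm (\<beta> p))\<^sup>2 + 16 * (norm (\<beta> p) * norm (\<beta> (sw p))) \<le> 24 * (norm (\<beta> p))\<^sup>2 + 8 * (norm (\<beta> (sw p)))\<^sup>2"
      using sum_squares_bound[of "norm (\<beta> p)" "norm (\<beta> (sw p))"] by simp
  qed
  also have "\<dots> = 32 * (\<Sum>p\<in>P. (norm (\<beta> p))\<^sup>2)"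
    by (simp add: sum.distrib sum_distrib_left[symmetric] bij)
  also have "(\<Sum>p\<in>P. (norm (\<beta> p))\<^sup>2) = (\<Sum>n<K. \<Sum>m<K. (norm (B n m))\<^sup>2)"
    unfolding P_def \<beta>_def by (simp add: sum.cartesian_product case_prod_beta)
  finally show "(\<integral>\<omega>. (norm (\<Sum>n<K. \<Sum>m<K. B n m * (g n \<omega> * g m \<omega>)))\<^sup>2 \<partial>M) \<le> 32 * (\<Sum>n<K. \<Sum>m<K. (norm (B n m))\<^sup>2)"
    unfolding X_def .
qed

text \<open>The \<open>g\<^sub>n\<close> are orthogonal, so after taking expectations only the diagonal of the Gram matrix remains.\<close>

lemma linear_chaos_bound:
  fixes w :: "real \<Rightarrow> real"
  assumes w: "w \<in> borel_measurable borel" "\<And>x. 0 \<le> w x" "\<And>x. w x \<le> 1" and A: "finite A"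
  shows "(\<integral>\<^sup>+\<omega>. ennreal (\<integral>x. (norm (hermite_partial (\<lambda>n. c n * g n \<omega>) A x))\<^sup>2 * w x \<partial>lborel) \<partial>M)
    \<le> ennreal (17 * (\<Sum>n\<in>A. (norm (c n))\<^sup>2 * (\<integral>x. (hermite_fun n x)\<^sup>2 * w x \<partial>lborel)))"
proof -
  define G where "G n m = (\<integral>x. hermite_fun n x * hermite_fun m x * w x \<partial>lborel)" for n m
  have G0: "G n n \<ge> 0" for n
    unfolding G_def using w(2) by (intro Bochner_Integration.integral_nonneg) (simp add: mult_nonneg_nonneg)
  define V where "V \<omega> = (\<integral>x. (norm (hermite_partial (\<lambda>n. c n * g n \<omega>) A x))\<^sup>2 * w x \<partial>lborel)" for \<omega>
  have V0: "V \<omega> \<ge> 0" for \<omega>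
    unfolding V_def using w(2) by (intro Bochner_Integration.integral_nonneg) simp
  have eq: "complex_of_real (V \<omega>)
      = (\<Sum>n\<in>A. \<Sum>m\<in>A. (c n * cnj (c m) * complex_of_real (G n m)) * (g n \<omega> * cnj (g m \<omega>)))" for \<omega>
    unfolding V_def hermite_partial_norm_integral(2)[OF w] G_def by (intro sum.cong refl) simp
  have i: "integrable M (\<lambda>\<omega>. complex_of_real (V \<omega>))"
    unfolding eq by (intro Bochner_Integration.integrable_sum integrable_mult_right pair_moment(1))
  then have iV: "integrable M V"
    by (rule complex_of_real_integrable_eq[THEN iffD1])
  have "complex_of_real (\<integral>\<omega>. V \<omega> \<partial>M) = (\<integral>\<omega>. complex_of_real (V \<omega>) \<partial>M)"
    by (rule integral_complex_of_real[symmetric])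
  also have "\<dots> = (\<Sum>n\<in>A. \<Sum>m\<in>A. (c n * cnj (c m) * complex_of_real (G n m)) * (\<integral>\<omega>. g n \<omega> * cnj (g m \<omega>) \<partial>M))"
    unfolding eq using pair_moment(1) by (simp add: Bochner_Integration.integral_sum)
  also have "\<dots> = (\<Sum>n\<in>A. \<Sum>m\<in>A. if m = n then (c n * cnj (c n) * complex_of_real (G n n)) * (\<integral>\<omega>. g n \<omega> * cnj (g n \<omega>) \<partial>M) else 0)"
    using pair_moment(2) by (intro sum.cong refl) auto
  also have "\<dots> = (\<Sum>n\<in>A. (c n * cnj (c n) * complex_of_real (G n n)) * (\<integral>\<omega>. g n \<omega> * cnj (g n \<omega>) \<partial>M))"
    using A by simp
  finally have "norm (complex_of_real (\<integral>\<omega>. V \<omega> \<partial>M))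
      = norm (\<Sum>n\<in>A. (c n * cnj (c n) * complex_of_real (G n n)) * (\<integral>\<omega>. g n \<omega> * cnj (g n \<omega>) \<partial>M))"
    by (rule arg_cong)
  moreover have "(\<integral>\<omega>. V \<omega> \<partial>M) \<ge> 0" using V0 by (rule Bochner_Integration.integral_nonneg)
  ultimately have "(\<integral>\<omega>. V \<omega> \<partial>M)
      = norm (\<Sum>n\<in>A. (c n * cnj (c n) * complex_of_real (G n n)) * (\<integral>\<omega>. g n \<omega> * cnj (g n \<omega>) \<partial>M))"
    by (simp only: norm_of_real abs_of_nonneg)
  also have "\<dots> \<le> (\<Sum>n\<in>A. ((norm (c n))\<^sup>2 * G n n) * 17)"
  proof (intro sum_norm_le)
    fix n
    show "norm ((c n * cnj (c n) * complex_of_real (G n n)) * (\<integral>\<omega>. g n \<omega> * cnj (g n \<omega>) \<partial>M)) \<le> ((norm (c n))\<^sup>2 * G n n) * 17"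
      unfolding norm_mult complex_mod_cnj norm_of_real power2_eq_square abs_of_nonneg[OF G0]
      unfolding norm_mult[symmetric] using G0 pair_moment(3) by (intro mult_left_mono) auto
  qed
  also have "\<dots> = 17 * (\<Sum>n\<in>A. (norm (c n))\<^sup>2 * (\<integral>x. (hermite_fun n x)\<^sup>2 * w x \<partial>lborel))"
    unfolding G_def by (simp add: sum_distrib_left power2_eq_square mult_ac)
  finally have le: "(\<integral>\<omega>. V \<omega> \<partial>M) \<le> 17 * (\<Sum>n\<in>A. (norm (c n))\<^sup>2 * (\<integral>x. (hermite_fun n x)\<^sup>2 * w x \<partial>lborel))" .
  have "(\<integral>\<^sup>+\<omega>. ennreal (V \<omega>) \<partial>M) = ennreal (\<integral>\<omega>. V \<omega> \<partial>M)"
    using iV V0 by (intro nn_integral_eq_integral) auto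
  also have "\<dots> \<le> ennreal (17 * (\<Sum>n\<in>A. (norm (c n))\<^sup>2 * (\<integral>x. (hermite_fun n x)\<^sup>2 * w x \<partial>lborel)))"
    by (rule ennreal_leI[OF le])
  finally show ?thesis unfolding V_def .
qed

lemma square_norm_moment: "(\<integral>\<^sup>+\<omega>. ennreal ((norm (g n \<omega>))\<^sup>2) \<partial>M) \<le> 17"
proof -
  have eq: "complex_of_real ((norm (g n \<omega>))\<^sup>2) = g n \<omega> * cnj (g n \<omega>)" for \<omega>
    by (rule complex_norm_square)
  have i: "integrable M (\<lambda>\<omega>. (norm (g n \<omega>))\<^sup>2)"
    using pair_moment(1)[of n n] unfolding eq[symmetric] by (rule complex_of_real_integrable_eq[THEN iffD1])
  have "(\<integral>\<omega>. (norm (g n \<omega>))\<^sup>2 \<partial>M) \<le> norm (complex_of_real (\<integral>\<omega>. (norm (g n \<omega>))\<^sup>2 \<partial>M))"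
    by (simp only: norm_of_real abs_ge_self)
  also have "\<dots> \<le> 17"
    using pair_moment(3)[of n n] unfolding eq[symmetric] integral_complex_of_real .
  finally have "ennreal (\<integral>\<omega>. (norm (g n \<omega>))\<^sup>2 \<partial>M) \<le> ennreal 17" by (rule ennreal_leI)
  then show ?thesis
    using i by (subst nn_integral_eq_integral) auto
qed

end

lemma hermite_square_expand:
  "(\<integral>x. (hermite_partial d {..<K} x)\<^sup>2 * hermite_cfun k x \<partial>lborel)
    = (\<Sum>n<K. \<Sum>m<K. d n * d m * hermite_triple n m k)"
proof -
  have i: "integrable lborel (\<lambda>x. hermite_cfun n x * hermite_cfun m x * hermite_cfun k x)" for n m
    using integrable_hermite_mult[OF _ schwartz_L2(1)[OF schwartz_hermite_mult]]
      schwartz_measurable0(1)[OF schwartz_hermite_mult] by simp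
  have "(hermite_partial d {..<K} x)\<^sup>2 * hermite_cfun k x
      = (\<Sum>n<K. \<Sum>m<K. d n * d m * (hermite_cfun n x * hermite_cfun m x * hermite_cfun k x))" for x
    unfolding hermite_partial_def power2_eq_square sum_product sum_distrib_right
    by (intro sum.cong refl) (simp add: sum_distrib_left mult_ac)
  then show ?thesis
    unfolding hermite_triple_def hermite_coeff_def using i by (simp add: Bochner_Integration.integral_sum)
qed

text \<open>The three conditions on the coefficients that put the square into the Sobolev space, combined into
  one functional. Being measurable in the coefficients, it has a measurable set of finiteness, and
  its expectation can be computed term by term.\<close>

definition hermite_control :: "(nat \<Rightarrow> nat) \<Rightarrow> real \<Rightarrow> (nat \<Rightarrow> complex) \<Rightarrow> ennreal" where
  "hermite_control N \<theta> d = (\<Sum>n. ennreal ((norm (d n))\<^sup>2 / (2 * real n + 1)))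
    + (\<Sum>j. \<integral>\<^sup>+x. ennreal (2 ^ j * ((norm (hermite_partial d {N j..<N (Suc j)} x))\<^sup>2 * japanese_weight x)) \<partial>lborel)
    + liminf (\<lambda>j. ennreal (hermite_square_energy \<theta> d (N j)))"

lemma hermite_control_zero: "hermite_control N \<theta> (\<lambda>n. 0) = 0"
  by (simp add: hermite_control_def hermite_partial_def hermite_square_energy_def Liminf_const)

lemma hermite_control_finite:
  assumes "strict_mono N" "N 0 = 0" "hermite_control N \<theta> d < \<infinity>"
    and "\<And>\<phi>. T \<phi> = (\<Sum>n. d n * regular (hermite_cfun n) \<phi>)"
  shows "\<exists>v. has_square T v \<and> sobolev_norm \<theta> v < \<infinity>"
proof (rule square_in_sobolev_space[OF assms(1,2) _ _ _ assms(4)])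
  have fin: "(\<Sum>n. ennreal ((norm (d n))\<^sup>2 / (2 * real n + 1))) < \<infinity>"
    "(\<Sum>j. \<integral>\<^sup>+x. ennreal (2 ^ j * ((norm (hermite_partial d {N j..<N (Suc j)} x))\<^sup>2 * japanese_weight x)) \<partial>lborel) < \<infinity>"
    "liminf (\<lambda>j. ennreal (hermite_square_energy \<theta> d (N j))) < \<infinity>"
    using assms(3) by (auto simp: hermite_control_def)
  show "summable (\<lambda>n. (norm (d n))\<^sup>2 / (2 * real n + 1))"
    using fin(1) by (intro summable_suminf_not_top) auto
  show "(\<Sum>j. \<integral>\<^sup>+x. ennreal (2 ^ j * ((norm (hermite_partial d {N j..<N (Suc j)} x))\<^sup>2 * japanese_weight x)) \<partial>lborel) < \<infinity>"
    by (rule fin(2))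
  show "liminf (\<lambda>j. ennreal (hermite_square_energy \<theta> d (N j))) < \<infinity>"
    by (rule fin(3))
qed

lemma block_nn_integral:
  "(\<integral>\<^sup>+x. ennreal (2 ^ j * ((norm (hermite_partial d A x))\<^sup>2 * japanese_weight x)) \<partial>lborel)
    = ennreal (2 ^ j * (\<integral>x. (norm (hermite_partial d A x))\<^sup>2 * japanese_weight x \<partial>lborel))"
proof -
  have "integrable lborel (\<lambda>x. (norm (hermite_partial d A x))\<^sup>2 * japanese_weight x)"
    by (rule hermite_partial_norm_integral(1)) (auto simp: japanese_weight_le_1)
  then show ?thesis
    by (subst nn_integral_eq_integral) auto
qed

lemma block_norm_measurable [measurable (raw)]:
  assumes [measurable]: "\<And>n. (\<lambda>\<omega>. d \<omega> n) \<in> borel_measurable M"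
  shows "(\<lambda>\<omega>. \<integral>x. (norm (hermite_partial (d \<omega>) A x))\<^sup>2 * japanese_weight x \<partial>lborel) \<in> borel_measurable M"
proof -
  have W: "(\<integral>x. (norm (hermite_partial (d \<omega>) A x))\<^sup>2 * japanese_weight x \<partial>lborel)
      = Re (\<Sum>n\<in>A. \<Sum>m\<in>A. d \<omega> n * cnj (d \<omega> m) * complex_of_real (\<integral>x. hermite_fun n x * hermite_fun m x * japanese_weight x \<partial>lborel))"
    for \<omega>
    by (subst hermite_partial_norm_integral(2)[symmetric]) (auto simp: japanese_weight_le_1)
  show ?thesis unfolding W by measurable
qed

lemma hermite_square_energy_measurable [measurable (raw)]:
  assumes [measurable]: "\<And>n. (\<lambda>\<omega>. d \<omega> n) \<in> borel_measurable M"
  shows "(\<lambda>\<omega>. hermite_square_energy \<theta> (d \<omega>) K) \<in> borel_measurable M"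
  unfolding hermite_square_energy_def hermite_square_expand by measurable

lemma hermite_control_measurable [measurable (raw)]:
  assumes [measurable]: "\<And>n. (\<lambda>\<omega>. d \<omega> n) \<in> borel_measurable M"
  shows "(\<lambda>\<omega>. hermite_control N \<theta> (d \<omega>)) \<in> borel_measurable M"
  unfolding hermite_control_def block_nn_integral by measurable

section \<open>Almost sure finiteness\<close>

text \<open>All three terms have finite expectation: the first two by orthogonality, the third by Fatou's lemma
  and the bound for quadratic forms, which reduces it to the summability of the norms of the products
  \<open>h\<^sub>n h\<^sub>m\<close>.\<close>

lemma (in gaussian_sequence) AE_hermite_control_finite:
  fixes c :: "nat \<Rightarrow> complex"
  assumes c: "\<And>n. (norm (c n))\<^sup>2 = 2 / (2 * real n + 1)" and \<theta>: "\<theta> < 1/2"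
    and N: "summable (\<lambda>j. 2 ^ j * (\<Sum>n\<in>{N j..<N (Suc j)}.
      (norm (c n))\<^sup>2 * (\<integral>x. (hermite_fun n x)\<^sup>2 * japanese_weight x \<partial>lborel)))"
  shows "AE \<omega> in M. hermite_control N \<theta> (\<lambda>n. c n * g n \<omega>) < \<infinity>"
proof -
  define d where "d \<omega> n = c n * g n \<omega>" for \<omega> n
  have [measurable]: "(\<lambda>\<omega>. d \<omega> n) \<in> borel_measurable M" for n
    unfolding d_def by measurable
  have 1: "(\<integral>\<^sup>+\<omega>. (\<Sum>n. ennreal ((norm (d \<omega> n))\<^sup>2 / (2 * real n + 1))) \<partial>M) < \<infinity>"
  proof -
    have "(\<integral>\<^sup>+\<omega>. (\<Sum>n. ennreal ((norm (d \<omega> n))\<^sup>2 / (2 * real n + 1))) \<partial>M)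
        = (\<Sum>n. \<integral>\<^sup>+\<omega>. ennreal ((norm (d \<omega> n))\<^sup>2 / (2 * real n + 1)) \<partial>M)"
      by (rule nn_integral_suminf) measurable
    also have "\<dots> \<le> (\<Sum>n. ennreal (34 * inverse ((real (Suc n))\<^sup>2)))"
    proof (intro suminf_le summableI)
      fix n
      have *: "(norm (d \<omega> n))\<^sup>2 / (2 * real n + 1) = 2 / (2 * real n + 1)\<^sup>2 * (norm (g n \<omega>))\<^sup>2" for \<omega>
        by (simp add: d_def norm_mult power_mult_distrib c) (simp add: power2_eq_square)
      have "(\<integral>\<^sup>+\<omega>. ennreal ((norm (d \<omega> n))\<^sup>2 / (2 * real n + 1)) \<partial>M)
          = (\<integral>\<^sup>+\<omega>. ennreal (2 / (2 * real n + 1)\<^sup>2) * ennreal ((norm (g n \<omega>))\<^sup>2) \<partial>M)"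
        unfolding * by (intro nn_integral_cong ennreal_mult) auto
      also have "\<dots> = ennreal (2 / (2 * real n + 1)\<^sup>2) * (\<integral>\<^sup>+\<omega>. ennreal ((norm (g n \<omega>))\<^sup>2) \<partial>M)"
        by (rule nn_integral_cmult) measurable
      also have "\<dots> \<le> ennreal (2 / (2 * real n + 1)\<^sup>2) * ennreal 17"
        using square_norm_moment[of n] by (intro mult_left_mono) auto
      also have "\<dots> = ennreal (34 / (2 * real n + 1)\<^sup>2)"
        by (subst ennreal_mult[symmetric]) auto
      also have "\<dots> \<le> ennreal (34 * inverse ((real (Suc n))\<^sup>2))"
      proof (rule ennreal_leI)
        have "34 / (2 * real n + 1)\<^sup>2 \<le> 34 / (real (Suc n))\<^sup>2"
          by (intro divide_left_mono power_mono mult_pos_pos zero_less_power) auto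
        then show "34 / (2 * real n + 1)\<^sup>2 \<le> 34 * inverse ((real (Suc n))\<^sup>2)"
          by (simp only: divide_inverse)
      qed
      finally show "(\<integral>\<^sup>+\<omega>. ennreal ((norm (d \<omega> n))\<^sup>2 / (2 * real n + 1)) \<partial>M) \<le> ennreal (34 * inverse ((real (Suc n))\<^sup>2))" .
    qed
    also have "\<dots> < \<infinity>"
    proof -
      have "summable (\<lambda>n. 34 * inverse ((real (Suc n))\<^sup>2))"
        by (intro summable_mult summable_Suc_iff[THEN iffD2] inverse_power_summable) simp
      then show ?thesis by (subst suminf_ennreal2) auto
    qed
    finally show ?thesis .
  qed
  have 2: "(\<integral>\<^sup>+\<omega>. (\<Sum>j. ennreal (2 ^ j * (\<integral>x. (norm (hermite_partial (d \<omega>) {N j..<N (Suc j)} x))\<^sup>2 * japanese_weight x \<partial>lborel))) \<partial>M) < \<infinity>"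
  proof -
    define a where "a n = (norm (c n))\<^sup>2 * (\<integral>x. (hermite_fun n x)\<^sup>2 * japanese_weight x \<partial>lborel)" for n
    have a: "a n \<ge> 0" for n
      unfolding a_def by (intro mult_nonneg_nonneg Bochner_Integration.integral_nonneg) auto
    have "(\<integral>\<^sup>+\<omega>. (\<Sum>j. ennreal (2 ^ j * (\<integral>x. (norm (hermite_partial (d \<omega>) {N j..<N (Suc j)} x))\<^sup>2 * japanese_weight x \<partial>lborel))) \<partial>M)
       = (\<Sum>j. \<integral>\<^sup>+\<omega>. ennreal (2 ^ j * (\<integral>x. (norm (hermite_partial (d \<omega>) {N j..<N (Suc j)} x))\<^sup>2 * japanese_weight x \<partial>lborel)) \<partial>M)"
      by (rule nn_integral_suminf) measurable
    also have "\<dots> \<le> (\<Sum>j. ennreal (17 * (2 ^ j * (\<Sum>n\<in>{N j..<N (Suc j)}. a n))))"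
    proof (intro suminf_le summableI)
      fix j
      define A where "A = {N j..<N (Suc j)}"
      have "(\<integral>\<^sup>+\<omega>. ennreal (2 ^ j * (\<integral>x. (norm (hermite_partial (d \<omega>) A x))\<^sup>2 * japanese_weight x \<partial>lborel)) \<partial>M)
          = (\<integral>\<^sup>+\<omega>. ennreal (2 ^ j) * ennreal (\<integral>x. (norm (hermite_partial (d \<omega>) A x))\<^sup>2 * japanese_weight x \<partial>lborel) \<partial>M)"
        by (intro nn_integral_cong ennreal_mult Bochner_Integration.integral_nonneg) auto
      also have "\<dots> = ennreal (2 ^ j) * (\<integral>\<^sup>+\<omega>. ennreal (\<integral>x. (norm (hermite_partial (d \<omega>) A x))\<^sup>2 * japanese_weight x \<partial>lborel) \<partial>M)"
        by (rule nn_integral_cmult) measurable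
      also have "\<dots> \<le> ennreal (2 ^ j) * ennreal (17 * (\<Sum>n\<in>A. a n))"
        unfolding d_def[abs_def] a_def
        by (intro mult_left_mono linear_chaos_bound) (auto simp: japanese_weight_le_1 A_def)
      also have "\<dots> = ennreal (17 * (2 ^ j * (\<Sum>n\<in>A. a n)))"
        using a by (subst ennreal_mult[symmetric]) (auto simp: mult_ac intro!: sum_nonneg)
      finally show "(\<integral>\<^sup>+\<omega>. ennreal (2 ^ j * (\<integral>x. (norm (hermite_partial (d \<omega>) {N j..<N (Suc j)} x))\<^sup>2 * japanese_weight x \<partial>lborel)) \<partial>M)
          \<le> ennreal (17 * (2 ^ j * (\<Sum>n\<in>{N j..<N (Suc j)}. a n)))"
        unfolding A_def .
    qed
    also have "\<dots> < \<infinity>"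
    proof -
      have "summable (\<lambda>j. 17 * (2 ^ j * (\<Sum>n\<in>{N j..<N (Suc j)}. a n)))"
        using N unfolding a_def by (rule summable_mult)
      then show ?thesis using a by (subst suminf_ennreal2) (auto intro!: mult_nonneg_nonneg sum_nonneg)
    qed
    finally show ?thesis .
  qed
  have 3: "(\<integral>\<^sup>+\<omega>. liminf (\<lambda>j. ennreal (hermite_square_energy \<theta> (d \<omega>) (N j))) \<partial>M) < \<infinity>"
  proof -
    obtain B where B: "\<And>N K. (\<Sum>n<N. \<Sum>m<N. (\<Sum>k<K. (2 * real k + 1) powr \<theta> * (norm (hermite_triple n m k))\<^sup>2)
      / ((2 * real n + 1) * (2 * real m + 1))) \<le> B"
      using hermite_product_norms_summable[OF \<theta>] by blast
    have E: "(\<integral>\<^sup>+\<omega>. ennreal (hermite_square_energy \<theta> (d \<omega>) K) \<partial>M) \<le> ennreal (128 * B)" for K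
    proof -
      define X where "X k \<omega> = (norm (\<Sum>n<K. \<Sum>m<K. (c n * c m * hermite_triple n m k) * (g n \<omega> * g m \<omega>)))\<^sup>2" for k \<omega>
      have en: "hermite_square_energy \<theta> (d \<omega>) K = (\<Sum>k<K. (2 * real k + 1) powr \<theta> * X k \<omega>)" for \<omega>
        unfolding hermite_square_energy_def hermite_square_expand X_def d_def by (simp only: mult_ac)
      have iX: "integrable M (X k)" for k
        unfolding X_def[abs_def] by (rule quadratic_chaos_bound(1))
      have "(\<integral>\<omega>. hermite_square_energy \<theta> (d \<omega>) K \<partial>M) = (\<Sum>k<K. (2 * real k + 1) powr \<theta> * (\<integral>\<omega>. X k \<omega> \<partial>M))"
        unfolding en using iX by (simp add: Bochner_Integration.integral_sum)
      also have "\<dots> \<le> (\<Sum>k<K. (2 * real k + 1) powr \<theta> * (32 * (\<Sum>n<K. \<Sum>m<K. (norm (c n * c m * hermite_triple n m k))\<^sup>2)))"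
        unfolding X_def[abs_def] by (intro sum_mono mult_left_mono quadratic_chaos_bound(2)) auto
      also have "\<dots> = (\<Sum>k<K. \<Sum>n<K. \<Sum>m<K. 128 * ((2 * real k + 1) powr \<theta> * (norm (hermite_triple n m k))\<^sup>2 / ((2 * real n + 1) * (2 * real m + 1))))"
      proof -
        have "(norm (c n * c m * hermite_triple n m k))\<^sup>2 = 4 * ((norm (hermite_triple n m k))\<^sup>2 / ((2 * real n + 1) * (2 * real m + 1)))" for n m k
          by (simp add: norm_mult power_mult_distrib c)
        then show ?thesis by (simp add: sum_distrib_left mult_ac)
      qed
      also have "\<dots> = (\<Sum>n<K. \<Sum>k<K. \<Sum>m<K. 128 * ((2 * real k + 1) powr \<theta> * (norm (hermite_triple n m k))\<^sup>2 / ((2 * real n + 1) * (2 * real m + 1))))"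
        by (rule sum.swap)
      also have "\<dots> = (\<Sum>n<K. \<Sum>m<K. \<Sum>k<K. 128 * ((2 * real k + 1) powr \<theta> * (norm (hermite_triple n m k))\<^sup>2 / ((2 * real n + 1) * (2 * real m + 1))))"
        by (intro sum.cong refl sum.swap)
      also have "\<dots> = 128 * (\<Sum>n<K. \<Sum>m<K. (\<Sum>k<K. (2 * real k + 1) powr \<theta> * (norm (hermite_triple n m k))\<^sup>2)
          / ((2 * real n + 1) * (2 * real m + 1)))"
        unfolding sum_divide_distrib sum_distrib_left ..
      also have "\<dots> \<le> 128 * B" using B by (intro mult_left_mono) auto
      finally have le: "(\<integral>\<omega>. hermite_square_energy \<theta> (d \<omega>) K \<partial>M) \<le> 128 * B" .
      have "integrable M (\<lambda>\<omega>. hermite_square_energy \<theta> (d \<omega>) K)"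
        unfolding en by (intro Bochner_Integration.integrable_sum integrable_mult_right iX)
      then have "(\<integral>\<^sup>+\<omega>. ennreal (hermite_square_energy \<theta> (d \<omega>) K) \<partial>M) = ennreal (\<integral>\<omega>. hermite_square_energy \<theta> (d \<omega>) K \<partial>M)"
        by (intro nn_integral_eq_integral) (auto simp: en X_def intro!: sum_nonneg)
      then show ?thesis using ennreal_leI[OF le] by simp
    qed
    have "(\<integral>\<^sup>+\<omega>. liminf (\<lambda>j. ennreal (hermite_square_energy \<theta> (d \<omega>) (N j))) \<partial>M)
        \<le> liminf (\<lambda>j. \<integral>\<^sup>+\<omega>. ennreal (hermite_square_energy \<theta> (d \<omega>) (N j)) \<partial>M)"
      by (rule nn_integral_liminf) measurable
    also have "\<dots> \<le> liminf (\<lambda>j. ennreal (128 * B))"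
      using E by (intro Liminf_mono always_eventually) auto
    also have "\<dots> = ennreal (128 * B)" by (simp add: Liminf_const)
    also have "\<dots> < \<infinity>" by simp
    finally show ?thesis .
  qed
  have "(\<integral>\<^sup>+\<omega>. hermite_control N \<theta> (d \<omega>) \<partial>M)
    = (\<integral>\<^sup>+\<omega>. (\<Sum>n. ennreal ((norm (d \<omega> n))\<^sup>2 / (2 * real n + 1))) \<partial>M)
    + (\<integral>\<^sup>+\<omega>. (\<Sum>j. ennreal (2 ^ j * (\<integral>x. (norm (hermite_partial (d \<omega>) {N j..<N (Suc j)} x))\<^sup>2 * japanese_weight x \<partial>lborel))) \<partial>M)
    + (\<integral>\<^sup>+\<omega>. liminf (\<lambda>j. ennreal (hermite_square_energy \<theta> (d \<omega>) (N j))) \<partial>M)"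
    unfolding hermite_control_def block_nn_integral
    by (subst nn_integral_add; (subst nn_integral_add)?; measurable)
  also have "\<dots> < \<infinity>" using 1 2 3 by (simp add: ennreal_add_less_top)
  finally have "(\<integral>\<^sup>+\<omega>. hermite_control N \<theta> (d \<omega>) \<partial>M) \<noteq> \<infinity>" by simp
  then have "AE \<omega> in M. hermite_control N \<theta> (d \<omega>) \<noteq> \<infinity>"
    by (intro nn_integral_PInf_AE) measurable
  then show ?thesis
    unfolding d_def[abs_def] by eventually_elim (simp add: less_top)
qed

lemma hermite_weights_summable:
  assumes "\<And>n. (norm (c n))\<^sup>2 = 2 / (2 * real n + 1)"
  shows "summable (\<lambda>n. (norm (c n))\<^sup>2 * (\<integral>x. (hermite_fun n x)\<^sup>2 * japanese_weight x \<partial>lborel))"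
proof -
  obtain C where C: "\<And>N x. (\<Sum>n<N. (hermite_fun n x)\<^sup>2 / (2 * real n + 1)) \<le> C"
    using hermite_inverse_weighted_bounded by blast
  have i: "integrable lborel (\<lambda>x. (hermite_fun n x)\<^sup>2 * japanese_weight x)" for n
    using hermite_partial_norm_integral(1)[of japanese_weight "\<lambda>_. 1" "{n}"]
    by (simp add: hermite_partial_def japanese_weight_le_1)
  show ?thesis
  proof (rule summableI_nonneg_bounded)
    fix n
    show "0 \<le> (norm (c n))\<^sup>2 * (\<integral>x. (hermite_fun n x)\<^sup>2 * japanese_weight x \<partial>lborel)"
      by (intro mult_nonneg_nonneg Bochner_Integration.integral_nonneg) auto
    have "(\<Sum>n<n. (norm (c n))\<^sup>2 * (\<integral>x. (hermite_fun n x)\<^sup>2 * japanese_weight x \<partial>lborel))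
        = (\<integral>x. (\<Sum>n<n. (norm (c n))\<^sup>2 * ((hermite_fun n x)\<^sup>2 * japanese_weight x)) \<partial>lborel)"
      using i by (simp add: Bochner_Integration.integral_sum)
    also have "\<dots> \<le> (\<integral>x. (2 * C) * japanese_weight x \<partial>lborel)"
    proof (intro integral_mono Bochner_Integration.integrable_sum integrable_mult_right i integrable_japanese_weight)
      fix x
      have "(\<Sum>n<n. (norm (c n))\<^sup>2 * ((hermite_fun n x)\<^sup>2 * japanese_weight x))
          = 2 * (\<Sum>n<n. (hermite_fun n x)\<^sup>2 / (2 * real n + 1)) * japanese_weight x"
        unfolding assms sum_distrib_left sum_distrib_right by (intro sum.cong) auto
      also have "\<dots> \<le> (2 * C) * japanese_weight x"
        using C by (intro mult_right_mono mult_left_mono) auto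
      finally show "(\<Sum>n<n. (norm (c n))\<^sup>2 * ((hermite_fun n x)\<^sup>2 * japanese_weight x)) \<le> (2 * C) * japanese_weight x" .
    qed
    finally show "(\<Sum>n<n. (norm (c n))\<^sup>2 * (\<integral>x. (hermite_fun n x)\<^sup>2 * japanese_weight x \<partial>lborel))
      \<le> (\<integral>x. (2 * C) * japanese_weight x \<partial>lborel)" .
  qed
qed

section \<open>Hermite coefficients on Sobolev spaces\<close>

text \<open>The coefficient functionals are bounded on \<open>\<H>\<^sup>s\<close>, by Bessel's inequality for the function that
  represents \<open>H\<^bsup>s/2\<^esup> T\<close>.\<close>

lemma sobolev_coeff_bound:
  assumes "sobolev_norm s T < ennreal r"
  shows "(2 * real n + 1) powr (s / 2) * norm (T (hermite_cfun n)) < r"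
proof -
  obtain f where f: "represents f (H_power (s / 2) T)" "integrable lborel (\<lambda>x. (norm (f x))\<^sup>2)"
    "ennreal (sqrt (\<integral>x. (norm (f x))\<^sup>2 \<partial>lborel)) < ennreal r"
    using assms unfolding sobolev_norm_def L2_norm_def Inf_less_iff by blast
  have fm: "f \<in> borel_measurable lborel" using f(1) by (simp add: represents_def)
  have "H_power (s / 2) T (hermite_cfun n)
      = (\<Sum>m. complex_of_real ((2 * real m + 1) powr (s / 2)) * T (hermite_cfun m) * (if n = m then 1 else 0))"
    by (simp add: H_power_def H_calculus_def hermite_freq_square regular_hermite[OF schwartz_hermite] hermite_orthonormal)
  also have "\<dots> = (\<Sum>m\<in>{n}. complex_of_real ((2 * real m + 1) powr (s / 2)) * T (hermite_cfun m) * (if n = m then 1 else 0))"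
    by (rule suminf_finite) auto
  finally have "complex_of_real ((2 * real n + 1) powr (s / 2)) * T (hermite_cfun n) = H_power (s / 2) T (hermite_cfun n)"
    by simp
  also have "\<dots> = hermite_coeff f n"
    using f(1) schwartz_hermite by (simp add: represents_def regular_def hermite_coeff_def)
  finally have "(2 * real n + 1) powr (s / 2) * norm (T (hermite_cfun n)) = norm (hermite_coeff f n)"
    by (metis norm_mult norm_of_real abs_of_nonneg powr_ge_zero)
  also have "\<dots> \<le> sqrt (\<integral>x. (norm (f x))\<^sup>2 \<partial>lborel)"
  proof (rule real_le_rsqrt)
    have "(norm (hermite_coeff f n))\<^sup>2 \<le> (\<Sum>k<Suc n. (norm (hermite_coeff f k))\<^sup>2)"
      by (rule member_le_sum) auto
    also have "\<dots> \<le> (\<integral>x. (norm (f x))\<^sup>2 \<partial>lborel)"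
      by (rule hermite_bessel[OF fm f(2)])
    finally show "(norm (hermite_coeff f n))\<^sup>2 \<le> (\<integral>x. (norm (f x))\<^sup>2 \<partial>lborel)" .
  qed
  also have "\<dots> < r"
    using f(3) by (subst (asm) ennreal_less_iff) (auto intro!: Bochner_Integration.integral_nonneg)
  finally show ?thesis .
qed

lemma space_sobolev_borel: "space (sobolev_borel s) = sobolev_space s"
  unfolding sobolev_borel_def by (rule space_measure_of) (auto simp: sobolev_open_def)

lemma sobolev_coeff_measurable: "(\<lambda>u. u (hermite_cfun n)) \<in> borel_measurable (sobolev_borel s)"
proof (rule borel_measurableI)
  fix V :: "complex set" assume V: "open V"
  define U where "U = {u \<in> sobolev_space s. u (hermite_cfun n) \<in> V}"
  define q where "q = (2 * real n + 1) powr (s / 2)"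
  have q: "q > 0" by (simp add: q_def)
  have "sobolev_open s U"
    unfolding sobolev_open_def
  proof (intro conjI ballI)
    show "U \<subseteq> sobolev_space s" by (auto simp: U_def)
    fix T assume T: "T \<in> U"
    then have "T (hermite_cfun n) \<in> V" by (simp add: U_def)
    then obtain e where e: "e > 0" "ball (T (hermite_cfun n)) e \<subseteq> V"
      using V[unfolded open_contains_ball] by blast
    show "\<exists>r>0. {S \<in> sobolev_space s. sobolev_dist s T S < r} \<subseteq> U"
    proof (intro exI conjI)
      show "ennreal (q * e) > 0" using q e by simp
      show "{S \<in> sobolev_space s. sobolev_dist s T S < ennreal (q * e)} \<subseteq> U"
      proof safe
        fix S assume S: "S \<in> sobolev_space s" "sobolev_dist s T S < ennreal (q * e)"
        have "q * norm (T (hermite_cfun n) - S (hermite_cfun n)) < q * e"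
          using sobolev_coeff_bound[OF S(2)[unfolded sobolev_dist_def], of n] by (simp add: q_def)
        then have "S (hermite_cfun n) \<in> ball (T (hermite_cfun n)) e"
          using q by (simp add: dist_norm)
        then show "S \<in> U" using e S by (auto simp: U_def)
      qed
    qed
  qed
  then have "U \<in> sets (sobolev_borel s)"
    unfolding sobolev_borel_def by (intro in_measure_of) (auto simp: sobolev_open_def)
  moreover have "(\<lambda>u. u (hermite_cfun n)) -` V \<inter> space (sobolev_borel s) = U"
    by (auto simp: U_def space_sobolev_borel)
  ultimately show "(\<lambda>u. u (hermite_cfun n)) -` V \<inter> space (sobolev_borel s) \<in> sets (sobolev_borel s)"
    by simp
qed

lemma hermite_sums_coeff:
  assumes "hermite_sums s c T"
  shows "T (hermite_cfun n) = c n"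
proof -
  define q where "q = (2 * real n + 1) powr (s / 2)"
  have q: "q > 0" by (simp add: q_def)
  have "norm (c n - T (hermite_cfun n)) \<le> e" if e: "e > 0" for e
  proof -
    have "(\<lambda>N. sobolev_dist s (regular (\<lambda>x. \<Sum>n<N. c n * hermite_cfun n x)) T) \<longlonglongrightarrow> 0"
      using assms by (simp add: hermite_sums_def)
    then have "eventually (\<lambda>N. sobolev_dist s (regular (\<lambda>x. \<Sum>n<N. c n * hermite_cfun n x)) T < ennreal (q * e)) sequentially"
      using q e by (intro order_tendstoD(2)) auto
    then obtain N0 where N0: "\<And>N. N \<ge> N0 \<Longrightarrow>
        sobolev_dist s (regular (\<lambda>x. \<Sum>n<N. c n * hermite_cfun n x)) T < ennreal (q * e)"
      by (auto simp: eventually_sequentially)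
    define N where "N = max N0 (Suc n)"
    have "regular (\<lambda>x. \<Sum>n<N. c n * hermite_cfun n x) (hermite_cfun n)
        = (\<integral>x. hermite_partial c {..<N} x * hermite_cfun n x \<partial>lborel)"
      using schwartz_hermite by (simp add: regular_def hermite_partial_def)
    also have "\<dots> = (\<Sum>k<N. if k = n then c n else 0)"
      unfolding hermite_coeff_partial[OF schwartz_hermite] hermite_orthonormal by (intro sum.cong) auto
    also have "\<dots> = c n" by (simp add: N_def)
    finally have "q * norm (c n - T (hermite_cfun n)) < q * e"
      using sobolev_coeff_bound[OF N0[of N, unfolded sobolev_dist_def], of n] by (simp add: N_def q_def)
    then show ?thesis using q by simp
  qed
  then have "norm (c n - T (hermite_cfun n)) \<le> 0" by (rule field_le_epsilon[of _ 0, simplified])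
  then show ?thesis by simp
qed

text \<open>A divergent series has the zero functional as its default value, which is the second alternative.\<close>

lemma hermite_suminf_coeff:
  "(\<forall>n. hermite_suminf s c (hermite_cfun n) = c n) \<or> (\<forall>n. hermite_suminf s c (hermite_cfun n) = 0)"
proof (cases "\<exists>T. hermite_sums s c T")
  case True
  then have "hermite_sums s c (hermite_suminf s c)"
    unfolding hermite_suminf_def by (simp add: someI_ex)
  then show ?thesis using hermite_sums_coeff by blast
next
  case False
  then show ?thesis by (simp add: hermite_suminf_def)
qed

text \<open>For a map that is not known to be measurable, \<^const>\<open>distr\<close> is still a measure, with values given either by the
  preimages or by \<open>0\<close>.\<close>

lemma AE_distrI:
  assumes A: "A \<in> sets N" "\<And>u. u \<in> A \<Longrightarrow> P u"
    and f: "AE \<omega> in M. f \<omega> \<in> space N \<longrightarrow> f \<omega> \<in> A"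
  shows "AE u in distr M N f. P u"
proof (rule AE_I)
  define B where "B = space N - A"
  obtain Z where Z: "{\<omega> \<in> space M. \<not> (f \<omega> \<in> space N \<longrightarrow> f \<omega> \<in> A)} \<subseteq> Z" "emeasure M Z = 0" "Z \<in> sets M"
    using f by (rule AE_E)
  have "f -` B \<inter> space M \<subseteq> Z" using Z(1) by (auto simp: B_def)
  then have "emeasure M (f -` B \<inter> space M) = 0"
    using emeasure_mono[of "f -` B \<inter> space M" Z M] Z(2,3) by simp
  then show "emeasure (distr M N f) B = 0"
    unfolding distr_def emeasure_measure_of_conv by simp
  show "B \<in> sets (distr M N f)" using A(1) by (simp add: B_def)
  show "{u \<in> space (distr M N f). \<not> P u} \<subseteq> B" using A(2) by (auto simp: B_def)
qed

theorem mainTheorem5: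
  fixes M :: "'w measure" and g :: "nat \<Rightarrow> 'w \<Rightarrow> complex" and \<sigma> \<theta> t :: real
  assumes "prob_space M"
    and "prob_space.indep_vars M (\<lambda>_. borel) g UNIV"
    and "\<And>n. standard_complex_gaussian M (g n)"
    and "\<sigma> > 0"
    and "\<theta> < 1 / 2"
  shows "AE u in gaussian_law M g \<sigma>.
           \<exists>v. has_square (schroedinger_flow t u) v \<and> sobolev_norm \<theta> v < \<infinity>"
proof -
  interpret gaussian_sequence M g
    using assms by (intro gaussian_sequence.intro gaussian_sequence_axioms.intro)
  define e where "e n = exp (- (\<i> * complex_of_real (t * (2 * real n + 1))))" for n
  define a where "a n = complex_of_real (sqrt 2 / hermite_freq n)" for n
  define c where "c n = e n * a n" for n
  have c: "(norm (c n))\<^sup>2 = 2 / (2 * real n + 1)" for n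
    by (simp add: c_def e_def a_def norm_mult norm_divide power_mult_distrib power_divide hermite_freq_square)
  obtain N where N: "strict_mono N" "N 0 = 0"
    and sN: "summable (\<lambda>j. 2 ^ j * (\<Sum>n\<in>{N j..<N (Suc j)}.
      (norm (c n))\<^sup>2 * (\<integral>x. (hermite_fun n x)\<^sup>2 * japanese_weight x \<partial>lborel)))"
    using lacunary_blocks[OF _ hermite_weights_summable[OF c]]
    by (auto intro!: mult_nonneg_nonneg Bochner_Integration.integral_nonneg)
  define S where "S = sobolev_borel (- \<sigma>)"
  define d where "d u n = e n * u (hermite_cfun n)" for u :: distribution and n
  have [measurable]: "(\<lambda>u. d u n) \<in> borel_measurable S" for n
    unfolding d_def S_def using sobolev_coeff_measurable by measurable
  define A where "A = {u \<in> space S. hermite_control N \<theta> (d u) < \<infinity>}"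
  have "A \<in> sets S"
    unfolding A_def by measurable
  moreover have "\<exists>v. has_square (schroedinger_flow t u) v \<and> sobolev_norm \<theta> v < \<infinity>" if "u \<in> A" for u
  proof (rule hermite_control_finite[OF N])
    show "hermite_control N \<theta> (d u) < \<infinity>" using that by (simp add: A_def)
    show "schroedinger_flow t u \<phi> = (\<Sum>n. d u n * regular (hermite_cfun n) \<phi>)" for \<phi>
      by (simp add: schroedinger_flow_def H_calculus_def hermite_freq_square d_def e_def)
  qed
  moreover have "AE \<omega> in M. hermite_suminf (- \<sigma>) (\<lambda>n. a n * g n \<omega>) \<in> space S
      \<longrightarrow> hermite_suminf (- \<sigma>) (\<lambda>n. a n * g n \<omega>) \<in> A"
    using AE_hermite_control_finite[OF c assms(5) sN]
  proof eventually_elim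
    case (elim \<omega>)
    define u where "u = hermite_suminf (- \<sigma>) (\<lambda>n. a n * g n \<omega>)"
    \<comment> \<open>The functional vanishes at the zero sequence, so the default value is covered as well.\<close>
    consider "d u = (\<lambda>n. c n * g n \<omega>)" | "d u = (\<lambda>n. 0)"
      using hermite_suminf_coeff[of "- \<sigma>" "\<lambda>n. a n * g n \<omega>"]
      unfolding d_def c_def u_def by (auto simp: mult.assoc)
    then have "hermite_control N \<theta> (d u) < \<infinity>"
      using elim by cases (simp_all add: hermite_control_zero)
    then show ?case by (simp add: A_def u_def)
  qed
  ultimately show ?thesis
    unfolding gaussian_law_def S_def a_def by (rule AE_distrI)
qed

end
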